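(* Let $N=1$ and $I=(0,1)$. Assume that the operators $\mathcal{A}_\varepsilon u=-(a_\varepsilon(x)|u'|^{p-2}u')'$ $G$-converge to $\mathcal{A}u=-(a(x)|u'|^{p-2}u')'$ as $\varepsilon\to0^+$, and that $\rho_\varepsilon\rightharpoonup\rho$ weakly-* in $L^\infty(I)$. For each $k\ge1$ let $\lambda_k^\varepsilon$ be the $k$-th eigenvalue of $$ -(a_\varepsilon(x)|u'|^{p-2}u')'=\lambda\rho_\varepsilon|u|^{p-2}u\ \text{ in }I,\qquad u(0)=u(1)=0, $$ and let $\lambda_k$ be the $k$-th eigenvalue of $$ -(a(x)|u'|^{p-2}u')'=\lambda\rho|u|^{p-2}u\ \text{ in }I,\qquad u(0)=u(1)=0 . $$ Then $$ \lim_{\varepsilon\to0}\lambda_k^\varepsilon=\lambda_k . $$ Moreover, if $u_k^\varepsilon$ is an eigenfunction associated to $\lambda_k^\varepsilon$ normalized by $\|u_k^\varepsilon\|_{L^p(I)}=1$, then, up to a subsequence, $u_k^\varepsilon$ converges weakly in $W^{1,p}_0(I)$ to $u_k$, an eigenfunction associated to $\lambda_k$.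
   Context: Here $1<p<\infty$ and $p'=p/(p-1)$. The coefficients and weights are measurable and satisfy, with constants independent of $\varepsilon$, $0<\alpha\le a_\varepsilon(x)\le\beta<\infty$ and $0<\rho^-\le\rho_\varepsilon(x)\le\rho^+<\infty$ for a.e. $x\in I$; the limit coefficient $a$ is likewise bounded and bounded away from $0$. $G$-convergence: $\mathcal{A}_\varepsilon$ $G$-converges to $\mathcal{A}$ if for every $f\in W^{-1,p'}(I)$ and every $f_\varepsilon\to f$ strongly in $W^{-1,p'}(I)$, the weak solutions $u^\varepsilon\in W^{1,p}_0(I)$ of $\mathcal{A}_\varepsilon u^\varepsilon=f_\varepsilon$ satisfy $u^\varepsilon\rightharpoonup u$ weakly in $W^{1,p}_0(I)$ and $a_\varepsilon|(u^\varepsilon)'|^{p-2}(u^\varepsilon)'\rightharpoonup a|u'|^{p-2}u'$ weakly in $L^{p'}(I)$, where $u\in W^{1,p}_0(I)$ is the weak solution of $\mathcal{A}u=f$. Eigenvalues. For a problem $-(b|u'|^{p-2}u')'=\lambda\sigma|u|^{p-2}u$ in $I$, $u(0)=u(1)=0$, the $k$-th eigenvalue is the variational one, $$\inf_{C\in\mathcal{C}_k}\sup_{v\in C}\frac{\int_I b|v'|^p\,dx}{\int_I\sigma|v|^p\,dx},$$ where $\mathcal{C}_k$ is the family of closed symmetric ($C=-C$) sets $C\subset W^{1,p}_0(I)\setminus\{0\}$ of Krasnoselskii genus at least $k$ (the genus is the least $m$ for which there is an odd continuous map $C\to\mathbb{R}^m\setminus\{0\}$, $\infty$ if none exists, $0$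 for $C=\emptyset$). An eigenfunction associated to $\lambda$ is a nontrivial weak solution in $W^{1,p}_0(I)$. *)

theory Defs
  imports "HOL-Analysis.Analysis"
begin

section \<open>Function spaces on the interval (0,1)\<close>

text \<open>
  Elements of the spaces below are represented by functions on the real line; only their values
  almost everywhere on (0,1) matter. The (semi)norms, the bounded functionals and the topologies
  do not distinguish functions that agree almost everywhere on (0,1), so working with
  representatives amounts to working with equivalence classes.
\<close>

abbreviation unit_meas :: "real measure" where
  "unit_meas \<equiv> lebesgue_on {0<..<1}"

definition Lp_space :: "real \<Rightarrow> (real \<Rightarrow> real) set" where
  "Lp_space p = {u \<in> borel_measurable unit_meas. integrable unit_meas (\<lambda>x. \<bar>u x\<bar> powr p)}"

definition Lp_norm :: "real \<Rightarrow> (real \<Rightarrow> real) \<Rightarrow> real" where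
  "Lp_norm p u = (\<integral>x. \<bar>u x\<bar> powr p \<partial>unit_meas) powr (1 / p)"

definition Linf_space :: "(real \<Rightarrow> real) set" where
  "Linf_space = {u \<in> borel_measurable unit_meas. \<exists>B. AE x in unit_meas. \<bar>u x\<bar> \<le> B}"

definition conj_exp :: "real \<Rightarrow> real" where
  "conj_exp p = p / (p - 1)"

definition test_fun :: "(real \<Rightarrow> real) \<Rightarrow> bool" where
  "test_fun \<phi> \<longleftrightarrow>
     (\<forall>n. ((deriv ^^ n) \<phi>) differentiable_on UNIV) \<and>
     (\<exists>K. compact K \<and> K \<subseteq> {0<..<1} \<and> (\<forall>x. x \<notin> K \<longrightarrow> \<phi> x = 0))"

definition loc_integrable :: "(real \<Rightarrow> real) \<Rightarrow> bool" where
  "loc_integrable u \<longleftrightarrow> (\<forall>K. compact K \<and> K \<subseteq> {0<..<1} \<longrightarrow> set_integrable lebesgue K u)"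

definition is_weak_deriv :: "(real \<Rightarrow> real) \<Rightarrow> (real \<Rightarrow> real) \<Rightarrow> bool" where
  "is_weak_deriv u g \<longleftrightarrow> loc_integrable u \<and> loc_integrable g \<and>
     (\<forall>\<phi>. test_fun \<phi> \<longrightarrow>
        (\<integral>x. u x * deriv \<phi> x \<partial>unit_meas) = - (\<integral>x. g x * \<phi> x \<partial>unit_meas))"

text \<open>The weak derivative is unique only up to a null set of (0,1); an arbitrary version is chosen.\<close>

definition wderiv :: "(real \<Rightarrow> real) \<Rightarrow> real \<Rightarrow> real" where
  "wderiv u = (SOME g. is_weak_deriv u g)"

definition W1p :: "real \<Rightarrow> (real \<Rightarrow> real) set" where
  "W1p p = {u \<in> Lp_space p. \<exists>g \<in> Lp_space p. is_weak_deriv u g}"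

definition W1p_norm :: "real \<Rightarrow> (real \<Rightarrow> real) \<Rightarrow> real" where
  "W1p_norm p u =
     ((\<integral>x. \<bar>u x\<bar> powr p \<partial>unit_meas) + (\<integral>x. \<bar>wderiv u x\<bar> powr p \<partial>unit_meas)) powr (1 / p)"

definition W01p :: "real \<Rightarrow> (real \<Rightarrow> real) set" where
  "W01p p = {u \<in> W1p p. \<exists>\<phi>. (\<forall>n. test_fun (\<phi> n)) \<and>
                            (\<lambda>n::nat. W1p_norm p (\<lambda>x. u x - \<phi> n x)) \<longlonglongrightarrow> 0}"


section \<open>Duality, weak convergence and the norm topology\<close>

text \<open>
  In this section a space is given by a linear space X of functions (its carrier) together with
  a seminorm N. Functionals are total functions of which only the values on X matter.
\<close>

definition dual_space ::
    "(real \<Rightarrow> real) set \<Rightarrow> ((real \<Rightarrow> real) \<Rightarrow> real) \<Rightarrow> ((real \<Rightarrow> real) \<Rightarrow> real) set" where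
  "dual_space X N = {f.
     (\<forall>u\<in>X. \<forall>v\<in>X. f (\<lambda>x. u x + v x) = f u + f v) \<and>
     (\<forall>c. \<forall>u\<in>X. f (\<lambda>x. c * u x) = c * f u) \<and>
     (\<exists>B. \<forall>u\<in>X. \<bar>f u\<bar> \<le> B * N u)}"

definition dual_norm ::
    "(real \<Rightarrow> real) set \<Rightarrow> ((real \<Rightarrow> real) \<Rightarrow> real) \<Rightarrow> ((real \<Rightarrow> real) \<Rightarrow> real) \<Rightarrow> real" where
  "dual_norm X N f = (SUP u\<in>{u \<in> X. N u \<le> 1}. \<bar>f u\<bar>)"

definition weak_conv ::
    "(real \<Rightarrow> real) set \<Rightarrow> ((real \<Rightarrow> real) \<Rightarrow> real) \<Rightarrow>
     ('i \<Rightarrow> real \<Rightarrow> real) \<Rightarrow> (real \<Rightarrow> real) \<Rightarrow> 'i filter \<Rightarrow> bool" where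
  "weak_conv X N w w0 F \<longleftrightarrow> w0 \<in> X \<and> (\<forall>\<^sub>F i in F. w i \<in> X) \<and>
     (\<forall>f \<in> dual_space X N. ((\<lambda>i. f (w i)) \<longlongrightarrow> f w0) F)"

abbreviation weak_conv_W01p ::
    "real \<Rightarrow> ('i \<Rightarrow> real \<Rightarrow> real) \<Rightarrow> (real \<Rightarrow> real) \<Rightarrow> 'i filter \<Rightarrow> bool" where
  "weak_conv_W01p p \<equiv> weak_conv (W01p p) (W1p_norm p)"

abbreviation weak_conv_Lp ::
    "real \<Rightarrow> ('i \<Rightarrow> real \<Rightarrow> real) \<Rightarrow> (real \<Rightarrow> real) \<Rightarrow> 'i filter \<Rightarrow> bool" where
  "weak_conv_Lp q \<equiv> weak_conv (Lp_space q) (Lp_norm q)"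

definition weak_star_conv_Linf ::
    "('i \<Rightarrow> real \<Rightarrow> real) \<Rightarrow> (real \<Rightarrow> real) \<Rightarrow> 'i filter \<Rightarrow> bool" where
  "weak_star_conv_Linf w w0 F \<longleftrightarrow> w0 \<in> Linf_space \<and> (\<forall>\<^sub>F i in F. w i \<in> Linf_space) \<and>
     (\<forall>g \<in> Lp_space 1. ((\<lambda>i. \<integral>x. w i x * g x \<partial>unit_meas) \<longlongrightarrow> (\<integral>x. w0 x * g x \<partial>unit_meas)) F)"

text \<open>\<open>W_dual p\<close> is the space usually denoted by W with exponents -1 and p' = \<open>conj_exp p\<close>.\<close>

abbreviation W_dual :: "real \<Rightarrow> ((real \<Rightarrow> real) \<Rightarrow> real) set" where
  "W_dual p \<equiv> dual_space (W01p p) (W1p_norm p)"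

definition strong_conv_W_dual ::
    "real \<Rightarrow> ('i \<Rightarrow> (real \<Rightarrow> real) \<Rightarrow> real) \<Rightarrow> ((real \<Rightarrow> real) \<Rightarrow> real) \<Rightarrow> 'i filter \<Rightarrow> bool" where
  "strong_conv_W_dual p fs f F \<longleftrightarrow>
     ((\<lambda>i. dual_norm (W01p p) (W1p_norm p) (\<lambda>u. fs i u - f u)) \<longlongrightarrow> 0) F"

definition W01p_topology :: "real \<Rightarrow> (real \<Rightarrow> real) topology" where
  "W01p_topology p = topology (\<lambda>S. S \<subseteq> W01p p \<and>
     (\<forall>u\<in>S. \<exists>r>0. \<forall>v\<in>W01p p. W1p_norm p (\<lambda>x. v x - u x) < r \<longrightarrow> v \<in> S))"

lemma openin_W01p_topology:
  "openin (W01p_topology p) S \<longleftrightarrow> S \<subseteq> W01p p \<and>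
     (\<forall>u\<in>S. \<exists>r>0. \<forall>v\<in>W01p p. W1p_norm p (\<lambda>x. v x - u x) < r \<longrightarrow> v \<in> S)"
proof -
  let ?P = "\<lambda>S. S \<subseteq> W01p p \<and>
     (\<forall>u\<in>S. \<exists>r>0. \<forall>v\<in>W01p p. W1p_norm p (\<lambda>x. v x - u x) < r \<longrightarrow> v \<in> S)"
  have 1: "?P (S \<inter> T)" if S: "?P S" and T: "?P T" for S T
  proof (intro conjI ballI)
    show "S \<inter> T \<subseteq> W01p p" using S by blast
    fix u assume "u \<in> S \<inter> T"
    then obtain r s where "r > 0" "s > 0"
      and "\<forall>v\<in>W01p p. W1p_norm p (\<lambda>x. v x - u x) < r \<longrightarrow> v \<in> S"
      and "\<forall>v\<in>W01p p. W1p_norm p (\<lambda>x. v x - u x) < s \<longrightarrow> v \<in> T"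
      using S T by (metis IntD1 IntD2)
    then show "\<exists>r>0. \<forall>v\<in>W01p p. W1p_norm p (\<lambda>x. v x - u x) < r \<longrightarrow> v \<in> S \<inter> T"
      by (intro exI[of _ "min r s"]) auto
  qed
  have 2: "?P (\<Union>\<K>)" if \<K>: "\<forall>K\<in>\<K>. ?P K" for \<K>
  proof (intro conjI ballI)
    show "\<Union>\<K> \<subseteq> W01p p" using \<K> by blast
    fix u assume "u \<in> \<Union>\<K>"
    then obtain K where K: "K \<in> \<K>" "u \<in> K" by blast
    then obtain r where "r > 0" and r: "\<forall>v\<in>W01p p. W1p_norm p (\<lambda>x. v x - u x) < r \<longrightarrow> v \<in> K"
      using \<K> by blast
    with K show "\<exists>r>0. \<forall>v\<in>W01p p. W1p_norm p (\<lambda>x. v x - u x) < r \<longrightarrow> v \<in> \<Union>\<K>"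
      by (intro exI[of _ r]) auto
  qed
  have "istopology ?P"
    unfolding istopology_def using 1 2 by presburger
  then show ?thesis
    unfolding W01p_topology_def by (simp only: topology_inverse')
qed

lemma topspace_W01p_topology: "topspace (W01p_topology p) = W01p p"
proof
  show "topspace (W01p_topology p) \<subseteq> W01p p"
    using openin_W01p_topology openin_topspace by blast
  have "openin (W01p_topology p) (W01p p)"
    unfolding openin_W01p_topology using zero_less_one by blast
  then show "W01p p \<subseteq> topspace (W01p_topology p)"
    by (rule openin_subset)
qed


section \<open>Weak solutions and G-convergence\<close>

definition flux :: "real \<Rightarrow> (real \<Rightarrow> real) \<Rightarrow> (real \<Rightarrow> real) \<Rightarrow> real \<Rightarrow> real" where
  "flux p a u = (\<lambda>x. a x * (\<bar>wderiv u x\<bar> powr (p - 2) * wderiv u x))"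

definition weak_solution ::
    "real \<Rightarrow> (real \<Rightarrow> real) \<Rightarrow> ((real \<Rightarrow> real) \<Rightarrow> real) \<Rightarrow> (real \<Rightarrow> real) \<Rightarrow> bool" where
  "weak_solution p a f u \<longleftrightarrow> u \<in> W01p p \<and>
     (\<forall>v\<in>W01p p. (\<integral>x. flux p a u x * wderiv v x \<partial>unit_meas) = f v)"

definition G_converges ::
    "real \<Rightarrow> (real \<Rightarrow> real \<Rightarrow> real) \<Rightarrow> (real \<Rightarrow> real) \<Rightarrow> bool" where
  "G_converges p a_eps a \<longleftrightarrow>
     (\<forall>f fs us u. f \<in> W_dual p \<longrightarrow> (\<forall>\<epsilon>>0. fs \<epsilon> \<in> W_dual p) \<longrightarrow>
        strong_conv_W_dual p fs f (at_right 0) \<longrightarrow>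
        (\<forall>\<epsilon>>0. weak_solution p (a_eps \<epsilon>) (fs \<epsilon>) (us \<epsilon>)) \<longrightarrow>
        weak_solution p a f u \<longrightarrow>
        weak_conv_W01p p us u (at_right 0) \<and>
        weak_conv_Lp (conj_exp p) (\<lambda>\<epsilon>. flux p (a_eps \<epsilon>) (us \<epsilon>)) (flux p a u) (at_right 0))"


section \<open>Variational eigenvalues\<close>

text \<open>
  \<open>Euclidean_space m\<close> is the space of real sequences vanishing from index m on, so the empty set
  is the only one of genus 0. The infimum of the empty set of \<open>enat\<close> is \<open>\<infinity>\<close>.
\<close>

definition genus :: "real \<Rightarrow> (real \<Rightarrow> real) set \<Rightarrow> enat" where
  "genus p C = Inf {enat m | m. \<exists>h.
     continuous_map (subtopology (W01p_topology p) C) (Euclidean_space m) h \<and>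
     (\<forall>u\<in>C. h u \<noteq> (\<lambda>i. 0)) \<and>
     (\<forall>u\<in>C. h (\<lambda>x. - u x) = (\<lambda>i. - h u i))}"

definition genus_family :: "real \<Rightarrow> nat \<Rightarrow> (real \<Rightarrow> real) set set" where
  "genus_family p k = {C. closedin (W01p_topology p) C \<and>
     (\<forall>u\<in>C. \<not> (AE x in unit_meas. u x = 0)) \<and>
     (\<forall>u\<in>C. (\<lambda>x. - u x) \<in> C) \<and>
     enat k \<le> genus p C}"

definition rayleigh ::
    "real \<Rightarrow> (real \<Rightarrow> real) \<Rightarrow> (real \<Rightarrow> real) \<Rightarrow> (real \<Rightarrow> real) \<Rightarrow> real" where
  "rayleigh p b \<sigma> v =
     (\<integral>x. b x * \<bar>wderiv v x\<bar> powr p \<partial>unit_meas) / (\<integral>x. \<sigma> x * \<bar>v x\<bar> powr p \<partial>unit_meas)"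

text \<open>
  The quotient may be unbounded on some of the closed sets C, hence the extended reals; for
  coefficients bounded and bounded away from 0 the resulting eigenvalues are finite.
\<close>

definition eigenvalue :: "real \<Rightarrow> (real \<Rightarrow> real) \<Rightarrow> (real \<Rightarrow> real) \<Rightarrow> nat \<Rightarrow> ereal" where
  "eigenvalue p b \<sigma> k = (INF C\<in>genus_family p k. SUP v\<in>C. ereal (rayleigh p b \<sigma> v))"

definition eigenfunction ::
    "real \<Rightarrow> (real \<Rightarrow> real) \<Rightarrow> (real \<Rightarrow> real) \<Rightarrow> ereal \<Rightarrow> (real \<Rightarrow> real) \<Rightarrow> bool" where
  "eigenfunction p b \<sigma> \<Lambda> u \<longleftrightarrow> \<not> (AE x in unit_meas. u x = 0) \<and>
     (\<exists>l. \<Lambda> = ereal l \<and>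
        weak_solution p b (\<lambda>v. l * (\<integral>x. \<sigma> x * (\<bar>u x\<bar> powr (p - 2) * u x) * v x \<partial>unit_meas)) u)"

end

theory Submission
  imports Defs "HOL-Complex_Analysis.Great_Picard"
begin

text \<open>
  In dimension one the operator can be integrated once. The flux of a weak solution is a primitive
  of the right-hand side up to a constant, and the gradient is recovered from the flux \<open>\<xi>\<close> as
  \<open>b * sgn \<xi> * \<bar>\<xi>\<bar> powr (1/(p-1))\<close>, where \<open>b = a powr (-1/(p-1))\<close> is called the compliance of the
  coefficient. Testing G-convergence with a flux that takes two values shows that the integrals of
  the compliances over every interval \<open>(0,x)\<close> converge (\<open>G_converges_imp_prim_compliance\<close>).

  Eigenvalues are compared through an interpolation. Given \<open>v\<close> and a partition into \<open>M\<close> equal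
  cells, let \<open>w\<close> have the same nodal values as \<open>v\<close> and a gradient that on each cell is a constant
  multiple of the compliance. Among all functions with these nodal values, \<open>w\<close> has the least
  energy, and the energy of a cell is \<open>\<bar>\<Delta>v\<bar> powr p / B powr (p-1)\<close> with \<open>B\<close> the integral of
  the compliance. Hence, if two problems have close cell integrals of their compliances, the energy
  of \<open>w\<close> in the second problem hardly exceeds the energy of \<open>v\<close> in the first. Both functions
  are Hoelder continuous and agree at the nodes, so their masses are close as soon as the cell
  integrals of the weights are. Since \<open>v \<mapsto> w\<close> is linear and continuous, it carries an admissible
  set of genus at least \<open>k\<close> into a sublevel set of genus at least \<open>k\<close> of the other problem
  (\<open>eigenvalue_stability\<close>). The comparison is symmetric in the two problems, which gives both
  inequalities for the limit of the eigenvalues (\<open>eigenvalue_tendsto\<close>).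

  Normalized eigenfunctions are bounded in the Sobolev space, because energy equals eigenvalue times
  mass. The theorem of Arzela and Ascoli gives a subsequence that converges uniformly, and along it
  the right-hand sides of the eigenvalue equations converge strongly in the dual space, because
  their primitives converge. G-convergence then yields weak convergence to the solution of the limit
  equation, and point evaluations, which are bounded functionals, identify that solution with the
  uniform limit (\<open>eigenfunctions_converge\<close>).

  All this rests on a concrete description of the Sobolev space: its elements are primitives of
  functions of integral zero (\<open>W01pD\<close>), and every such primitive with a bounded gradient is an
  element (\<open>prim_in_W01p\<close>). The first fact holds because test functions are primitives of their
  derivatives; the second one and the uniqueness of weak derivatives are obtained by approximation
  with polynomials multiplied by smooth cutoffs.
\<close>

section \<open>Smooth functions and cutoffs\<close>

primrec times_differentiable :: "nat \<Rightarrow> (real \<Rightarrow> real) \<Rightarrow> bool" where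
  "times_differentiable 0 f \<longleftrightarrow> f differentiable_on UNIV"
| "times_differentiable (Suc n) f \<longleftrightarrow> f differentiable_on UNIV \<and> times_differentiable n (deriv f)"

definition smooth :: "(real \<Rightarrow> real) \<Rightarrow> bool" where
  "smooth f \<longleftrightarrow> (\<forall>n. times_differentiable n f)"

lemma times_differentiable_iff:
  "times_differentiable n f \<longleftrightarrow> (\<forall>m\<le>n. ((deriv ^^ m) f) differentiable_on UNIV)"
proof (induction n arbitrary: f)
  case (Suc n)
  have "(\<forall>m\<le>Suc n. ((deriv ^^ m) f) differentiable_on UNIV) \<longleftrightarrow>
     f differentiable_on UNIV \<and> (\<forall>m\<le>n. ((deriv ^^ m) (deriv f)) differentiable_on UNIV)"
  proof (intro iffI conjI allI impI)
    fix m assume "\<forall>m\<le>Suc n. ((deriv ^^ m) f) differentiable_on UNIV" "m \<le> n"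
    then show "((deriv ^^ m) (deriv f)) differentiable_on UNIV"
      by (metis Suc_le_mono funpow_swap1 funpow.simps(2) comp_apply)
  next
    assume "\<forall>m\<le>Suc n. ((deriv ^^ m) f) differentiable_on UNIV"
    then show "f differentiable_on UNIV" by (metis funpow_0 zero_le)
  next
    fix m assume a: "f differentiable_on UNIV \<and> (\<forall>m\<le>n. ((deriv ^^ m) (deriv f)) differentiable_on UNIV)"
      and m: "m \<le> Suc n"
    show "((deriv ^^ m) f) differentiable_on UNIV"
    proof (cases m)
      case 0 then show ?thesis using a by simp
    next
      case (Suc k)
      then show ?thesis using a m by (simp add: funpow_swap1)
    qed
  qed
  with Suc show ?case by simp
qed simp

lemma smooth_iff: "smooth f \<longleftrightarrow> (\<forall>n. ((deriv ^^ n) f) differentiable_on UNIV)"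
  unfolding smooth_def times_differentiable_iff by auto

lemma differentiable_on_UNIV_DERIV:
  fixes f :: "real \<Rightarrow> real"
  assumes "f differentiable_on UNIV"
  shows "(f has_field_derivative deriv f x) (at x)"
proof -
  have "f differentiable (at x)" using assms by (auto simp: differentiable_on_def)
  then obtain d where "(f has_field_derivative d) (at x)"
    using real_differentiable_def by blast
  then show ?thesis by (metis DERIV_imp_deriv)
qed

lemma DERIV_UNIV_imp:
  fixes f :: "real \<Rightarrow> real"
  assumes "\<And>x. (f has_field_derivative f' x) (at x)"
  shows "f differentiable_on UNIV" "deriv f = f'"
  using assms by (auto simp: differentiable_on_def real_differentiable_def intro: DERIV_imp_deriv)

lemma times_differentiable_Suc_imp: "times_differentiable (Suc n) f \<Longrightarrow> times_differentiable n f"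
  unfolding times_differentiable_iff by auto

lemma times_differentiable_add:
  "times_differentiable n f \<Longrightarrow> times_differentiable n g \<Longrightarrow> times_differentiable n (\<lambda>x. f x + g x)"
proof (induction n arbitrary: f g)
  case 0 then show ?case by (auto intro: differentiable_on_add)
next
  case (Suc n)
  have "deriv (\<lambda>x. f x + g x) = (\<lambda>x. deriv f x + deriv g x)"
    using Suc.prems by (intro DERIV_UNIV_imp(2) DERIV_add differentiable_on_UNIV_DERIV) auto
  then show ?case using Suc by (auto intro: differentiable_on_add)
qed

text \<open>
  The induction works on the number of derivatives because the product rule involves only the
  factors and their first derivatives.
\<close>

lemma times_differentiable_mult:
  "times_differentiable n f \<Longrightarrow> times_differentiable n g \<Longrightarrow> times_differentiable n (\<lambda>x. f x * g x)"
proof (induction n arbitrary: f g)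
  case 0 then show ?case by (auto intro: differentiable_on_mult)
next
  case (Suc n)
  have "deriv (\<lambda>x. f x * g x) = (\<lambda>x. deriv f x * g x + deriv g x * f x)"
    using Suc.prems by (intro DERIV_UNIV_imp(2) DERIV_mult differentiable_on_UNIV_DERIV) auto
  then show ?case using Suc times_differentiable_Suc_imp[OF Suc.prems(1)] times_differentiable_Suc_imp[OF Suc.prems(2)]
    by (auto intro!: differentiable_on_mult times_differentiable_add)
qed

lemma times_differentiable_const: "times_differentiable n (\<lambda>x. c)"
proof (induction n arbitrary: c)
  case (Suc n)
  have "deriv (\<lambda>x. c) = (\<lambda>x. 0)" by (rule DERIV_UNIV_imp) auto
  with Suc show ?case by (auto)
qed auto

lemma smooth_add: "smooth f \<Longrightarrow> smooth g \<Longrightarrow> smooth (\<lambda>x. f x + g x)"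
  and smooth_mult: "smooth f \<Longrightarrow> smooth g \<Longrightarrow> smooth (\<lambda>x. f x * g x)"
  and smooth_const: "smooth (\<lambda>x. c)"
  by (auto simp: smooth_def times_differentiable_add times_differentiable_mult times_differentiable_const)

lemma smooth_by_deriv:
  assumes "\<And>x. (f has_field_derivative f' x) (at x)" "smooth f'"
  shows "smooth f"
proof -
  have "times_differentiable n f" for n
    using DERIV_UNIV_imp[OF assms(1)] assms(2) by (cases n) (auto simp: smooth_def)
  then show ?thesis by (simp add: smooth_def)
qed

lemma smooth_deriv: "smooth f \<Longrightarrow> smooth (deriv f)"
  by (metis smooth_def times_differentiable.simps(2))

lemma smooth_DERIV: "smooth f \<Longrightarrow> (f has_field_derivative deriv f x) (at x)"
  using differentiable_on_UNIV_DERIV smooth_def times_differentiable.simps(1) by blast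

lemma smooth_continuous: "smooth f \<Longrightarrow> continuous_on A f"
  by (meson DERIV_isCont continuous_at_imp_continuous_on smooth_DERIV)

lemma smooth_affine: assumes "smooth f" shows "smooth (\<lambda>x. f (c * x + d))"
proof -
  have "times_differentiable n f \<Longrightarrow> times_differentiable n (\<lambda>x. f (c * x + d))" for n f
  proof (induction n arbitrary: f)
    case 0
    have "((\<lambda>x. f (c * x + d)) has_field_derivative (deriv f (c * x + d) * c)) (at x)" for x
      by (rule DERIV_chain2[where g = "\<lambda>x. c * x + d"], rule differentiable_on_UNIV_DERIV)
        (use 0 in \<open>auto intro!: derivative_eq_intros\<close>)
    from DERIV_UNIV_imp(1)[OF this] show ?case by simp
  next
    case (Suc n)
    have "((\<lambda>x. f (c * x + d)) has_field_derivative (deriv f (c * x + d) * c)) (at x)" for x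
      by (rule DERIV_chain2[where g = "\<lambda>x. c * x + d"], rule differentiable_on_UNIV_DERIV)
        (use Suc in \<open>auto intro!: derivative_eq_intros\<close>)
    from DERIV_UNIV_imp[OF this] Suc show ?case
      by (auto intro!: times_differentiable_mult times_differentiable_const)
  qed
  with assms show ?thesis by (auto simp: smooth_def)
qed

lemma smooth_id: "smooth (\<lambda>x. x)"
  by (rule smooth_by_deriv[OF DERIV_ident smooth_const])

lemma smooth_real_polynomial_function:
  "real_polynomial_function (f :: real \<Rightarrow> real) \<Longrightarrow> smooth f"
proof (induction rule: real_polynomial_function.induct)
  case (linear f)
  then have "f x = f 1 * x" for x
    using linear_scale[OF bounded_linear.linear, of f x 1] by simp
  then have "f = (\<lambda>x. f 1 * x)" by blast
  moreover have "smooth (\<lambda>x. f 1 * x)" by (intro smooth_mult smooth_const smooth_id)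
  ultimately show ?case by simp
qed (auto intro: smooth_add smooth_mult smooth_const)

text \<open>
  The functions \<open>q(1/x) exp(-1/x)\<close> with \<open>q\<close> a polynomial, extended by zero: this family contains
  the classical flat function \<open>exp(-1/x)\<close> and is closed under differentiation, which is why the
  flat function is smooth.
\<close>

definition flat :: "real poly \<Rightarrow> real \<Rightarrow> real" where
  "flat q x = (if x > 0 then poly q (1/x) * exp (-(1/x)) else 0)"

lemma poly_times_exp_tendsto_0: "((\<lambda>t::real. poly q t * exp (-t)) \<longlongrightarrow> 0) at_top"
proof -
  have "((\<lambda>t::real. \<Sum>i\<le>degree q. coeff q i * (t ^ i / exp t)) \<longlongrightarrow> (\<Sum>i\<le>degree q. coeff q i * 0)) at_top"
    by (intro tendsto_sum tendsto_mult tendsto_const tendsto_power_div_exp_0)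
  then show ?thesis
    by (simp add: poly_altdef sum_distrib_right exp_minus divide_inverse mult.assoc)
qed

lemma flat_DERIV: "(flat q has_field_derivative flat ([:0,0,1:] * (q - pderiv q)) x) (at x)"
proof -
  consider "x > 0" | "x < 0" | "x = 0" by linarith
  then show ?thesis
  proof cases
    case 1
    have "((\<lambda>x. poly q (1/x) * exp (-(1/x))) has_field_derivative flat ([:0,0,1:] * (q - pderiv q)) x) (at x)"
      using 1 unfolding flat_def
      by (auto intro!: derivative_eq_intros DERIV_chain'[OF _ poly_DERIV] simp: field_simps power2_eq_square)
    moreover have "eventually (\<lambda>y. flat q y = poly q (1/y) * exp (-(1/y))) (nhds x)"
      using eventually_nhds_in_open[of "{0<..}" x] 1 by (auto simp: flat_def elim!: eventually_mono)
    ultimately show ?thesis by (subst DERIV_cong_ev[OF refl _ refl]) auto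
  next
    case 2
    have "eventually (\<lambda>y. flat q y = 0) (nhds x)"
      using eventually_nhds_in_open[of "{..<0}" x] 2 by (auto simp: flat_def elim!: eventually_mono)
    then have "(flat q has_field_derivative 0) (at x)" by (subst DERIV_cong_ev[OF refl _ refl]) auto
    then show ?thesis using 2 by (simp add: flat_def)
  next
    case 3
    have "((\<lambda>h. flat q h / h) \<longlongrightarrow> 0) (at_right 0)"
    proof -
      have "((\<lambda>t::real. poly (pCons 0 q) t * exp (-t)) \<longlongrightarrow> 0) at_top"
        by (rule poly_times_exp_tendsto_0)
      then have "((\<lambda>h::real. poly (pCons 0 q) (inverse h) * exp (-(inverse h))) \<longlongrightarrow> 0) (at_right 0)"
        using filterlim_compose filterlim_inverse_at_top_right by blast
      moreover have "eventually (\<lambda>h. poly (pCons 0 q) (inverse h) * exp (-(inverse h)) = flat q h / h) (at_right 0)"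
        using eventually_at_right_less[of 0] by eventually_elim (auto simp: flat_def divide_simps)
      ultimately show ?thesis by (rule Lim_transform_eventually)
    qed
    moreover have "((\<lambda>h. flat q h / h) \<longlongrightarrow> 0) (at_left 0)"
    proof -
      have "eventually (\<lambda>h. 0 = flat q h / h) (at_left 0)"
        by (auto simp: flat_def eventually_at_filter)
      then show ?thesis using Lim_transform_eventually tendsto_const by fast
    qed
    ultimately have "((\<lambda>h. flat q h / h) \<longlongrightarrow> 0) (at 0)" by (simp add: filterlim_split_at)
    then show ?thesis using 3 by (simp add: DERIV_def flat_def)
  qed
qed

lemma smooth_flat: "smooth (flat q)"
proof -
  have "times_differentiable n (flat q)" for n q
    by (induction n arbitrary: q)
      (use DERIV_UNIV_imp[OF flat_DERIV] in auto)
  then show ?thesis by (simp add: smooth_def)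
qed

text \<open>
  Smooth, supported in \<open>[1/n, 1-1/n]\<close>, and converging to 1 on \<open>(0,1)\<close>.
\<close>

definition cutoff :: "nat \<Rightarrow> real \<Rightarrow> real" where
  "cutoff n x = flat 1 (real n * x - 1) * flat 1 (real n * (1 - x) - 1)"

lemma smooth_cutoff: "smooth (cutoff n)"
proof -
  have "cutoff n = (\<lambda>x. flat 1 (real n * x + (-1)) * flat 1 ((- real n) * x + (real n - 1)))"
    by (auto simp: cutoff_def algebra_simps)
  then show ?thesis using smooth_mult[OF smooth_affine[OF smooth_flat] smooth_affine[OF smooth_flat]] by presburger
qed

lemma cutoff_range: "0 \<le> cutoff n x" "cutoff n x \<le> 1"
  by (auto simp: cutoff_def flat_def mult_le_one)

lemma cutoff_eq_0: "x \<notin> {1/real (Suc n)..1-1/real (Suc n)} \<Longrightarrow> cutoff (Suc n) x = 0"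
  by (auto simp: cutoff_def flat_def field_simps)

lemma cutoff_pos: "x \<in> {0<..<1} \<Longrightarrow> 1 < real n * x \<Longrightarrow> 1 < real n * (1-x) \<Longrightarrow> 0 < cutoff n x"
  by (auto simp: cutoff_def flat_def)

lemma cutoff_tendsto: assumes "x \<in> {0<..<1}" shows "(\<lambda>n. cutoff n x) \<longlonglongrightarrow> 1"
proof -
  have *: "(\<lambda>n. flat 1 (real n * y - 1)) \<longlonglongrightarrow> 1" if "y > 0" for y
  proof -
    have top: "filterlim (\<lambda>n. real n * y - 1) at_top sequentially"
      using filterlim_tendsto_add_at_top[OF tendsto_const[of "-1"] filterlim_at_top_mult_tendsto_pos[OF tendsto_const that filterlim_real_sequentially]] by (simp add: add.commute)
    have "(\<lambda>n. exp (-(1/(real n * y - 1)))) \<longlonglongrightarrow> exp (-0)"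
      by (intro tendsto_intros tendsto_divide_0[OF tendsto_const] filterlim_at_top_imp_at_infinity top)
    moreover have "eventually (\<lambda>n. exp (-(1/(real n * y - 1))) = flat 1 (real n * y - 1)) sequentially"
      using eventually_compose_filterlim[OF eventually_gt_at_top[of 0] top]
      by eventually_elim (auto simp: flat_def)
    ultimately show ?thesis using Lim_transform_eventually by fastforce
  qed
  show ?thesis unfolding cutoff_def
    using tendsto_mult[OF *[of x] *[of "1-x"]] assms by simp
qed

lemma cutoff_mult_test_fun: 
  assumes "smooth f" shows "test_fun (\<lambda>x. cutoff (Suc n) x * f x)"
proof -
  have "\<exists>K. compact K \<and> K \<subseteq> {0<..<1} \<and> (\<forall>x. x \<notin> K \<longrightarrow> cutoff (Suc n) x * f x = 0)"
  proof (intro exI[of _ "{1/real (Suc n)..1-1/real (Suc n)}"] conjI allI impI)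
    have "0 < 1/real (Suc n)" by simp
    then show "{1/real (Suc n)..1-1/real (Suc n)} \<subseteq> {0<..<1}"
      by (intro subsetI) (simp only: atLeastAtMost_iff greaterThanLessThan_iff, linarith)
    fix x assume "x \<notin> {1/real (Suc n)..1-1/real (Suc n)}"
    then have "cutoff (Suc n) x = 0" by (rule cutoff_eq_0)
    then show "cutoff (Suc n) x * f x = 0" by simp
  qed (rule compact_Icc)
  then show ?thesis
    using smooth_mult[OF smooth_cutoff assms] by (auto simp: test_fun_def smooth_iff)
qed

section \<open>Integrals and primitives on the unit interval\<close>

lemma unit_finite_measure: "finite_measure unit_meas"
  by (rule finite_measure_lebesgue_on) auto

interpretation unit_meas: finite_measure unit_meas
  by (rule unit_finite_measure)

lemma measure_unit [simp]: "measure unit_meas {0<..<1} = 1"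
  by (simp add: measure_restrict_space)

lemma integral_unit_const [simp]: "(\<integral>x. c \<partial>unit_meas) = (c::real)"
  by (simp add: measure_restrict_space)

lemma AE_unitI: "(\<And>x. 0 < x \<Longrightarrow> x < 1 \<Longrightarrow> P x) \<Longrightarrow> AE x in unit_meas. P x"
  by (rule AE_I2) auto

lemma borel_measurable_unit:
  "f \<in> borel_measurable borel \<Longrightarrow> f \<in> borel_measurable unit_meas"
  by (rule measurable_restrict_space1) (simp add: measurable_completion)

lemma borel_measurable_indicator_atMost_unit [measurable]:
  "(\<lambda>t. indicat_real {..x} t) \<in> borel_measurable unit_meas"
  by (rule borel_measurable_unit) simp

lemma continuous_imp_measurable_unit:
  fixes f :: "real \<Rightarrow> real" shows "continuous_on UNIV f \<Longrightarrow> f \<in> borel_measurable unit_meas"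
  by (intro borel_measurable_unit borel_measurable_continuous_onI)

lemma bounded_integrable_unit:
  fixes f :: "real \<Rightarrow> real"
  assumes "f \<in> borel_measurable unit_meas" "AE x in unit_meas. \<bar>f x\<bar> \<le> B"
  shows "integrable unit_meas f"
  using assms by (intro unit_meas.integrable_const_bound[where B = B]) auto

lemma abs_integral_unit_le:
  fixes f :: "real \<Rightarrow> real"
  assumes "f \<in> borel_measurable unit_meas" "AE x in unit_meas. \<bar>f x\<bar> \<le> B"
  shows "\<bar>\<integral>x. f x \<partial>unit_meas\<bar> \<le> B"
proof -
  have "\<bar>\<integral>x. f x \<partial>unit_meas\<bar> \<le> (\<integral>x. \<bar>f x\<bar> \<partial>unit_meas)" by simp
  also have "\<dots> \<le> (\<integral>x. B \<partial>unit_meas)"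
    using assms by (intro integral_mono_AE integrable_abs bounded_integrable_unit) auto
  finally show ?thesis by simp
qed

lemma integrable_bounded_mult:
  fixes f g :: "real \<Rightarrow> real"
  assumes "integrable unit_meas f" "g \<in> borel_measurable unit_meas" "AE x in unit_meas. \<bar>g x\<bar> \<le> B"
  shows "integrable unit_meas (\<lambda>x. g x * f x)"
proof (rule Bochner_Integration.integrable_bound[of _ "\<lambda>x. B * f x"])
  show "AE x in unit_meas. norm (g x * f x) \<le> norm (B * f x)"
    using assms(3) by eventually_elim (auto simp: abs_mult intro!: mult_right_mono)
qed (use assms in auto)

lemma continuous_bounded_unit:
  fixes f :: "real \<Rightarrow> real" assumes "continuous_on UNIV f"
  obtains B where "\<And>x. 0 \<le> x \<Longrightarrow> x \<le> 1 \<Longrightarrow> \<bar>f x\<bar> \<le> B" "B \<ge> 0"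
proof -
  have "compact (f ` {0..1})"
    by (rule compact_continuous_image) (use assms continuous_on_subset in blast)+
  then obtain B where B: "\<And>y. y \<in> f ` {0..1} \<Longrightarrow> norm y \<le> B"
    using bounded_iff compact_imp_bounded by metis
  have *: "\<bar>f x\<bar> \<le> B" if "0 \<le> x" "x \<le> 1" for x using B[of "f x"] that by simp
  from *[of 0] have "B \<ge> 0" by simp
  with * show ?thesis by (rule that)
qed

lemma continuous_integrable_unit:
  fixes f :: "real \<Rightarrow> real" assumes "continuous_on UNIV f"
  shows "integrable unit_meas f"
proof -
  obtain B where B: "\<And>x. 0 \<le> x \<Longrightarrow> x \<le> 1 \<Longrightarrow> \<bar>f x\<bar> \<le> B" using continuous_bounded_unit[OF assms] by metis
  show ?thesis
    by (rule bounded_integrable_unit[where B = B, OF continuous_imp_measurable_unit[OF assms] AE_unitI])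
       (use B in auto)
qed

text \<open>
  The primitive is defined by an integral over the whole unit interval with an indicator, so that
  dominated convergence applies to it within a single measure. It equals 0 left of 0 and the full
  integral right of 1.
\<close>

definition prim :: "(real \<Rightarrow> real) \<Rightarrow> real \<Rightarrow> real" where
  "prim g x = (\<integral>t. indicat_real {..x} t * g t \<partial>unit_meas)"

lemma integrable_indicator_mult_unit:
  fixes g :: "real \<Rightarrow> real"
  assumes "integrable unit_meas g"
  shows "integrable unit_meas (\<lambda>t. indicat_real {..x} t * g t)"
  by (rule integrable_bounded_mult[where B = 1, OF assms borel_measurable_indicator_atMost_unit])
    (auto simp: indicator_def)

lemma prim_0: "x \<le> 0 \<Longrightarrow> prim g x = 0"
proof -
  assume "x \<le> 0"
  then have "prim g x = (\<integral>t. 0 \<partial>unit_meas)"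
    unfolding prim_def by (intro Bochner_Integration.integral_cong) auto
  then show ?thesis by simp
qed

lemma prim_1: "1 \<le> x \<Longrightarrow> prim g x = (\<integral>t. g t \<partial>unit_meas)"
  unfolding prim_def by (intro Bochner_Integration.integral_cong) auto

lemma prim_cong: "AE x in unit_meas. f x = g x \<Longrightarrow> f \<in> borel_measurable unit_meas \<Longrightarrow>
    g \<in> borel_measurable unit_meas \<Longrightarrow> prim f x = prim g x"
  unfolding prim_def by (rule integral_cong_AE) auto

lemma prim_diff: "integrable unit_meas f \<Longrightarrow> integrable unit_meas g \<Longrightarrow>
    prim (\<lambda>t. f t - g t) x = prim f x - prim g x"
  unfolding prim_def by (simp add: right_diff_distrib integrable_indicator_mult_unit)

lemma prim_cmult: "prim (\<lambda>t. c * g t) x = c * prim g x"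
proof -
  have "prim (\<lambda>t. c * g t) x = (\<integral>t. c * (indicat_real {..x} t * g t) \<partial>unit_meas)"
    unfolding prim_def by (simp add: mult.left_commute)
  then show ?thesis by (simp add: prim_def)
qed

lemma prim_uminus: "prim (\<lambda>t. - g t) x = - prim g x"
  using prim_cmult[of "-1" g x] by simp

lemma abs_prim_le: assumes "integrable unit_meas g"
  shows "\<bar>prim g x\<bar> \<le> (\<integral>t. \<bar>g t\<bar> \<partial>unit_meas)"
proof -
  have "\<bar>prim g x\<bar> \<le> (\<integral>t. \<bar>indicat_real {..x} t * g t\<bar> \<partial>unit_meas)" unfolding prim_def by simp
  also have "\<dots> \<le> (\<integral>t. \<bar>g t\<bar> \<partial>unit_meas)"
    using assms by (intro integral_mono integrable_abs integrable_indicator_mult_unit) (auto simp: indicator_def)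
  finally show ?thesis .
qed

lemma abs_prim_le_bound: assumes "g \<in> borel_measurable unit_meas" "AE x in unit_meas. \<bar>g x\<bar> \<le> B"
  shows "\<bar>prim g x\<bar> \<le> B"
proof -
  have "\<bar>prim g x\<bar> \<le> (\<integral>t. \<bar>g t\<bar> \<partial>unit_meas)"
    by (rule abs_prim_le[OF bounded_integrable_unit[OF assms]])
  also have "\<dots> \<le> B" using abs_integral_unit_le[of "\<lambda>x. \<bar>g x\<bar>" B] assms by auto
  finally show ?thesis .
qed

lemma AE_unit_neq: "AE t in unit_meas. t \<noteq> (x::real)"
proof -
  have "AE t in lebesgue. t \<noteq> x" by (rule AE_completion) (rule AE_lborel_singleton)
  then show ?thesis by (subst AE_restrict_space_iff) auto
qed

lemma prim_continuous:
  assumes "integrable unit_meas g"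
  shows "continuous_on UNIV (prim g)"
proof -
  note [measurable] = borel_measurable_integrable[OF assms]
  have "isCont (prim g) x" for x
    unfolding continuous_at_sequentially comp_def
  proof (intro allI impI)
    fix y assume y: "y \<longlonglongrightarrow> x"
    show "(\<lambda>n. prim g (y n)) \<longlonglongrightarrow> prim g x"
      unfolding prim_def
    proof (rule integral_dominated_convergence[where w = "\<lambda>t. \<bar>g t\<bar>"])
      show "AE t in unit_meas. (\<lambda>n. indicat_real {..y n} t * g t) \<longlonglongrightarrow> indicat_real {..x} t * g t"
        using AE_unit_neq[of x]
      proof eventually_elim
        case (elim t)
        have "eventually (\<lambda>n. indicat_real {..y n} t = indicat_real {..x} t) sequentially"
        proof (cases "t < x")
          case True
          from order_tendstoD(1)[OF y True] show ?thesis by eventually_elim (use True in auto)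
        next
          case False
          with elim have "x < t" by auto
          from order_tendstoD(2)[OF y this] show ?thesis by eventually_elim (use \<open>x < t\<close> in auto)
        qed
        then show ?case by (intro tendsto_mult tendsto_eventually tendsto_const) auto
      qed
      show "AE t in unit_meas. norm (indicat_real {..y n} t * g t) \<le> \<bar>g t\<bar>" for n
        by (auto simp: indicator_def)
      show "integrable unit_meas (\<lambda>t. \<bar>g t\<bar>)" using assms by simp
    qed measurable
  qed
  then show ?thesis by (simp add: continuous_on_eq_continuous_at)
qed

lemma prim_measurable: "integrable unit_meas g \<Longrightarrow> prim g \<in> borel_measurable unit_meas"
  by (intro continuous_imp_measurable_unit prim_continuous)

text \<open>
  The endpoints form a null set, so the integral over the open unit interval agrees with the one
  over \<open>{0..x}\<close> in the fundamental theorem of calculus.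
\<close>

lemma prim_FTC:
  assumes "\<And>t. (F has_field_derivative f t) (at t)" "continuous_on UNIV f" "0 \<le> x" "x \<le> 1"
  shows "prim f x = F x - F 0"
proof -
  have m: "f \<in> borel_measurable borel" by (rule borel_measurable_continuous_onI) fact
  have "prim f x = (\<integral>t. indicat_real {0<..<1} t *\<^sub>R (indicat_real {..x} t * f t) \<partial>lebesgue)"
    unfolding prim_def by (subst integral_restrict_space) auto
  also have "\<dots> = (\<integral>t. indicat_real {0<..<1} t *\<^sub>R (indicat_real {..x} t * f t) \<partial>lborel)"
    by (rule integral_completion) (use m in measurable)
  also have "\<dots> = (\<integral>t. f t * indicat_real {0..x} t \<partial>lborel)"
  proof (rule integral_cong_AE)
    show "AE t in lborel. indicat_real {0<..<1} t *\<^sub>R (indicat_real {..x} t * f t) = f t * indicat_real {0..x} t"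
      using AE_lborel_singleton[of 0] AE_lborel_singleton[of 1]
      by eventually_elim (use assms in \<open>auto simp: indicator_def\<close>)
  qed (use m in measurable)
  also have "\<dots> = F x - F 0"
    by (rule integral_FTC_Icc_real) (use assms in \<open>auto simp: continuous_on_eq_continuous_at\<close>)
  finally show ?thesis .
qed

lemma exists_antiderivative:
  assumes "continuous_on UNIV (f :: real \<Rightarrow> real)"
  obtains F where "\<And>t. (F has_field_derivative f t) (at t)" "F 0 = 0"
proof -
  have "\<exists>F. \<forall>x :: real. -\<infinity> < ereal x \<longrightarrow> ereal x < \<infinity> \<longrightarrow> (F has_vector_derivative f x) (at x)"
    by (rule einterval_antiderivative) (use assms in \<open>auto simp: continuous_on_eq_continuous_at\<close>)
  then obtain F where "\<And>x. (F has_vector_derivative f x) (at x)" by auto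
  then have F: "\<And>x. (F has_field_derivative f x) (at x)"
    by (simp add: has_real_derivative_iff_has_vector_derivative)
  have "\<And>x. ((\<lambda>t. F t - F 0) has_field_derivative f x) (at x)"
    by (rule derivative_eq_intros F refl)+ auto
  then show ?thesis by (rule that) simp
qed

lemma prim_eq_antiderivative:
  assumes "continuous_on UNIV f"
  obtains F where "\<And>t. (F has_field_derivative f t) (at t)" "\<And>x. 0 \<le> x \<Longrightarrow> x \<le> 1 \<Longrightarrow> F x = prim f x"
proof -
  obtain F where F: "\<And>t. (F has_field_derivative f t) (at t)" "F 0 = 0"
    using exists_antiderivative[OF assms] by blast
  with prim_FTC[OF F(1) assms] show ?thesis by (intro that[OF F(1)]) simp
qed

text \<open>
  A measurable function is an almost everywhere limit of continuous functions. Truncating them at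
  the bound and applying the Weierstrass theorem keeps the approximants uniformly bounded, as needed
  for dominated convergence.
\<close>

lemma bounded_approx_polynomial:
  assumes "g \<in> borel_measurable unit_meas" "AE x in unit_meas. \<bar>g x\<bar> \<le> B"
  obtains P where "\<And>n::nat. real_polynomial_function (P n)"
    "\<And>n x. 0 \<le> x \<Longrightarrow> x \<le> 1 \<Longrightarrow> \<bar>P n x\<bar> \<le> \<bar>B\<bar> + 1"
    "AE x in unit_meas. (\<lambda>n. P n x) \<longlonglongrightarrow> g x"
proof -
  have "g measurable_on {0<..<1}" using assms(1) by (subst measurable_on_iff_borel_measurable) auto
  then obtain N h where N: "negligible N" and h: "\<And>n::nat. continuous_on UNIV (h n)"
    and lim: "\<And>x. x \<notin> N \<Longrightarrow> (\<lambda>n. h n x) \<longlonglongrightarrow> (if x \<in> {0<..<1} then g x else 0)"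
    unfolding measurable_on_def by blast
  define k where "k n x = max (-\<bar>B\<bar>) (min \<bar>B\<bar> (h n x))" for n x
  have k: "continuous_on {0..1} (k n)" for n
    unfolding k_def by (intro continuous_intros continuous_on_subset[OF h]) auto
  have "\<exists>P. real_polynomial_function P \<and> (\<forall>x\<in>{0..1}. \<bar>k n x - P x\<bar> < 1 / real (Suc n))" for n
  proof -
    have "0 < 1 / real (Suc n)" by simp
    from Stone_Weierstrass_real_polynomial_function[OF compact_Icc k[of n] this] show ?thesis by metis
  qed
  then obtain P where P: "\<And>n. real_polynomial_function (P n)"
    and Pk: "\<And>n x. x \<in> {0..1} \<Longrightarrow> \<bar>k n x - P n x\<bar> < 1 / real (Suc n)" by metis
  show ?thesis
  proof (rule that[OF P])
    fix n and x :: real assume "0 \<le> x" "x \<le> 1"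
    then have "\<bar>k n x - P n x\<bar> < 1 / real (Suc n)" using Pk by simp
    also have "\<dots> \<le> 1" by simp
    finally have "\<bar>k n x - P n x\<bar> < 1" .
    moreover have "\<bar>k n x\<bar> \<le> \<bar>B\<bar>" by (auto simp: k_def max_def min_def)
    ultimately show "\<bar>P n x\<bar> \<le> \<bar>B\<bar> + 1" by linarith
  next
    have "AE x in lebesgue. x \<notin> N" using N by (simp add: negligible_iff_null_sets AE_not_in)
    then have "AE x in unit_meas. x \<notin> N" by (subst AE_restrict_space_iff) (auto elim: eventually_mono)
    moreover have "AE x in unit_meas. 0 < x \<and> x < 1" by (rule AE_unitI) auto
    ultimately show "AE x in unit_meas. (\<lambda>n. P n x) \<longlonglongrightarrow> g x" using assms(2)
    proof eventually_elim
      case (elim x)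
      then have "(\<lambda>n. h n x) \<longlonglongrightarrow> g x" using lim[of x] by auto
      then have "(\<lambda>n. k n x) \<longlonglongrightarrow> max (-\<bar>B\<bar>) (min \<bar>B\<bar> (g x))"
        unfolding k_def by (intro tendsto_intros)
      then have k: "(\<lambda>n. k n x) \<longlonglongrightarrow> g x" using elim by (auto simp: max_def min_def abs_le_iff split: if_splits)
      have "(\<lambda>n. k n x - P n x) \<longlonglongrightarrow> 0"
      proof (rule Lim_null_comparison)
        show "eventually (\<lambda>n. norm (k n x - P n x) \<le> 1 / real (Suc n)) sequentially"
          using Pk[of x] elim by (auto intro!: always_eventually less_imp_le)
        show "(\<lambda>n. 1 / real (Suc n)) \<longlonglongrightarrow> 0" by (rule LIMSEQ_Suc) (rule lim_1_over_n)
      qed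
      from tendsto_diff[OF k this] show ?case by simp
    qed
  qed
qed

lemma test_funD:
  assumes "test_fun \<phi>"
  shows "smooth \<phi>" "(\<phi> has_field_derivative deriv \<phi> x) (at x)" "continuous_on UNIV \<phi>"
    "continuous_on UNIV (deriv \<phi>)" "x \<le> 0 \<Longrightarrow> \<phi> x = 0" "1 \<le> x \<Longrightarrow> \<phi> x = 0"
    "0 \<le> x \<Longrightarrow> x \<le> 1 \<Longrightarrow> prim (deriv \<phi>) x = \<phi> x"
proof -
  show s: "smooth \<phi>" using assms by (simp add: test_fun_def smooth_iff)
  then show "(\<phi> has_field_derivative deriv \<phi> x) (at x)" for x by (rule smooth_DERIV)
  note D = this
  show "continuous_on UNIV \<phi>" using s by (rule smooth_continuous)
  show c: "continuous_on UNIV (deriv \<phi>)" using s by (intro smooth_continuous smooth_deriv)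
  show z: "\<phi> x = 0" if "x \<le> 0" for x using assms that by (force simp: test_fun_def)
  show "1 \<le> x \<Longrightarrow> \<phi> x = 0" using assms by (force simp: test_fun_def)
  show "0 \<le> x \<Longrightarrow> x \<le> 1 \<Longrightarrow> prim (deriv \<phi>) x = \<phi> x"
    using prim_FTC[OF D c] z by simp
qed

text \<open>
  For polynomials this is the fundamental theorem of calculus for the product of the primitive and
  the test function; the general case follows by bounded approximation with polynomials.
\<close>

lemma integral_by_parts_test_fun:
  assumes k: "k \<in> borel_measurable unit_meas" "AE x in unit_meas. \<bar>k x\<bar> \<le> B" and t: "test_fun \<phi>"
  shows "(\<integral>x. k x * \<phi> x \<partial>unit_meas) = - (\<integral>x. prim k x * deriv \<phi> x \<partial>unit_meas)"
proof -
  obtain P where P: "\<And>n::nat. real_polynomial_function (P n)"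
    and PB: "\<And>n x. 0 \<le> x \<Longrightarrow> x \<le> 1 \<Longrightarrow> \<bar>P n x\<bar> \<le> \<bar>B\<bar> + 1"
    and lim: "AE x in unit_meas. (\<lambda>n. P n x) \<longlonglongrightarrow> k x"
    using bounded_approx_polynomial[OF k] by metis
  have Pc: "continuous_on UNIV (P n)" for n using P smooth_real_polynomial_function smooth_continuous by blast
  note [measurable] = continuous_imp_measurable_unit[OF Pc] k(1) continuous_imp_measurable_unit[OF test_funD(3)[OF t]]
    continuous_imp_measurable_unit[OF test_funD(4)[OF t]]
    prim_measurable[OF continuous_integrable_unit[OF Pc]] prim_measurable[OF bounded_integrable_unit[OF k]]
  have eq: "(\<integral>x. P n x * \<phi> x \<partial>unit_meas) = - (\<integral>x. prim (P n) x * deriv \<phi> x \<partial>unit_meas)" for n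
  proof -
    obtain F where F: "\<And>t. (F has_field_derivative P n t) (at t)" "\<And>x. 0 \<le> x \<Longrightarrow> x \<le> 1 \<Longrightarrow> F x = prim (P n) x"
      using prim_eq_antiderivative[OF Pc] by blast
    have Fc: "continuous_on UNIV F" using F(1) DERIV_isCont continuous_at_imp_continuous_on by blast
    have D: "((\<lambda>x. F x * \<phi> x) has_field_derivative P n x * \<phi> x + deriv \<phi> x * F x) (at x)" for x
      by (rule DERIV_mult F test_funD t)+
    have c: "continuous_on UNIV (\<lambda>x. P n x * \<phi> x + deriv \<phi> x * F x)"
      by (intro continuous_intros Pc Fc test_funD t)
    have i1: "integrable unit_meas (\<lambda>x. P n x * \<phi> x)" and i2: "integrable unit_meas (\<lambda>x. deriv \<phi> x * F x)"
      by (intro continuous_integrable_unit continuous_intros Pc Fc test_funD t)+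
    have "0 = prim (\<lambda>x. P n x * \<phi> x + deriv \<phi> x * F x) 1"
      using prim_FTC[OF D c, of 1] test_funD(5,6)[OF t] by simp
    also have "\<dots> = (\<integral>x. P n x * \<phi> x \<partial>unit_meas) + (\<integral>x. deriv \<phi> x * F x \<partial>unit_meas)"
      using i1 i2 by (simp add: prim_1)
    also have "(\<integral>x. deriv \<phi> x * F x \<partial>unit_meas) = (\<integral>x. prim (P n) x * deriv \<phi> x \<partial>unit_meas)"
      by (rule Bochner_Integration.integral_cong) (auto simp: F(2))
    finally show ?thesis by simp
  qed
  obtain B1 where B1: "\<And>x. 0 \<le> x \<Longrightarrow> x \<le> 1 \<Longrightarrow> \<bar>\<phi> x\<bar> \<le> B1" "B1 \<ge> 0"
    using continuous_bounded_unit[OF test_funD(3)[OF t]] by metis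
  obtain B2 where B2: "\<And>x. 0 \<le> x \<Longrightarrow> x \<le> 1 \<Longrightarrow> \<bar>deriv \<phi> x\<bar> \<le> B2" "B2 \<ge> 0"
    using continuous_bounded_unit[OF test_funD(4)[OF t]] by metis
  have "(\<lambda>n. \<integral>x. P n x * \<phi> x \<partial>unit_meas) \<longlonglongrightarrow> (\<integral>x. k x * \<phi> x \<partial>unit_meas)"
  proof (rule integral_dominated_convergence[where w = "\<lambda>x. (\<bar>B\<bar> + 1) * B1"])
    show "AE x in unit_meas. (\<lambda>n. P n x * \<phi> x) \<longlonglongrightarrow> k x * \<phi> x"
      using lim by eventually_elim (intro tendsto_intros)
    show "AE x in unit_meas. norm (P n x * \<phi> x) \<le> (\<bar>B\<bar> + 1) * B1" for n
      by (rule AE_unitI) (auto simp: abs_mult intro!: mult_mono PB B1)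
  qed auto
  moreover have "(\<lambda>n. \<integral>x. prim (P n) x * deriv \<phi> x \<partial>unit_meas) \<longlonglongrightarrow> (\<integral>x. prim k x * deriv \<phi> x \<partial>unit_meas)"
  proof (rule integral_dominated_convergence[where w = "\<lambda>x. (\<bar>B\<bar> + 1) * B2"])
    have "(\<lambda>n. prim (P n) x) \<longlonglongrightarrow> prim k x" for x
      unfolding prim_def
    proof (rule integral_dominated_convergence[where w = "\<lambda>x. (\<bar>B\<bar> + 1)"])
      show "AE t in unit_meas. (\<lambda>n. indicat_real {..x} t * P n t) \<longlonglongrightarrow> indicat_real {..x} t * k t"
        using lim by eventually_elim (intro tendsto_intros)
      show "AE t in unit_meas. norm (indicat_real {..x} t * P n t) \<le> \<bar>B\<bar> + 1" for n
        by (rule AE_unitI) (use PB in \<open>auto simp: indicator_def\<close>)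
    qed auto
    then show "AE x in unit_meas. (\<lambda>n. prim (P n) x * deriv \<phi> x) \<longlonglongrightarrow> prim k x * deriv \<phi> x"
      by (intro AE_I2 tendsto_intros)
    have "\<bar>prim (P n) x\<bar> \<le> \<bar>B\<bar> + 1" for n x
      by (rule abs_prim_le_bound) (auto intro!: AE_unitI PB)
    then show "AE x in unit_meas. norm (prim (P n) x * deriv \<phi> x) \<le> (\<bar>B\<bar> + 1) * B2" for n
      by (intro AE_unitI) (auto simp: abs_mult intro!: mult_mono B2)
  qed auto
  ultimately show ?thesis unfolding eq using LIMSEQ_unique tendsto_minus by fast
qed

section \<open>Weighted convexity inequalities\<close>

text \<open>
  The standing hypothesis on coefficients and weights.
\<close>

definition bounded_between :: "real \<Rightarrow> real \<Rightarrow> (real \<Rightarrow> real) \<Rightarrow> bool" where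
  "bounded_between l h f \<longleftrightarrow> f \<in> borel_measurable unit_meas \<and> (AE x in unit_meas. l \<le> f x \<and> f x \<le> h)"

text \<open>
  In the equation \<open>flux = a * \<bar>u'\<bar> powr (p-1)\<close> for an increasing \<open>u\<close>, this is the factor by
  which the gradient responds to the flux: \<open>u' = compliance * flux powr (1/(p-1))\<close>.
\<close>

definition compliance :: "real \<Rightarrow> (real \<Rightarrow> real) \<Rightarrow> real \<Rightarrow> real" where
  "compliance p a x = a x powr (-1/(p-1))"

lemma bounded_between_measurable: "bounded_between l h f \<Longrightarrow> f \<in> borel_measurable unit_meas"
  by (simp add: bounded_between_def)

lemma bounded_between_AE: "bounded_between l h f \<Longrightarrow> AE x in unit_meas. l \<le> f x \<and> f x \<le> h"
  unfolding bounded_between_def by blast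

lemma bounded_between_le: "bounded_between l h f \<Longrightarrow> l \<le> h"
proof -
  assume "bounded_between l h f"
  then have "AE x in unit_meas. l \<le> h" by (auto simp: bounded_between_def)
  then have "(\<integral>x. l \<partial>unit_meas) \<le> (\<integral>x. h \<partial>unit_meas)" by (intro integral_mono_AE) auto
  then show ?thesis by simp
qed

lemma bounded_between_abs: "bounded_between l h f \<Longrightarrow> 0 \<le> l \<Longrightarrow> AE x in unit_meas. \<bar>f x\<bar> \<le> h"
  by (drule bounded_between_AE) (erule eventually_mono, auto)

lemma bounded_between_mono: "bounded_between l' h' f \<Longrightarrow> l \<le> l' \<Longrightarrow> h' \<le> h \<Longrightarrow> bounded_between l h f"
proof -
  assume f: "bounded_between l' h' f" and le: "l \<le> l'" "h' \<le> h"
  have "AE x in unit_meas. l \<le> f x \<and> f x \<le> h" using bounded_between_AE[OF f] by eventually_elim (use le in auto)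
  then show ?thesis using bounded_between_measurable[OF f] by (simp add: bounded_between_def)
qed

lemma compliance_measurable: "a \<in> borel_measurable unit_meas \<Longrightarrow> compliance p a \<in> borel_measurable unit_meas"
  unfolding compliance_def[abs_def] by measurable

lemma integrable_indicator_borel:
  fixes g :: "real \<Rightarrow> real"
  assumes "integrable unit_meas g" "S \<in> sets borel"
  shows "integrable unit_meas (\<lambda>t. indicat_real S t * g t)"
  by (rule integrable_bounded_mult[where B = 1, OF assms(1) borel_measurable_unit])
    (use assms(2) in \<open>auto simp: indicator_def\<close>)

lemma bounded_between_compliance:
  assumes "1 < p" "0 < \<alpha>" "bounded_between \<alpha> \<beta> a"
  shows "bounded_between (\<beta> powr (-1/(p-1))) (\<alpha> powr (-1/(p-1))) (compliance p a)"
proof -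
  have [measurable]: "a \<in> borel_measurable unit_meas" using assms by (simp add: bounded_between_def)
  have "AE x in unit_meas. \<alpha> \<le> a x \<and> a x \<le> \<beta>" using assms by (simp add: bounded_between_def)
  then have "AE x in unit_meas. \<beta> powr (-1/(p-1)) \<le> compliance p a x \<and> compliance p a x \<le> \<alpha> powr (-1/(p-1))"
    by eventually_elim (use assms in \<open>auto simp: compliance_def intro!: powr_mono2'\<close>)
  then show ?thesis using compliance_measurable[of a p] by (simp add: bounded_between_def)
qed

text \<open>
  Young's inequality for the factors \<open>a powr (1/p) * g\<close> and \<open>a powr (-1/p) * \<kappa>\<close>. The weight that
  appears with \<open>\<kappa>\<close> is the compliance.
\<close>

lemma young_weighted:
  fixes g \<kappa> a p :: real
  assumes p: "1 < p" and a: "0 < a"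
  shows "g * \<kappa> \<le> a * \<bar>g\<bar> powr p / p + (1 - 1/p) * (a powr (-1/(p-1)) * \<bar>\<kappa>\<bar> powr (p/(p-1)))"
proof -
  let ?q = "p/(p-1)"
  have q: "?q > 1" "1/p + 1/?q = 1" using p by (auto simp: field_simps)
  have "g * \<kappa> \<le> \<bar>g\<bar> * \<bar>\<kappa>\<bar>" by (metis abs_ge_self abs_mult)
  also have "\<dots> = (a powr (1/p) * \<bar>g\<bar>) * (a powr (-1/p) * \<bar>\<kappa>\<bar>)"
    using a by (simp add: powr_minus field_simps powr_divide)
  also have "\<dots> \<le> (a powr (1/p) * \<bar>g\<bar>) powr p / p + (a powr (-1/p) * \<bar>\<kappa>\<bar>) powr ?q / ?q"
    by (rule Youngs_inequality) (use p q in auto)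
  also have "(a powr (1/p) * \<bar>g\<bar>) powr p = a * \<bar>g\<bar> powr p"
    using p a by (simp add: powr_mult powr_powr)
  also have "(a powr (-1/p) * \<bar>\<kappa>\<bar>) powr ?q / ?q = (1 - 1/p) * (a powr (-1/(p-1)) * \<bar>\<kappa>\<bar> powr ?q)"
  proof -
    have "-1/p * ?q = -1/(p-1)" using p by (simp add: field_simps)
    moreover have "1/?q = 1 - 1/p" using p by (simp add: field_simps)
    moreover have "(a powr (-1/p) * \<bar>\<kappa>\<bar>) powr ?q / ?q = (1/?q) * (a powr (-1/p * ?q) * \<bar>\<kappa>\<bar> powr ?q)"
      by (simp add: powr_mult powr_powr)
    ultimately show ?thesis by presburger
  qed
  finally show ?thesis .
qed

lemma powr_mult_self: "0 \<le> (x::real) \<Longrightarrow> x * x powr (p - 1) = x powr p"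
  by (cases "x = 0") (auto simp: powr_diff)

lemma Lp_integrable_powr: "g \<in> Lp_space p \<Longrightarrow> integrable unit_meas (\<lambda>x. \<bar>g x\<bar> powr p)"
  and Lp_measurable: "g \<in> Lp_space p \<Longrightarrow> g \<in> borel_measurable unit_meas"
  by (auto simp: Lp_space_def)

lemma le_1_plus_powr: "1 \<le> p \<Longrightarrow> \<bar>x\<bar> \<le> 1 + \<bar>x\<bar> powr (p::real)"
proof (cases "\<bar>x\<bar> \<le> 1")
  case False
  assume "1 \<le> p"
  then have "\<bar>x\<bar> powr 1 \<le> \<bar>x\<bar> powr p" using False by (intro powr_mono) auto
  then show ?thesis by (auto simp: powr_one')
qed (simp add: add_increasing2)

lemma Lp_integrable: assumes "g \<in> Lp_space p" "1 \<le> p"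
  shows "integrable unit_meas g"
proof (rule Bochner_Integration.integrable_bound[of _ "\<lambda>x. 1 + \<bar>g x\<bar> powr p"])
  show "integrable unit_meas (\<lambda>x. 1 + \<bar>g x\<bar> powr p)" using Lp_integrable_powr[OF assms(1)] by auto
  show "AE x in unit_meas. norm (g x) \<le> norm (1 + \<bar>g x\<bar> powr p)"
    using le_1_plus_powr[OF assms(2)] by (auto intro!: AE_I2 simp: add_nonneg_nonneg)
qed (use Lp_measurable assms in auto)

lemma bounded_Lp: assumes "g \<in> borel_measurable unit_meas" "AE x in unit_meas. \<bar>g x\<bar> \<le> B" "0 \<le> p"
  shows "g \<in> Lp_space p"
proof -
  have "integrable unit_meas (\<lambda>x. \<bar>g x\<bar> powr p)"
  proof (rule bounded_integrable_unit[of _ "\<bar>B\<bar> powr p"])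
    show "AE x in unit_meas. \<bar>\<bar>g x\<bar> powr p\<bar> \<le> \<bar>B\<bar> powr p"
      using assms(2) by eventually_elim (use assms(3) in \<open>auto intro!: powr_mono2\<close>)
  qed (use assms in measurable)
  then show ?thesis using assms by (simp add: Lp_space_def)
qed

text \<open>
  The weighted Hoelder inequality, read as a minimum principle: among functions with prescribed
  integral over \<open>S\<close>, the energy is smallest for multiples of the compliance. It follows by
  integrating Young's inequality against the constant flux of that minimizer.
\<close>

lemma energy_lower_bound:
  fixes S :: "real set"
  assumes p: "1 < p" and l: "0 < l" and a: "bounded_between l h a" and g: "g \<in> Lp_space p"
    and S: "S \<in> sets borel" and Bpos: "0 < (\<integral>t. indicat_real S t * compliance p a t \<partial>unit_meas)"
  shows "\<bar>\<integral>t. indicat_real S t * g t \<partial>unit_meas\<bar> powr p / (\<integral>t. indicat_real S t * compliance p a t \<partial>unit_meas) powr (p-1)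
    \<le> (\<integral>t. indicat_real S t * (a t * \<bar>g t\<bar> powr p) \<partial>unit_meas)"
proof -
  define A where "A = (\<integral>t. indicat_real S t * g t \<partial>unit_meas)"
  define B where "B = (\<integral>t. indicat_real S t * compliance p a t \<partial>unit_meas)"
  \<comment> \<open>The constant flux of the multiple of the compliance that has integral \<open>A\<close>.\<close>
  define \<kappa> where "\<kappa> = sgn A * (\<bar>A\<bar>/B) powr (p-1)"
  have B: "B > 0" using Bpos by (simp add: B_def)
  have [measurable]: "(\<lambda>t. indicat_real S t) \<in> borel_measurable unit_meas"
    using S by (intro borel_measurable_unit) simp
  have i1: "integrable unit_meas (\<lambda>t. indicat_real S t * g t)"
    by (rule integrable_indicator_borel) (use Lp_integrable[OF g] p S in auto)
  have i2: "integrable unit_meas (\<lambda>t. indicat_real S t * compliance p a t)"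
  proof (rule integrable_indicator_borel[OF _ S])
    have c: "bounded_between (h powr (-1/(p-1))) (l powr (-1/(p-1))) (compliance p a)" using bounded_between_compliance[OF p l a] .
    show "integrable unit_meas (compliance p a)"
      by (rule bounded_integrable_unit[OF bounded_between_measurable[OF c] bounded_between_abs[OF c]]) auto
  qed
  have i3: "integrable unit_meas (\<lambda>t. indicat_real S t * (a t * \<bar>g t\<bar> powr p))"
    using bounded_between_abs[OF a] l
    by (intro integrable_indicator_borel[OF _ S] integrable_bounded_mult[OF Lp_integrable_powr[OF g] bounded_between_measurable[OF a]]) auto
  have "AE t in unit_meas. (indicat_real S t * g t) * \<kappa> \<le> (indicat_real S t * (a t * \<bar>g t\<bar> powr p)) / p
      + (1 - 1/p) * \<bar>\<kappa>\<bar> powr (p/(p-1)) * (indicat_real S t * compliance p a t)"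
    using bounded_between_AE[OF a]
  proof eventually_elim
    case (elim t)
    then show ?case using young_weighted[OF p, of "a t" "g t" \<kappa>] l
      by (auto simp: indicator_def compliance_def mult_ac)
  qed
  then have "(\<integral>t. (indicat_real S t * g t) * \<kappa> \<partial>unit_meas) \<le>
     (\<integral>t. (indicat_real S t * (a t * \<bar>g t\<bar> powr p)) / p
      + (1 - 1/p) * \<bar>\<kappa>\<bar> powr (p/(p-1)) * (indicat_real S t * compliance p a t) \<partial>unit_meas)"
    by (intro integral_mono_AE) (use i1 i2 i3 in auto)
  also have "\<dots> = (\<integral>t. indicat_real S t * (a t * \<bar>g t\<bar> powr p) \<partial>unit_meas) / p
      + (1 - 1/p) * \<bar>\<kappa>\<bar> powr (p/(p-1)) * B"
    using i2 i3 by (subst Bochner_Integration.integral_add) (auto simp: B_def)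
  also have "(\<integral>t. (indicat_real S t * g t) * \<kappa> \<partial>unit_meas) = A * \<kappa>"
    by (simp add: A_def)
  finally have main: "A * \<kappa> \<le> (\<integral>t. indicat_real S t * (a t * \<bar>g t\<bar> powr p) \<partial>unit_meas) / p
      + (1 - 1/p) * \<bar>\<kappa>\<bar> powr (p/(p-1)) * B" .
  have 1: "A * \<kappa> = \<bar>A\<bar> powr p / B powr (p-1)"
  proof -
    have "A * \<kappa> = \<bar>A\<bar> * (\<bar>A\<bar>/B) powr (p-1)" by (simp add: \<kappa>_def mult.assoc[symmetric] abs_sgn)
    also have "\<dots> = (\<bar>A\<bar> * \<bar>A\<bar> powr (p-1)) / B powr (p-1)" using B by (simp add: powr_divide)
    finally show ?thesis by (simp add: powr_mult_self)
  qed
  have 2: "\<bar>\<kappa>\<bar> powr (p/(p-1)) * B = \<bar>A\<bar> powr p / B powr (p-1)"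
  proof (cases "A = 0")
    case False
    then have "\<bar>\<kappa>\<bar> = (\<bar>A\<bar>/B) powr (p-1)" by (simp add: \<kappa>_def abs_mult abs_sgn_eq)
    then have "\<bar>\<kappa>\<bar> powr (p/(p-1)) = (\<bar>A\<bar>/B) powr p" using p by (simp add: powr_powr)
    then show ?thesis using B p by (simp add: powr_divide powr_diff)
  qed (use p in \<open>simp add: \<kappa>_def\<close>)
  have "\<bar>A\<bar> powr p / B powr (p-1) \<le> (\<integral>t. indicat_real S t * (a t * \<bar>g t\<bar> powr p) \<partial>unit_meas) / p
      + (1 - 1/p) * (\<bar>A\<bar> powr p / B powr (p-1))"
    using main unfolding 1 mult.assoc 2 .
  moreover have "X \<le> Y" if "X \<le> Y / p + (1 - 1/p) * X" for X Y
    using p that by (simp add: field_simps)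
  ultimately show ?thesis unfolding A_def B_def by blast
qed

lemma bounded_between_1: "bounded_between 1 1 (\<lambda>x. 1)" by (simp add: bounded_between_def)

text \<open>
  The minimum principle for the constant coefficient 1 on the whole interval.
\<close>

lemma abs_integral_powr_le:
  assumes p: "1 < p" and g: "g \<in> Lp_space p"
  shows "(\<integral>t. \<bar>g t\<bar> \<partial>unit_meas) powr p \<le> (\<integral>t. \<bar>g t\<bar> powr p \<partial>unit_meas)"
proof -
  have "(\<lambda>x. \<bar>g x\<bar>) \<in> Lp_space p" using g by (auto simp: Lp_space_def)
  from energy_lower_bound[OF p _ bounded_between_1 this, of UNIV] show ?thesis by (simp add: compliance_def)
qed

lemma abs_integral_le_Lp:
  assumes p: "1 < p" and g: "g \<in> Lp_space p"
  shows "(\<integral>t. \<bar>g t\<bar> \<partial>unit_meas) \<le> (\<integral>t. \<bar>g t\<bar> powr p \<partial>unit_meas) powr (1/p)"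
proof -
  have "((\<integral>t. \<bar>g t\<bar> \<partial>unit_meas) powr p) powr (1/p) \<le> (\<integral>t. \<bar>g t\<bar> powr p \<partial>unit_meas) powr (1/p)"
    using p by (intro powr_mono2 abs_integral_powr_le g) auto
  then show ?thesis using p by (simp add: powr_powr)
qed

lemma powr_sum_le: "0 \<le> p \<Longrightarrow> \<bar>x + y\<bar> powr p \<le> 2 powr p * (\<bar>x\<bar> powr p + \<bar>y\<bar> powr (p::real))"
proof -
  assume p: "0 \<le> p"
  have "\<bar>x + y\<bar> \<le> 2 * max \<bar>x\<bar> \<bar>y\<bar>" by auto
  then have "\<bar>x + y\<bar> powr p \<le> (2 * max \<bar>x\<bar> \<bar>y\<bar>) powr p" using p by (intro powr_mono2) auto
  also have "\<dots> = 2 powr p * max \<bar>x\<bar> \<bar>y\<bar> powr p" by (simp add: powr_mult)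
  also have "\<dots> \<le> 2 powr p * (\<bar>x\<bar> powr p + \<bar>y\<bar> powr p)" by (auto simp: max_def)
  finally show ?thesis .
qed

lemma Lp_lincomb:
  assumes "f \<in> Lp_space p" "g \<in> Lp_space p" "0 \<le> p"
  shows "(\<lambda>x. c * f x + d * g x) \<in> Lp_space p"
proof -
  have [measurable]: "f \<in> borel_measurable unit_meas" "g \<in> borel_measurable unit_meas" using assms Lp_measurable by auto
  have "integrable unit_meas (\<lambda>x. \<bar>c * f x + d * g x\<bar> powr p)"
  proof (rule Bochner_Integration.integrable_bound[of _ "\<lambda>x. 2 powr p * (\<bar>c\<bar> powr p * \<bar>f x\<bar> powr p + \<bar>d\<bar> powr p * \<bar>g x\<bar> powr p)"])
    show "AE x in unit_meas. norm (\<bar>c * f x + d * g x\<bar> powr p) \<le> norm (2 powr p * (\<bar>c\<bar> powr p * \<bar>f x\<bar> powr p + \<bar>d\<bar> powr p * \<bar>g x\<bar> powr p))"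
    proof (intro AE_I2)
      fix x show "norm (\<bar>c * f x + d * g x\<bar> powr p) \<le> norm (2 powr p * (\<bar>c\<bar> powr p * \<bar>f x\<bar> powr p + \<bar>d\<bar> powr p * \<bar>g x\<bar> powr p))"
        using powr_sum_le[OF assms(3), of "c * f x" "d * g x"]
        by (simp add: abs_mult powr_mult abs_of_nonneg)
    qed
  qed (use assms Lp_integrable_powr in auto)
  then show ?thesis by (auto simp: Lp_space_def)
qed

section \<open>Weak derivatives and the space of primitives\<close>

lemma loc_integrable_integrable:
  assumes "integrable unit_meas u" shows "loc_integrable u"
proof -
  have "set_integrable lebesgue {0<..<1} u"
    using assms by (subst (asm) integrable_restrict_space) (auto simp: set_integrable_def)
  then show ?thesis unfolding loc_integrable_def
    by (intro allI impI) (rule set_integrable_subset, auto intro: compact_imp_closed lmeasurable_compact fmeasurableD)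
qed

text \<open>
  Local integrability controls the function only on compact subintervals, so measurability on the
  open interval is obtained from an exhaustion.
\<close>

lemma loc_integrable_measurable:
  assumes "loc_integrable u" shows "u \<in> borel_measurable unit_meas"
proof -
  define K where "K n = {1 / real (Suc n)..1 - 1 / real (Suc n)}" for n
  have K: "K n \<subseteq> {0<..<1}" for n
  proof -
    have "0 < 1 / real (Suc n)" by simp
    then show ?thesis unfolding K_def
      by (intro subsetI) (simp only: atLeastAtMost_iff greaterThanLessThan_iff, linarith)
  qed
  have "(\<lambda>x. indicat_real (K n) x *\<^sub>R u x) \<in> borel_measurable lebesgue" for n
  proof -
    have "compact (K n)" by (simp add: K_def)
    then have "set_integrable lebesgue (K n) u" using assms K unfolding loc_integrable_def by blast
    then show ?thesis unfolding set_integrable_def by (rule borel_measurable_integrable)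
  qed
  then have m: "(\<lambda>x. indicat_real (K n) x *\<^sub>R u x) \<in> borel_measurable unit_meas" for n
    by (rule measurable_restrict_space1)
  show ?thesis
  proof (rule borel_measurable_LIMSEQ_real[OF _ m])
    fix x assume "x \<in> space unit_meas"
    then have x: "0 < x" "x < 1" by auto
    have "(\<lambda>n. 1 / real (Suc n)) \<longlonglongrightarrow> 0" by (rule LIMSEQ_Suc) (rule lim_1_over_n)
    moreover have "0 < min x (1 - x)" using x by simp
    ultimately have "eventually (\<lambda>n. 1 / real (Suc n) < min x (1-x)) sequentially"
      by (rule order_tendstoD)
    then have "eventually (\<lambda>n. indicat_real (K n) x *\<^sub>R u x = u x) sequentially"
      by eventually_elim (auto simp: K_def)
    then show "(\<lambda>n. indicat_real (K n) x *\<^sub>R u x) \<longlonglongrightarrow> u x" by (rule tendsto_eventually)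
  qed
qed

lemma loc_integrable_test:
  assumes u: "loc_integrable u" and t: "test_fun \<phi>"
  shows "integrable unit_meas (\<lambda>x. u x * \<phi> x)"
proof -
  obtain K where K: "compact K" "K \<subseteq> {0<..<1}" "\<And>x. x \<notin> K \<Longrightarrow> \<phi> x = 0" using t by (auto simp: test_fun_def)
  have "set_integrable lebesgue K u" using u K unfolding loc_integrable_def by blast
  then have "integrable lebesgue (\<lambda>x. indicat_real K x * u x)" by (simp add: set_integrable_def)
  then have i: "integrable unit_meas (\<lambda>x. indicat_real K x * u x)"
    using integrable_mult_indicator[of "{0<..<1}" lebesgue "\<lambda>x. indicat_real K x * u x"]
    by (subst integrable_restrict_space) auto
  obtain B where B: "\<And>x. 0 \<le> x \<Longrightarrow> x \<le> 1 \<Longrightarrow> \<bar>\<phi> x\<bar> \<le> B" using continuous_bounded_unit[OF test_funD(3)[OF t]] by metis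
  have "integrable unit_meas (\<lambda>x. \<phi> x * (indicat_real K x * u x))"
    by (rule integrable_bounded_mult[where B = B, OF i continuous_imp_measurable_unit[OF test_funD(3)[OF t]] AE_unitI])
      (use B in auto)
  moreover have "(\<lambda>x. \<phi> x * (indicat_real K x * u x)) = (\<lambda>x. u x * \<phi> x)"
  proof
    fix x show "\<phi> x * (indicat_real K x * u x) = u x * \<phi> x" using K(3)[of x] by (cases "x \<in> K") auto
  qed
  ultimately show ?thesis by simp
qed

text \<open>
  Test functions of the form cutoff times polynomial approximate cutoff times \<open>sgn d\<close> boundedly,
  so the integral of cutoff times \<open>\<bar>d\<bar>\<close> vanishes for every cutoff.
\<close>

lemma fundamental_lemma:
  assumes d: "loc_integrable d" and z: "\<And>\<phi>. test_fun \<phi> \<Longrightarrow> (\<integral>x. d x * \<phi> x \<partial>unit_meas) = 0"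
  shows "AE x in unit_meas. d x = 0"
proof -
  have dm [measurable]: "d \<in> borel_measurable unit_meas" by (rule loc_integrable_measurable[OF d])
  obtain P where P: "\<And>n::nat. real_polynomial_function (P n)"
    and PB: "\<And>n x. 0 \<le> x \<Longrightarrow> x \<le> 1 \<Longrightarrow> \<bar>P n x\<bar> \<le> \<bar>1\<bar> + 1"
    and lim: "AE x in unit_meas. (\<lambda>n. P n x) \<longlonglongrightarrow> sgn (d x)"
  proof (rule bounded_approx_polynomial[of "\<lambda>x. sgn (d x)" 1])
    show "AE x in unit_meas. \<bar>sgn (d x)\<bar> \<le> 1" by (simp add: abs_sgn_eq)
  qed auto
  have Ps: "smooth (P n)" for n by (rule smooth_real_polynomial_function[OF P])
  note [measurable] = continuous_imp_measurable_unit[OF smooth_continuous[OF Ps]]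
    continuous_imp_measurable_unit[OF smooth_continuous[OF smooth_cutoff]]
  have "AE x in unit_meas. cutoff (Suc m) x * \<bar>d x\<bar> = 0" for m
  proof -
    have ci: "integrable unit_meas (\<lambda>x. cutoff (Suc m) x * \<bar>d x\<bar>)"
    proof -
      have "integrable unit_meas (\<lambda>x. d x * (cutoff (Suc m) x * 1))"
        by (rule loc_integrable_test[OF d cutoff_mult_test_fun[OF smooth_const]])
      then have "integrable unit_meas (\<lambda>x. \<bar>d x * (cutoff (Suc m) x * 1)\<bar>)" by (rule integrable_abs)
      then show ?thesis by (simp add: abs_mult cutoff_range mult.commute)
    qed
    have "(\<lambda>n. \<integral>x. d x * (cutoff (Suc m) x * P n x) \<partial>unit_meas) \<longlonglongrightarrow> (\<integral>x. cutoff (Suc m) x * \<bar>d x\<bar> \<partial>unit_meas)"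
    proof (rule integral_dominated_convergence[where w = "\<lambda>x. 2 * (cutoff (Suc m) x * \<bar>d x\<bar>)"])
      show "AE x in unit_meas. (\<lambda>n. d x * (cutoff (Suc m) x * P n x)) \<longlonglongrightarrow> cutoff (Suc m) x * \<bar>d x\<bar>"
        using lim
      proof eventually_elim
        case (elim x)
        have "(\<lambda>n. d x * (cutoff (Suc m) x * P n x)) \<longlonglongrightarrow> d x * (cutoff (Suc m) x * sgn (d x))"
          by (intro tendsto_intros elim)
        also have "d x * (cutoff (Suc m) x * sgn (d x)) = cutoff (Suc m) x * \<bar>d x\<bar>"
          by (simp add: abs_sgn)
        finally show ?case .
      qed
      show "AE x in unit_meas. norm (d x * (cutoff (Suc m) x * P n x)) \<le> 2 * (cutoff (Suc m) x * \<bar>d x\<bar>)" for n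
      proof (rule AE_unitI)
        fix x :: real assume "0 < x" "x < 1"
        then have "\<bar>P n x\<bar> \<le> 2" using PB[of x n] by simp
        then have "(\<bar>d x\<bar> * cutoff (Suc m) x) * \<bar>P n x\<bar> \<le> (\<bar>d x\<bar> * cutoff (Suc m) x) * 2"
          by (intro mult_left_mono) (auto simp: cutoff_range)
        then show "norm (d x * (cutoff (Suc m) x * P n x)) \<le> 2 * (cutoff (Suc m) x * \<bar>d x\<bar>)"
          by (simp add: abs_mult cutoff_range mult_ac)
      qed
      show "integrable unit_meas (\<lambda>x. 2 * (cutoff (Suc m) x * \<bar>d x\<bar>))" using ci by simp
    qed measurable
    moreover have "(\<integral>x. d x * (cutoff (Suc m) x * P n x) \<partial>unit_meas) = 0" for n
      by (rule z[OF cutoff_mult_test_fun[OF Ps]])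
    ultimately have "(\<integral>x. cutoff (Suc m) x * \<bar>d x\<bar> \<partial>unit_meas) = 0"
      using LIMSEQ_unique[OF tendsto_const] by fastforce
    then show ?thesis using ci
      by (subst (asm) integral_nonneg_eq_0_iff_AE) (auto simp: cutoff_range)
  qed
  then have "AE x in unit_meas. \<forall>m. cutoff (Suc m) x * \<bar>d x\<bar> = 0" by (simp only: AE_all_countable) blast
  moreover have "AE x in unit_meas. 0 < x \<and> x < 1" by (rule AE_unitI) auto
  ultimately show ?thesis
  proof eventually_elim
    case (elim x)
    have "(\<lambda>m. cutoff (Suc m) x) \<longlonglongrightarrow> 1" by (rule LIMSEQ_Suc[OF cutoff_tendsto]) (use elim in auto)
    then have "eventually (\<lambda>m. cutoff (Suc m) x > 0) sequentially" by (rule order_tendstoD) simp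
    then obtain m where "cutoff (Suc m) x > 0" using eventually_happens' by fastforce
    then show ?case using elim by auto
  qed
qed

lemma is_weak_deriv_unique:
  assumes "is_weak_deriv u g" "is_weak_deriv u h"
  shows "AE x in unit_meas. g x = h x"
proof -
  have l: "loc_integrable g" "loc_integrable h" using assms by (auto simp: is_weak_deriv_def)
  have "AE x in unit_meas. g x - h x = 0"
  proof (rule fundamental_lemma)
    show "loc_integrable (\<lambda>x. g x - h x)" using l unfolding loc_integrable_def
      by (auto simp: set_integral_diff)
    fix \<phi> assume t: "test_fun \<phi>"
    have "(\<integral>x. g x * \<phi> x - h x * \<phi> x \<partial>unit_meas) = (\<integral>x. g x * \<phi> x \<partial>unit_meas) - (\<integral>x. h x * \<phi> x \<partial>unit_meas)"
      using l t by (intro Bochner_Integration.integral_diff loc_integrable_test)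
    also have "\<dots> = 0" using assms t unfolding is_weak_deriv_def by force
    finally show "(\<integral>x. (g x - h x) * \<phi> x \<partial>unit_meas) = 0" by (simp add: left_diff_distrib)
  qed
  then show ?thesis by eventually_elim simp
qed

lemma deriv_test_fun: assumes "test_fun \<phi>" shows "test_fun (deriv \<phi>)"
proof -
  obtain K where K: "compact K" "K \<subseteq> {0<..<1}" "\<And>x. x \<notin> K \<Longrightarrow> \<phi> x = 0" using assms by (auto simp: test_fun_def)
  have "deriv \<phi> x = 0" if "x \<notin> K" for x
  proof -
    have "eventually (\<lambda>y. \<phi> y = 0) (nhds x)"
      using eventually_nhds_in_open[of "- K" x] K that by (auto simp: compact_imp_closed open_Compl elim!: eventually_mono)
    then have "(\<phi> has_field_derivative 0) (at x)" by (subst DERIV_cong_ev[OF refl _ refl]) auto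
    then show ?thesis by (rule DERIV_imp_deriv)
  qed
  then show ?thesis using smooth_deriv[OF test_funD(1)[OF assms]] K unfolding test_fun_def smooth_iff by blast
qed

lemma is_weak_deriv_lincomb:
  assumes "is_weak_deriv u g" "is_weak_deriv v h"
  shows "is_weak_deriv (\<lambda>x. c * u x + d * v x) (\<lambda>x. c * g x + d * h x)"
proof -
  have l: "loc_integrable u" "loc_integrable v" "loc_integrable g" "loc_integrable h"
    using assms by (auto simp: is_weak_deriv_def)
  have lc: "loc_integrable (\<lambda>x. c * f x + d * f' x)" if "loc_integrable f" "loc_integrable f'" for f f'
    using that unfolding loc_integrable_def by (auto intro!: set_integral_add set_integrable_mult_right)
  have eq: "(\<integral>x. (c * f x + d * f' x) * \<phi> x \<partial>unit_meas) = c * (\<integral>x. f x * \<phi> x \<partial>unit_meas) + d * (\<integral>x. f' x * \<phi> x \<partial>unit_meas)"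
    if "loc_integrable f" "loc_integrable f'" "test_fun \<phi>" for f f' \<phi>
  proof -
    have "(\<integral>x. (c * f x + d * f' x) * \<phi> x \<partial>unit_meas) = (\<integral>x. c * (f x * \<phi> x) + d * (f' x * \<phi> x) \<partial>unit_meas)"
      by (simp add: algebra_simps)
    also have "\<dots> = c * (\<integral>x. f x * \<phi> x \<partial>unit_meas) + d * (\<integral>x. f' x * \<phi> x \<partial>unit_meas)"
      using loc_integrable_test that by simp
    finally show ?thesis .
  qed
  show ?thesis unfolding is_weak_deriv_def
    using assms by (auto simp: lc l eq deriv_test_fun is_weak_deriv_def)
qed

lemma is_weak_deriv_prim:
  assumes "k \<in> borel_measurable unit_meas" "AE x in unit_meas. \<bar>k x\<bar> \<le> B"
  shows "is_weak_deriv (prim k) k"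
  unfolding is_weak_deriv_def
  using integral_by_parts_test_fun[OF assms] bounded_integrable_unit[OF assms]
  by (auto intro!: loc_integrable_integrable continuous_integrable_unit prim_continuous)

lemma is_weak_deriv_test_fun:
  assumes t: "test_fun \<phi>" shows "is_weak_deriv \<phi> (deriv \<phi>)"
proof -
  have c: "continuous_on UNIV (deriv \<phi>)" by (rule test_funD(4)[OF t])
  obtain B where B: "\<And>x. 0 \<le> x \<Longrightarrow> x \<le> 1 \<Longrightarrow> \<bar>deriv \<phi> x\<bar> \<le> B" using continuous_bounded_unit[OF c] by metis
  have b: "AE x in unit_meas. \<bar>deriv \<phi> x\<bar> \<le> B" by (rule AE_unitI) (use B in auto)
  have "(\<integral>x. \<phi> x * deriv \<psi> x \<partial>unit_meas) = - (\<integral>x. deriv \<phi> x * \<psi> x \<partial>unit_meas)" if "test_fun \<psi>" for \<psi>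
  proof -
    have "(\<integral>x. \<phi> x * deriv \<psi> x \<partial>unit_meas) = (\<integral>x. prim (deriv \<phi>) x * deriv \<psi> x \<partial>unit_meas)"
      by (rule Bochner_Integration.integral_cong) (auto simp: test_funD(7)[OF t])
    then show ?thesis using integral_by_parts_test_fun[OF continuous_imp_measurable_unit[OF c] b that] by simp
  qed
  then show ?thesis unfolding is_weak_deriv_def
    using c test_funD(3)[OF t] by (auto intro!: loc_integrable_integrable continuous_integrable_unit)
qed

text \<open>
  The weak derivative is a choice; these facts replace it by any known version.
\<close>

lemma wderivI:
  assumes "is_weak_deriv u g"
  shows "is_weak_deriv u (wderiv u)" "AE x in unit_meas. wderiv u x = g x"
    "wderiv u \<in> borel_measurable unit_meas"
proof -
  show 1: "is_weak_deriv u (wderiv u)" 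
    using someI[of "is_weak_deriv u", OF assms] by (simp add: wderiv_def)
  then show "AE x in unit_meas. wderiv u x = g x" using assms is_weak_deriv_unique by blast
  show "wderiv u \<in> borel_measurable unit_meas"
    using 1 by (auto simp: is_weak_deriv_def loc_integrable_measurable)
qed

lemma integral_abs_powr_cong:
  fixes f g :: "real \<Rightarrow> real"
  assumes "AE x in unit_meas. f x = g x" "f \<in> borel_measurable unit_meas" "g \<in> borel_measurable unit_meas"
  shows "(\<integral>x. \<bar>f x\<bar> powr p \<partial>unit_meas) = (\<integral>x. \<bar>g x\<bar> powr p \<partial>unit_meas)"
proof -
  have m: "(\<lambda>x. \<bar>f x\<bar> powr p) \<in> borel_measurable unit_meas"
    "(\<lambda>x. \<bar>g x\<bar> powr p) \<in> borel_measurable unit_meas"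
    using assms(2,3) by measurable
  have "AE x in unit_meas. \<bar>f x\<bar> powr p = \<bar>g x\<bar> powr p"
    using assms(1) by eventually_elim simp
  then show ?thesis by (intro integral_cong_AE m)
qed

lemma W1p_norm_eq:
  assumes "is_weak_deriv u g"
  shows "W1p_norm p u = ((\<integral>x. \<bar>u x\<bar> powr p \<partial>unit_meas) + (\<integral>x. \<bar>g x\<bar> powr p \<partial>unit_meas)) powr (1/p)"
proof -
  have "g \<in> borel_measurable unit_meas"
    using assms by (simp add: is_weak_deriv_def loc_integrable_measurable)
  from integral_abs_powr_cong[OF wderivI(2,3)[OF assms] this] show ?thesis
    by (simp add: W1p_norm_def)
qed

lemma Lp_cong_AE:
  assumes "f \<in> Lp_space p" "AE x in unit_meas. g x = f x" "g \<in> borel_measurable unit_meas"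
  shows "g \<in> Lp_space p"
proof -
  have "integrable unit_meas (\<lambda>x. \<bar>g x\<bar> powr p) = integrable unit_meas (\<lambda>x. \<bar>f x\<bar> powr p)"
    by (rule integrable_cong_AE) (use assms Lp_measurable in \<open>auto elim: eventually_mono\<close>)
  then show ?thesis using assms by (simp add: Lp_space_def)
qed

lemma W1pD:
  assumes "u \<in> W1p p"
  shows "u \<in> Lp_space p" "is_weak_deriv u (wderiv u)" "wderiv u \<in> Lp_space p"
proof -
  show "u \<in> Lp_space p" using assms by (simp add: W1p_def)
  obtain g where "g \<in> Lp_space p" "is_weak_deriv u g" using assms by (auto simp: W1p_def)
  then show "is_weak_deriv u (wderiv u)" "wderiv u \<in> Lp_space p"
    using wderivI[of u g] Lp_cong_AE by blast+
qed

lemma W1p_norm_powr: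
  assumes "0 < p"
  shows "W1p_norm p u powr p = (\<integral>x. \<bar>u x\<bar> powr p \<partial>unit_meas) + (\<integral>x. \<bar>wderiv u x\<bar> powr p \<partial>unit_meas)"
  unfolding W1p_norm_def using assms by (simp add: powr_powr add_nonneg_nonneg)

lemma W1p_norm_nonneg: "0 \<le> W1p_norm p u"
  by (simp add: W1p_norm_def)

lemma integral_abs_powr_le_norm:
  assumes "0 < p"
  shows "(\<integral>x. \<bar>u x\<bar> powr p \<partial>unit_meas) \<le> W1p_norm p u powr p"
    "(\<integral>x. \<bar>wderiv u x\<bar> powr p \<partial>unit_meas) \<le> W1p_norm p u powr p"
  unfolding W1p_norm_powr[OF assms] by auto

lemma tendsto_0_powr:
  assumes "0 < (q::real)" "(f \<longlongrightarrow> 0) F" "eventually (\<lambda>x. 0 \<le> f x) F"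
  shows "((\<lambda>x. f x powr q) \<longlongrightarrow> 0) F"
  using tendsto_powr'[OF assms(2) tendsto_const[of q]] assms by auto

text \<open>
  By the Hoelder inequality, approximation in the Sobolev norm implies convergence in mean of the
  functions and of their gradients, which is what passing to the limit in integrals requires.
\<close>

lemma W01p_approx:
  assumes p: "1 < p" and u: "u \<in> W01p p"
  obtains \<phi> where "\<And>n::nat. test_fun (\<phi> n)"
    "(\<lambda>n. \<integral>x. \<bar>u x - \<phi> n x\<bar> \<partial>unit_meas) \<longlonglongrightarrow> 0"
    "(\<lambda>n. \<integral>x. \<bar>wderiv u x - deriv (\<phi> n) x\<bar> \<partial>unit_meas) \<longlonglongrightarrow> 0"
proof -
  have u1: "u \<in> W1p p" using u by (simp add: W01p_def)
  note W = W1pD[OF u1]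
  obtain \<phi> where t: "\<And>n::nat. test_fun (\<phi> n)" and lim: "(\<lambda>n. W1p_norm p (\<lambda>x. u x - \<phi> n x)) \<longlonglongrightarrow> 0"
    using u by (auto simp: W01p_def)
  have tL: "f \<in> Lp_space p" if c: "continuous_on UNIV f" for f
  proof -
    obtain B where B: "\<And>x. 0 \<le> x \<Longrightarrow> x \<le> 1 \<Longrightarrow> \<bar>f x\<bar> \<le> B" using continuous_bounded_unit[OF c] by metis
    show ?thesis by (rule bounded_Lp[OF continuous_imp_measurable_unit[OF c] AE_unitI[of "\<lambda>x. \<bar>f x\<bar> \<le> B"]]) (use B p in auto)
  qed
  have L1: "(\<lambda>x. u x - \<phi> n x) \<in> Lp_space p" and L2: "(\<lambda>x. wderiv u x - deriv (\<phi> n) x) \<in> Lp_space p" for n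
    using Lp_lincomb[OF W(1) tL[OF test_funD(3)[OF t[of n]]], of 1 "-1"] Lp_lincomb[OF W(3) tL[OF test_funD(4)[OF t[of n]]], of 1 "-1"] p by auto
  have wd: "is_weak_deriv (\<lambda>x. u x - \<phi> n x) (\<lambda>x. wderiv u x - deriv (\<phi> n) x)" for n
    using is_weak_deriv_lincomb[OF W(2) is_weak_deriv_test_fun[OF t[of n]], of 1 "-1"] by simp
  have eq: "W1p_norm p (\<lambda>x. u x - \<phi> n x) = ((\<integral>x. \<bar>u x - \<phi> n x\<bar> powr p \<partial>unit_meas) + (\<integral>x. \<bar>wderiv u x - deriv (\<phi> n) x\<bar> powr p \<partial>unit_meas)) powr (1/p)" for n
    by (rule W1p_norm_eq[OF wd])
  have b1: "(\<integral>x. \<bar>u x - \<phi> n x\<bar> \<partial>unit_meas) \<le> W1p_norm p (\<lambda>x. u x - \<phi> n x)" for n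
    unfolding eq using p by (intro order_trans[OF abs_integral_le_Lp[OF p L1]] powr_mono2) auto
  have b2: "(\<integral>x. \<bar>wderiv u x - deriv (\<phi> n) x\<bar> \<partial>unit_meas) \<le> W1p_norm p (\<lambda>x. u x - \<phi> n x)" for n
    unfolding eq using p by (intro order_trans[OF abs_integral_le_Lp[OF p L2]] powr_mono2) auto
  show ?thesis
  proof (rule that[OF t])
    show "(\<lambda>n. \<integral>x. \<bar>u x - \<phi> n x\<bar> \<partial>unit_meas) \<longlonglongrightarrow> 0"
      by (rule Lim_null_comparison[OF _ lim]) (use b1 in auto)
    show "(\<lambda>n. \<integral>x. \<bar>wderiv u x - deriv (\<phi> n) x\<bar> \<partial>unit_meas) \<longlonglongrightarrow> 0"
      by (rule Lim_null_comparison[OF _ lim]) (use b2 in auto)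
  qed
qed

text \<open>
  A test function is the primitive of its derivative, and the primitive depends continuously on the
  gradient in mean. Passing to the limit, every element of the space is the primitive of its weak
  derivative, and the derivative has integral zero.
\<close>

lemma W01pD:
  assumes p: "1 < p" and u: "u \<in> W01p p"
  shows "u \<in> Lp_space p" "is_weak_deriv u (wderiv u)" "wderiv u \<in> Lp_space p"
    "integrable unit_meas u" "integrable unit_meas (wderiv u)"
    "(\<integral>x. wderiv u x \<partial>unit_meas) = 0" "AE x in unit_meas. u x = prim (wderiv u) x"
proof -
  have u1: "u \<in> W1p p" using u by (simp add: W01p_def)
  show W: "u \<in> Lp_space p" "is_weak_deriv u (wderiv u)" "wderiv u \<in> Lp_space p" by (rule W1pD[OF u1])+
  show i: "integrable unit_meas u" "integrable unit_meas (wderiv u)" using W Lp_integrable p by auto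
  obtain \<phi> where t: "\<And>n::nat. test_fun (\<phi> n)"
    and l1: "(\<lambda>n. \<integral>x. \<bar>u x - \<phi> n x\<bar> \<partial>unit_meas) \<longlonglongrightarrow> 0"
    and l2: "(\<lambda>n. \<integral>x. \<bar>wderiv u x - deriv (\<phi> n) x\<bar> \<partial>unit_meas) \<longlonglongrightarrow> 0"
    using W01p_approx[OF p u] by blast
  have ti: "integrable unit_meas (\<phi> n)" "integrable unit_meas (deriv (\<phi> n))" for n
    by (intro continuous_integrable_unit test_funD t)+
  have b: "\<bar>prim (wderiv u) x - \<phi> n x\<bar> \<le> (\<integral>x. \<bar>wderiv u x - deriv (\<phi> n) x\<bar> \<partial>unit_meas)" if "0 \<le> x" "x \<le> 1" for x n
  proof -
    have "prim (wderiv u) x - \<phi> n x = prim (\<lambda>x. wderiv u x - deriv (\<phi> n) x) x"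
      using test_funD(7)[OF t that] prim_diff[OF i(2) ti(2)] by simp
    also have "\<bar>\<dots>\<bar> \<le> (\<integral>x. \<bar>wderiv u x - deriv (\<phi> n) x\<bar> \<partial>unit_meas)"
      by (intro abs_prim_le Bochner_Integration.integrable_diff i ti)
    finally show ?thesis .
  qed
  have "\<bar>\<integral>x. wderiv u x \<partial>unit_meas\<bar> \<le> 0"
  proof (rule LIMSEQ_le[OF tendsto_const l2], intro exI allI impI)
    fix n show "\<bar>\<integral>x. wderiv u x \<partial>unit_meas\<bar> \<le> (\<integral>x. \<bar>wderiv u x - deriv (\<phi> n) x\<bar> \<partial>unit_meas)"
      using b[of 1 n] test_funD(6)[OF t, of 1 n] by (simp add: prim_1)
  qed
  then show "(\<integral>x. wderiv u x \<partial>unit_meas) = 0" by simp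
  have pm: "integrable unit_meas (prim (wderiv u))" by (intro continuous_integrable_unit prim_continuous i)
  have "(\<integral>x. \<bar>u x - prim (wderiv u) x\<bar> \<partial>unit_meas) \<le> 0 + 0"
  proof (rule LIMSEQ_le[OF tendsto_const tendsto_add[OF l1 l2]], intro exI allI impI)
    fix n
    have "(\<integral>x. \<bar>u x - prim (wderiv u) x\<bar> \<partial>unit_meas) \<le> (\<integral>x. \<bar>u x - \<phi> n x\<bar> + (\<integral>x. \<bar>wderiv u x - deriv (\<phi> n) x\<bar> \<partial>unit_meas) \<partial>unit_meas)"
    proof (intro integral_mono_AE AE_unitI)
      fix x :: real assume "0 < x" "x < 1"
      then show "\<bar>u x - prim (wderiv u) x\<bar> \<le> \<bar>u x - \<phi> n x\<bar> + (\<integral>x. \<bar>wderiv u x - deriv (\<phi> n) x\<bar> \<partial>unit_meas)"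
        using b[of x n] by linarith
    qed (use i pm ti in auto)
    also have "\<dots> = (\<integral>x. \<bar>u x - \<phi> n x\<bar> \<partial>unit_meas) + (\<integral>x. \<bar>wderiv u x - deriv (\<phi> n) x\<bar> \<partial>unit_meas)"
      using i ti by (subst Bochner_Integration.integral_add) auto
    finally show "(\<integral>x. \<bar>u x - prim (wderiv u) x\<bar> \<partial>unit_meas) \<le> \<dots>" .
  qed
  then have "(\<integral>x. \<bar>u x - prim (wderiv u) x\<bar> \<partial>unit_meas) = 0" by (simp add: antisym)
  then have "AE x in unit_meas. \<bar>u x - prim (wderiv u) x\<bar> = 0"
    using i pm by (subst (asm) integral_nonneg_eq_0_iff_AE) auto
  then show "AE x in unit_meas. u x = prim (wderiv u) x" by eventually_elim simp
qed

section \<open>Constructing elements and functionals of the Sobolev space\<close>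

text \<open>
  The antiderivative is constant on both sides of the support of \<open>h\<close>; it vanishes to the left
  by normalization and to the right because the integral of \<open>h\<close> is zero.
\<close>

lemma test_fun_antiderivative:
  assumes h: "test_fun h" and z: "(\<integral>x. h x \<partial>unit_meas) = 0"
  obtains \<phi> where "test_fun \<phi>" "deriv \<phi> = h"
proof -
  obtain F where F: "\<And>t. (F has_field_derivative h t) (at t)" "F 0 = 0"
    using exists_antiderivative[OF test_funD(3)[OF h]] by metis
  obtain K where K: "compact K" "K \<subseteq> {0<..<1}" "\<And>x. x \<notin> K \<Longrightarrow> h x = 0" using h by (auto simp: test_fun_def)
  \<comment> \<open>The extra point keeps the set nonempty, so that it has a least and a greatest element.\<close>
  define K' where "K' = insert (1/2) K"
  have K': "compact K'" "K' \<noteq> {}" "K' \<subseteq> {0<..<1}" using K by (auto simp: K'_def)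
  obtain c where c: "c \<in> K'" "\<And>x. x \<in> K' \<Longrightarrow> c \<le> x" using compact_attains_inf[OF K'(1,2)] by metis
  obtain d where d: "d \<in> K'" "\<And>x. x \<in> K' \<Longrightarrow> x \<le> d" using compact_attains_sup[OF K'(1,2)] by metis
  have cd: "0 < c" "d < 1" "0 < d" "c < 1" using c(1) d(1) K'(3) by auto
  have F1: "F 1 = 0" using prim_FTC[OF F(1) test_funD(3)[OF h], of 1] z F(2) by (simp add: prim_1)
  have const: "F x = F y" if "x \<in> S" "y \<in> S" "convex S" "\<And>t. t \<in> S \<Longrightarrow> h t = 0" for x y S
  proof -
    have "\<exists>c. \<forall>x\<in>S. F x = c"
      by (rule has_field_derivative_zero_constant[OF that(3)])
        (use F(1) that(4) in \<open>metis has_field_derivative_at_within\<close>)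
    then show ?thesis using that by auto
  qed
  have out: "h x = 0" if "x < c \<or> x > d" for x
    by (rule K(3)) (use that c(2)[of x] d(2)[of x] in \<open>auto simp: K'_def\<close>)
  have "F x = 0" if "x \<notin> {c..d}" for x
  proof -
    from that consider "x < c" | "x > d" by force
    then show ?thesis
    proof cases
      case 1
      then show ?thesis using const[of x "{..<c}" 0] cd F(2) out by auto
    next
      case 2
      then show ?thesis using const[of x "{d<..}" 1] cd F1 out by auto
    qed
  qed
  moreover have "smooth F" by (rule smooth_by_deriv[OF F(1) test_funD(1)[OF h]])
  moreover have "{c..d} \<subseteq> {0<..<1}" using cd by auto
  ultimately have "test_fun F" unfolding test_fun_def smooth_iff using compact_Icc by blast
  moreover have "deriv F = h" by (rule DERIV_UNIV_imp(2)[OF F(1)])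
  ultimately show ?thesis by (rule that)
qed

lemma test_fun_lincomb: "test_fun f \<Longrightarrow> test_fun g \<Longrightarrow> test_fun (\<lambda>x. f x + c * g x)"
proof -
  assume f: "test_fun f" and g: "test_fun g"
  obtain K where K: "compact K" "K \<subseteq> {0<..<1}" "\<And>x. x \<notin> K \<Longrightarrow> f x = 0" using f by (auto simp: test_fun_def)
  obtain L where L: "compact L" "L \<subseteq> {0<..<1}" "\<And>x. x \<notin> L \<Longrightarrow> g x = 0" using g by (auto simp: test_fun_def)
  have "smooth (\<lambda>x. f x + c * g x)" using test_funD(1)[OF f] test_funD(1)[OF g] by (intro smooth_add smooth_mult smooth_const)
  moreover have "compact (K \<union> L)" "K \<union> L \<subseteq> {0<..<1}" "\<And>x. x \<notin> K \<union> L \<Longrightarrow> f x + c * g x = 0"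
    using K L by auto
  ultimately show ?thesis unfolding test_fun_def smooth_iff by blast
qed

text \<open>
  The converse of \<open>W01pD\<close> for bounded gradients. The gradient is approximated boundedly by test
  functions of integral zero; their primitives are test functions and converge in the Sobolev
  norm.
\<close>

lemma prim_in_W01p:
  assumes p: "1 < p" and g: "g \<in> borel_measurable unit_meas" "AE x in unit_meas. \<bar>g x\<bar> \<le> B"
    and z: "(\<integral>x. g x \<partial>unit_meas) = 0"
  shows "prim g \<in> W01p p" "AE x in unit_meas. wderiv (prim g) x = g x"
proof -
  have wd: "is_weak_deriv (prim g) g" by (rule is_weak_deriv_prim[OF g])
  show "AE x in unit_meas. wderiv (prim g) x = g x" by (rule wderivI[OF wd])
  have gi: "integrable unit_meas g" by (rule bounded_integrable_unit[OF g])
  have gL: "g \<in> Lp_space p" by (rule bounded_Lp[OF g]) (use p in simp)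
  have pL: "prim g \<in> Lp_space p"
    by (rule bounded_Lp[OF prim_measurable[OF gi] AE_I2]) (use p abs_prim_le_bound[OF g] in auto)
  have W1: "prim g \<in> W1p p" using wd gL pL by (auto simp: W1p_def)
  obtain P where P: "\<And>n::nat. real_polynomial_function (P n)"
    and PB: "\<And>n x. 0 \<le> x \<Longrightarrow> x \<le> 1 \<Longrightarrow> \<bar>P n x\<bar> \<le> \<bar>B\<bar> + 1"
    and lim: "AE x in unit_meas. (\<lambda>n. P n x) \<longlonglongrightarrow> g x"
    using bounded_approx_polynomial[OF g] by metis
  have Ps: "smooth (P n)" for n by (rule smooth_real_polynomial_function[OF P])
  define h where "h n x = cutoff (Suc n) x * P n x" for n x
  define \<eta> where "\<eta> x = cutoff (Suc 2) x * 1" for x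
  have ht: "test_fun (h n)" for n unfolding h_def by (rule cutoff_mult_test_fun[OF Ps])
  have ct: "test_fun \<eta>" unfolding \<eta>_def by (rule cutoff_mult_test_fun[OF smooth_const])
  have hi: "integrable unit_meas (h n)" for n by (intro continuous_integrable_unit test_funD(3) ht)
  have ci: "integrable unit_meas \<eta>" by (intro continuous_integrable_unit test_funD(3) ct)
  have hB: "\<bar>h n x\<bar> \<le> \<bar>B\<bar> + 1" if "0 \<le> x" "x \<le> 1" for n x
  proof -
    have "\<bar>h n x\<bar> = cutoff (Suc n) x * \<bar>P n x\<bar>" by (simp add: h_def abs_mult cutoff_range)
    also have "\<dots> \<le> 1 * (\<bar>B\<bar> + 1)" by (intro mult_mono cutoff_range PB that) auto
    finally show ?thesis by simp
  qed
  define m where "m = (\<integral>x. \<eta> x \<partial>unit_meas)"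
  have m: "m > 0"
  proof -
    have "m \<ge> 0" unfolding m_def \<eta>_def by (rule Bochner_Integration.integral_nonneg) (auto simp: cutoff_range)
    moreover have "m \<noteq> 0"
    proof
      assume "m = 0"
      then have "AE x in unit_meas. \<eta> x = 0"
        unfolding m_def using ci by (subst (asm) integral_nonneg_eq_0_iff_AE) (auto simp: \<eta>_def cutoff_range)
      then have "AE x in lebesgue. x \<in> {0<..<1} \<longrightarrow> \<eta> x = 0" by (subst (asm) AE_restrict_space_iff) auto
      then have "AE x in lebesgue. x \<notin> {2/5<..<3/5::real}"
      proof eventually_elim
        case (elim x)
        have "0 < \<eta> x" if "x \<in> {2/5<..<3/5}"
          unfolding \<eta>_def mult_1_right by (rule cutoff_pos) (use that in auto)
        then show ?case using elim by force
      qed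
      then have "{2/5<..<3/5::real} \<in> null_sets lebesgue" by (subst AE_iff_null_sets) auto
      then have "emeasure lebesgue {2/5<..<3/5::real} = 0" by blast
      then show False by simp
    qed
    ultimately show ?thesis by simp
  qed
  \<comment> \<open>Subtracting a multiple of a fixed bump makes the integrals vanish, and the multiples tend to 0.\<close>
  define k where "k n x = h n x + (- (\<integral>x. h n x \<partial>unit_meas) / m) * \<eta> x" for n x
  have kt: "test_fun (k n)" for n unfolding k_def by (rule test_fun_lincomb[OF ht ct])
  have kz: "(\<integral>x. k n x \<partial>unit_meas) = 0" for n
    unfolding k_def using hi ci m by (simp add: m_def)
  have "\<exists>\<phi>. test_fun \<phi> \<and> deriv \<phi> = k n" for n using test_fun_antiderivative[OF kt kz] by metis
  then obtain \<phi> where \<phi>: "\<And>n. test_fun (\<phi> n)" "\<And>n. deriv (\<phi> n) = k n" by metis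
  have ki: "integrable unit_meas (k n)" for n by (intro continuous_integrable_unit test_funD(3) kt)
  have hlim: "AE x in unit_meas. (\<lambda>n. h n x) \<longlonglongrightarrow> g x"
  proof -
    have "AE x in unit_meas. 0 < x \<and> x < 1" by (rule AE_unitI) auto
    with lim show ?thesis
    proof eventually_elim
      case (elim x)
      have "(\<lambda>n. h n x) \<longlonglongrightarrow> 1 * g x" unfolding h_def
        by (intro tendsto_mult LIMSEQ_Suc[OF cutoff_tendsto] elim) (use elim in auto)
      then show ?case by simp
    qed
  qed
  have hI: "(\<lambda>n. \<integral>x. h n x \<partial>unit_meas) \<longlonglongrightarrow> 0"
  proof -
    have "(\<lambda>n. \<integral>x. h n x \<partial>unit_meas) \<longlonglongrightarrow> (\<integral>x. g x \<partial>unit_meas)"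
      by (rule integral_dominated_convergence[where w = "\<lambda>x. \<bar>B\<bar> + 1"])
        (use g hlim hi hB in \<open>auto intro!: AE_unitI\<close>)
    then show ?thesis using z by simp
  qed
  have klim: "AE x in unit_meas. (\<lambda>n. k n x) \<longlonglongrightarrow> g x"
    using hlim
  proof eventually_elim
    case (elim x)
    have "(\<lambda>n. k n x) \<longlonglongrightarrow> g x + (- 0 / m) * \<eta> x" unfolding k_def
      by (intro tendsto_intros elim hI) (use m in simp)
    then show ?case by simp
  qed
  define C where "C = \<bar>B\<bar> + 1 + (\<bar>B\<bar> + 1) / m"
  have kB: "\<bar>k n x\<bar> \<le> C" if "0 \<le> x" "x \<le> 1" for n x
  proof -
    have a: "\<bar>\<integral>x. h n x \<partial>unit_meas\<bar> \<le> \<bar>B\<bar> + 1"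
      by (rule abs_integral_unit_le[OF borel_measurable_integrable[OF hi]]) (auto intro!: AE_unitI hB)
    have "\<bar>k n x\<bar> \<le> \<bar>h n x\<bar> + \<bar>(- (\<integral>x. h n x \<partial>unit_meas) / m) * \<eta> x\<bar>" unfolding k_def by (rule abs_triangle_ineq)
    also have "\<bar>(- (\<integral>x. h n x \<partial>unit_meas) / m) * \<eta> x\<bar> = \<bar>\<integral>x. h n x \<partial>unit_meas\<bar> / m * cutoff (Suc 2) x"
      using m by (simp add: abs_mult \<eta>_def cutoff_range)
    also have "\<dots> \<le> (\<bar>B\<bar> + 1) / m * 1"
      using m a by (intro mult_mono divide_right_mono cutoff_range) auto
    finally show ?thesis using hB[OF that, of n] by (simp add: C_def)
  qed
  have dm: "(\<lambda>x. g x - k n x) \<in> borel_measurable unit_meas" for n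
    using g(1) borel_measurable_integrable[OF ki] by measurable
  have dB: "AE x in unit_meas. \<bar>g x - k n x\<bar> \<le> \<bar>B\<bar> + C" for n
  proof -
    have "AE x in unit_meas. \<bar>k n x\<bar> \<le> C" by (rule AE_unitI) (use kB in auto)
    with g(2) show ?thesis by eventually_elim linarith
  qed
  have dI: "(\<lambda>n. \<integral>x. \<bar>g x - k n x\<bar> powr p \<partial>unit_meas) \<longlonglongrightarrow> 0"
  proof -
    have "(\<lambda>n. \<integral>x. \<bar>g x - k n x\<bar> powr p \<partial>unit_meas) \<longlonglongrightarrow> (\<integral>x. 0 \<partial>unit_meas)"
    proof (rule integral_dominated_convergence[where w = "\<lambda>x. \<bar>\<bar>B\<bar> + C\<bar> powr p"])
      show "AE x in unit_meas. (\<lambda>n. \<bar>g x - k n x\<bar> powr p) \<longlonglongrightarrow> 0"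
        using klim
      proof eventually_elim
        case (elim x)
        have "(\<lambda>n. \<bar>g x - k n x\<bar>) \<longlonglongrightarrow> \<bar>g x - g x\<bar>" by (intro tendsto_intros elim)
        then show ?case using p by (intro tendsto_0_powr) auto
      qed
      show "AE x in unit_meas. norm (\<bar>g x - k n x\<bar> powr p) \<le> \<bar>\<bar>B\<bar> + C\<bar> powr p" for n
        using dB[of n] by eventually_elim (use p in \<open>auto intro!: powr_mono2\<close>)
    qed (use dm in measurable)
    then show ?thesis by simp
  qed
  have dL: "(\<lambda>x. g x - k n x) \<in> Lp_space p" for n by (rule bounded_Lp[OF dm dB]) (use p in simp)
  have wdn: "is_weak_deriv (\<lambda>x. prim g x - \<phi> n x) (\<lambda>x. g x - k n x)" for n
    using is_weak_deriv_lincomb[OF wd is_weak_deriv_test_fun[OF \<phi>(1)[of n]], of 1 "-1"] by (simp add: \<phi>(2))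
  have ub: "(\<integral>x. \<bar>prim g x - \<phi> n x\<bar> powr p \<partial>unit_meas) \<le> (\<integral>x. \<bar>g x - k n x\<bar> powr p \<partial>unit_meas)" for n
  proof -
    let ?c = "\<integral>x. \<bar>g x - k n x\<bar> powr p \<partial>unit_meas"
    have ptw: "\<bar>prim g x - \<phi> n x\<bar> powr p \<le> ?c" if "0 < x" "x < 1" for x
    proof -
      have "prim g x - \<phi> n x = prim (\<lambda>x. g x - k n x) x"
        using test_funD(7)[OF \<phi>(1)[of n], of x] that prim_diff[OF gi ki] by (simp add: \<phi>(2))
      then have "\<bar>prim g x - \<phi> n x\<bar> \<le> (\<integral>x. \<bar>g x - k n x\<bar> \<partial>unit_meas)"
        using abs_prim_le[OF Bochner_Integration.integrable_diff[OF gi ki]] by simp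
      then have "\<bar>prim g x - \<phi> n x\<bar> powr p \<le> (\<integral>x. \<bar>g x - k n x\<bar> \<partial>unit_meas) powr p"
        using p by (intro powr_mono2) auto
      also have "\<dots> \<le> ?c" by (rule abs_integral_powr_le[OF p dL])
      finally show ?thesis .
    qed
    have "\<bar>\<integral>x. \<bar>prim g x - \<phi> n x\<bar> powr p \<partial>unit_meas\<bar> \<le> ?c"
    proof (rule abs_integral_unit_le)
      have [measurable]: "(\<lambda>x. prim g x - \<phi> n x) \<in> borel_measurable unit_meas"
        by (intro borel_measurable_diff prim_measurable gi continuous_imp_measurable_unit test_funD(3) \<phi>)
      show "(\<lambda>x. \<bar>prim g x - \<phi> n x\<bar> powr p) \<in> borel_measurable unit_meas" by measurable
    qed (auto intro!: AE_unitI ptw)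
    then show ?thesis by simp
  qed
  have "(\<lambda>n. W1p_norm p (\<lambda>x. prim g x - \<phi> n x)) \<longlonglongrightarrow> 0"
  proof (rule Lim_null_comparison)
    have "(\<lambda>n. 2 * (\<integral>x. \<bar>g x - k n x\<bar> powr p \<partial>unit_meas)) \<longlonglongrightarrow> 2 * 0" by (intro tendsto_intros dI)
    then show "(\<lambda>n. (2 * (\<integral>x. \<bar>g x - k n x\<bar> powr p \<partial>unit_meas)) powr (1/p)) \<longlonglongrightarrow> 0"
      using p by (intro tendsto_0_powr) auto
    have "W1p_norm p (\<lambda>x. prim g x - \<phi> n x) \<le> (2 * (\<integral>x. \<bar>g x - k n x\<bar> powr p \<partial>unit_meas)) powr (1/p)" for n
      unfolding W1p_norm_eq[OF wdn] using ub[of n] p by (intro powr_mono2) auto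
    then show "eventually (\<lambda>n. norm (W1p_norm p (\<lambda>x. prim g x - \<phi> n x)) \<le> (2 * (\<integral>x. \<bar>g x - k n x\<bar> powr p \<partial>unit_meas)) powr (1/p)) sequentially"
      by (simp add: W1p_norm_nonneg)
  qed
  then show "prim g \<in> W01p p" using W1 \<phi>(1) by (auto simp: W01p_def)
qed

lemma W01p_zero: "1 < p \<Longrightarrow> (\<lambda>x. 0) \<in> W01p p"
proof -
  assume p: "1 < p"
  have "prim (\<lambda>x. 0) \<in> W01p p" by (rule prim_in_W01p[OF p, of _ 0]) auto
  moreover have "prim (\<lambda>x. 0) = (\<lambda>x. 0)" by (auto simp: prim_def)
  ultimately show ?thesis by simp
qed

text \<open>
  Integration by parts holds for test functions, and both sides are continuous for convergence in
  mean of the functions and of their gradients.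
\<close>

lemma W01p_integral_by_parts:
  assumes p: "1 < p" and k: "k \<in> borel_measurable unit_meas" "AE x in unit_meas. \<bar>k x\<bar> \<le> B"
    and v: "v \<in> W01p p"
  shows "(\<integral>x. k x * v x \<partial>unit_meas) = - (\<integral>x. prim k x * wderiv v x \<partial>unit_meas)"
proof -
  note V = W01pD[OF p v]
  obtain \<phi> where t: "\<And>n::nat. test_fun (\<phi> n)"
    and l1: "(\<lambda>n. \<integral>x. \<bar>v x - \<phi> n x\<bar> \<partial>unit_meas) \<longlonglongrightarrow> 0"
    and l2: "(\<lambda>n. \<integral>x. \<bar>wderiv v x - deriv (\<phi> n) x\<bar> \<partial>unit_meas) \<longlonglongrightarrow> 0"
    using W01p_approx[OF p v] by blast
  have ti: "integrable unit_meas (\<phi> n)" "integrable unit_meas (deriv (\<phi> n))" for n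
    by (intro continuous_integrable_unit test_funD t)+
  have pk: "prim k \<in> borel_measurable unit_meas" "AE x in unit_meas. \<bar>prim k x\<bar> \<le> B"
    using prim_measurable[OF bounded_integrable_unit[OF k]] abs_prim_le_bound[OF k] by auto
  have lim: "(\<lambda>n. \<integral>x. w x * f n x \<partial>unit_meas) \<longlonglongrightarrow> (\<integral>x. w x * f0 x \<partial>unit_meas)"
    if w: "w \<in> borel_measurable unit_meas" "AE x in unit_meas. \<bar>w x\<bar> \<le> B"
      and f: "\<And>n. integrable unit_meas (f n)" "integrable unit_meas f0" "(\<lambda>n. \<integral>x. \<bar>f0 x - f n x\<bar> \<partial>unit_meas) \<longlonglongrightarrow> 0"
    for w f0 and f :: "nat \<Rightarrow> real \<Rightarrow> real"
  proof -
    have wi: "integrable unit_meas (\<lambda>x. w x * f n x)" "integrable unit_meas (\<lambda>x. w x * f0 x)" for n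
      using integrable_bounded_mult[OF _ w] f by auto
    have "(\<lambda>n. (\<integral>x. w x * f n x \<partial>unit_meas) - (\<integral>x. w x * f0 x \<partial>unit_meas)) \<longlonglongrightarrow> 0"
    proof (rule Lim_null_comparison)
      show "(\<lambda>n. B * (\<integral>x. \<bar>f0 x - f n x\<bar> \<partial>unit_meas)) \<longlonglongrightarrow> 0" using tendsto_mult_left[OF f(3), of B] by simp
      have "\<bar>(\<integral>x. w x * f n x \<partial>unit_meas) - (\<integral>x. w x * f0 x \<partial>unit_meas)\<bar> \<le> B * (\<integral>x. \<bar>f0 x - f n x\<bar> \<partial>unit_meas)" for n
      proof -
        have "(\<integral>x. w x * f n x \<partial>unit_meas) - (\<integral>x. w x * f0 x \<partial>unit_meas) = (\<integral>x. w x * f n x - w x * f0 x \<partial>unit_meas)"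
          using wi by simp
        also have "\<bar>\<dots>\<bar> \<le> (\<integral>x. \<bar>w x * f n x - w x * f0 x\<bar> \<partial>unit_meas)" by simp
        also have "\<dots> \<le> (\<integral>x. B * \<bar>f0 x - f n x\<bar> \<partial>unit_meas)"
        proof (rule integral_mono_AE)
          show "AE x in unit_meas. \<bar>w x * f n x - w x * f0 x\<bar> \<le> B * \<bar>f0 x - f n x\<bar>"
            using w(2)
          proof eventually_elim
            case (elim x)
            have "\<bar>w x * f n x - w x * f0 x\<bar> = \<bar>w x\<bar> * \<bar>f0 x - f n x\<bar>"
              by (simp add: abs_mult[symmetric] algebra_simps abs_minus_commute)
            then show ?case using elim by (simp add: mult_right_mono)
          qed
        qed (use wi f in auto)
        finally show ?thesis by simp
      qed
      then show "eventually (\<lambda>n. norm ((\<integral>x. w x * f n x \<partial>unit_meas) - (\<integral>x. w x * f0 x \<partial>unit_meas)) \<le> B * (\<integral>x. \<bar>f0 x - f n x\<bar> \<partial>unit_meas)) sequentially"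
        by simp
    qed
    then show ?thesis by (simp add: LIM_zero_iff)
  qed
  have "(\<lambda>n. - (\<integral>x. prim k x * deriv (\<phi> n) x \<partial>unit_meas)) \<longlonglongrightarrow> - (\<integral>x. prim k x * wderiv v x \<partial>unit_meas)"
    by (intro tendsto_minus lim[OF pk ti(2) V(5) l2])
  then have "(\<lambda>n. \<integral>x. k x * \<phi> n x \<partial>unit_meas) \<longlonglongrightarrow> - (\<integral>x. prim k x * wderiv v x \<partial>unit_meas)"
    using integral_by_parts_test_fun[OF k t] by simp
  with lim[OF k ti(1) V(4) l1] show ?thesis by (rule LIMSEQ_unique)
qed

lemma wderiv_lincomb:
  assumes "is_weak_deriv u g" "is_weak_deriv v h"
  shows "AE x in unit_meas. wderiv (\<lambda>x. c * u x + d * v x) x = c * g x + d * h x"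
    "wderiv (\<lambda>x. c * u x + d * v x) \<in> borel_measurable unit_meas"
  using wderivI[OF is_weak_deriv_lincomb[OF assms, of c d]] by auto

lemma wderiv_uminus:
  assumes "is_weak_deriv u g" shows "AE x in unit_meas. wderiv (\<lambda>x. - u x) x = - g x"
    "wderiv (\<lambda>x. - u x) \<in> borel_measurable unit_meas" "is_weak_deriv (\<lambda>x. - u x) (\<lambda>x. - g x)"
  using wderiv_lincomb[OF assms assms, of "-1" 0] is_weak_deriv_lincomb[OF assms assms, of "-1" 0] by auto

lemma wderiv_diff:
  assumes "is_weak_deriv u g" "is_weak_deriv v h"
  shows "AE x in unit_meas. wderiv (\<lambda>x. u x - v x) x = g x - h x"
    "wderiv (\<lambda>x. u x - v x) \<in> borel_measurable unit_meas" "is_weak_deriv (\<lambda>x. u x - v x) (\<lambda>x. g x - h x)"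
  using wderiv_lincomb[OF assms, of 1 "-1"] is_weak_deriv_lincomb[OF assms, of 1 "-1"] by auto

lemma W1p_norm_uminus: assumes "is_weak_deriv u g" shows "W1p_norm p (\<lambda>x. - u x) = W1p_norm p u"
  unfolding W1p_norm_eq[OF wderiv_uminus(3)[OF assms]] W1p_norm_eq[OF assms] by simp

lemma W01p_uminus: assumes p: "1 < p" and u: "u \<in> W01p p" shows "(\<lambda>x. - u x) \<in> W01p p"
proof -
  note U = W01pD[OF p u]
  obtain \<phi> where t: "\<And>n::nat. test_fun (\<phi> n)" and lim: "(\<lambda>n. W1p_norm p (\<lambda>x. u x - \<phi> n x)) \<longlonglongrightarrow> 0"
    using u by (auto simp: W01p_def)
  have eq: "W1p_norm p (\<lambda>x. - u x - - \<phi> n x) = W1p_norm p (\<lambda>x. u x - \<phi> n x)" for n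
    using W1p_norm_uminus[OF wderiv_diff(3)[OF U(2) is_weak_deriv_test_fun[OF t[of n]]]] by simp
  have t': "test_fun (\<lambda>x. - \<phi> n x)" for n using test_fun_lincomb[OF t[of n] t[of n], of "-2"] by simp
  have "(\<lambda>x. - u x) \<in> Lp_space p" "(\<lambda>x. - wderiv u x) \<in> Lp_space p"
    using U(1,3) by (auto simp: Lp_space_def)
  then have "(\<lambda>x. - u x) \<in> W1p p" using wderiv_uminus(3)[OF U(2)] by (auto simp: W1p_def)
  moreover have "(\<lambda>n. W1p_norm p (\<lambda>x. - u x - - \<phi> n x)) \<longlonglongrightarrow> 0" using lim unfolding eq .
  ultimately show ?thesis using t' unfolding W01p_def mem_Collect_eq
    by (intro conjI exI[of _ "\<lambda>n x. - \<phi> n x"]) auto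
qed

lemma integral_abs_wderiv_le:
  assumes p: "1 < p" and u: "u \<in> W01p p"
  shows "(\<integral>x. \<bar>wderiv u x\<bar> \<partial>unit_meas) \<le> W1p_norm p u"
proof -
  have "(\<integral>x. \<bar>wderiv u x\<bar> \<partial>unit_meas) \<le> (\<integral>x. \<bar>wderiv u x\<bar> powr p \<partial>unit_meas) powr (1/p)"
    by (rule abs_integral_le_Lp[OF p W01pD(3)[OF p u]])
  also have "\<dots> \<le> W1p_norm p u" unfolding W1p_norm_def using p by (intro powr_mono2) auto
  finally show ?thesis .
qed

lemma abs_prim_wderiv_le:
  assumes p: "1 < p" and u: "u \<in> W01p p"
  shows "\<bar>prim (wderiv u) x\<bar> \<le> W1p_norm p u"
  using abs_prim_le[OF W01pD(5)[OF p u], of x] integral_abs_wderiv_le[OF p u] by linarith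

lemma W1p_norm_prim_le:
  assumes p: "1 < p" and g: "g \<in> borel_measurable unit_meas" "AE x in unit_meas. \<bar>g x\<bar> \<le> K"
  shows "W1p_norm p (prim g) \<le> 2 * K"
proof -
  have K: "0 \<le> K" using abs_prim_le_bound[OF g, of 0] by simp
  have [measurable]: "prim g \<in> borel_measurable unit_meas" by (rule prim_measurable[OF bounded_integrable_unit[OF g]])
  note [measurable] = g(1)
  have "\<bar>\<integral>x. \<bar>prim g x\<bar> powr p \<partial>unit_meas\<bar> \<le> K powr p"
    by (rule abs_integral_unit_le) (use abs_prim_le_bound[OF g] p in \<open>auto intro!: powr_mono2\<close>)
  moreover have "\<bar>\<integral>x. \<bar>g x\<bar> powr p \<partial>unit_meas\<bar> \<le> K powr p"
  proof (rule abs_integral_unit_le)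
    show "AE x in unit_meas. \<bar>\<bar>g x\<bar> powr p\<bar> \<le> K powr p"
      using g(2) by eventually_elim (use p in \<open>auto intro!: powr_mono2\<close>)
  qed measurable
  ultimately have "W1p_norm p (prim g) \<le> (2 * K powr p) powr (1/p)"
    unfolding W1p_norm_eq[OF is_weak_deriv_prim[OF g]] using p by (intro powr_mono2) auto
  also have "\<dots> = 2 powr (1/p) * K" using p K by (simp add: powr_mult powr_powr)
  also have "\<dots> \<le> 2 * K"
  proof -
    have "(2::real) powr (1/p) \<le> 2 powr 1" using p by (intro powr_mono) auto
    then show ?thesis using K by (intro mult_right_mono) auto
  qed
  finally show ?thesis .
qed

text \<open>
  Every bounded measurable \<open>\<xi>\<close> represents a functional by pairing it with gradients. Up to
  integration by parts, all functionals to which G-convergence is applied are of this form.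
\<close>

lemma integral_wderiv_in_dual:
  assumes p: "1 < p" and \<xi>: "\<xi> \<in> borel_measurable unit_meas" "AE x in unit_meas. \<bar>\<xi> x\<bar> \<le> B"
  shows "(\<lambda>v. \<integral>x. \<xi> x * wderiv v x \<partial>unit_meas) \<in> W_dual p"
proof -
  have int: "integrable unit_meas (\<lambda>x. \<xi> x * wderiv v x)" if "v \<in> W01p p" for v
    by (rule integrable_bounded_mult[OF W01pD(5)[OF p that] \<xi>])
  have lin: "(\<integral>x. \<xi> x * wderiv (\<lambda>x. c * u x + d * v x) x \<partial>unit_meas) =
       c * (\<integral>x. \<xi> x * wderiv u x \<partial>unit_meas) + d * (\<integral>x. \<xi> x * wderiv v x \<partial>unit_meas)"
    if "u \<in> W01p p" "v \<in> W01p p" for u v c d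
  proof -
    note L = wderiv_lincomb[OF W01pD(2)[OF p that(1)] W01pD(2)[OF p that(2)], of c d]
    note [measurable] = L(2) \<xi>(1) borel_measurable_integrable[OF W01pD(5)[OF p that(1)]] borel_measurable_integrable[OF W01pD(5)[OF p that(2)]]
    have "AE x in unit_meas. \<xi> x * wderiv (\<lambda>x. c * u x + d * v x) x = c * (\<xi> x * wderiv u x) + d * (\<xi> x * wderiv v x)"
      using L(1) by eventually_elim (simp add: algebra_simps)
    then have "(\<integral>x. \<xi> x * wderiv (\<lambda>x. c * u x + d * v x) x \<partial>unit_meas) = (\<integral>x. c * (\<xi> x * wderiv u x) + d * (\<xi> x * wderiv v x) \<partial>unit_meas)"
      by (intro integral_cong_AE) measurable
    then show ?thesis using int that by simp
  qed
  have "\<bar>\<integral>x. \<xi> x * wderiv u x \<partial>unit_meas\<bar> \<le> B * W1p_norm p u" if "u \<in> W01p p" for u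
  proof -
    have B: "B \<ge> 0" using abs_integral_unit_le[OF \<xi>] by linarith
    have "\<bar>\<integral>x. \<xi> x * wderiv u x \<partial>unit_meas\<bar> \<le> (\<integral>x. \<bar>\<xi> x * wderiv u x\<bar> \<partial>unit_meas)" by simp
    also have "\<dots> \<le> (\<integral>x. B * \<bar>wderiv u x\<bar> \<partial>unit_meas)"
    proof (rule integral_mono_AE)
      show "AE x in unit_meas. \<bar>\<xi> x * wderiv u x\<bar> \<le> B * \<bar>wderiv u x\<bar>"
        using \<xi>(2) by eventually_elim (auto simp: abs_mult intro!: mult_right_mono)
    qed (use int[OF that] W01pD(5)[OF p that] in auto)
    also have "\<dots> \<le> B * W1p_norm p u" using integral_abs_wderiv_le[OF p that] B by (simp add: mult_left_mono)
    finally show ?thesis .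
  qed
  moreover have "(\<integral>x. \<xi> x * wderiv (\<lambda>x. u x + v x) x \<partial>unit_meas) = (\<integral>x. \<xi> x * wderiv u x \<partial>unit_meas) + (\<integral>x. \<xi> x * wderiv v x \<partial>unit_meas)"
    if "u \<in> W01p p" "v \<in> W01p p" for u v using lin[OF that, of 1 1] by simp
  moreover have "(\<integral>x. \<xi> x * wderiv (\<lambda>x. c * u x) x \<partial>unit_meas) = c * (\<integral>x. \<xi> x * wderiv u x \<partial>unit_meas)"
    if "u \<in> W01p p" for u c using lin[OF that that, of c 0] by simp
  ultimately show ?thesis unfolding dual_space_def by blast
qed

lemma W_dual_cong:
  assumes "f \<in> W_dual p" "\<And>v. v \<in> W01p p \<Longrightarrow> g v = f v"
    and "\<And>u v. u \<in> W01p p \<Longrightarrow> v \<in> W01p p \<Longrightarrow> g (\<lambda>x. u x + v x) = g u + g v"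
    and "\<And>c u. u \<in> W01p p \<Longrightarrow> g (\<lambda>x. c * u x) = c * g u"
  shows "g \<in> W_dual p"
proof -
  obtain B where "\<And>u. u \<in> W01p p \<Longrightarrow> \<bar>f u\<bar> \<le> B * W1p_norm p u" using assms(1) unfolding dual_space_def by blast
  then have "\<forall>u\<in>W01p p. \<bar>g u\<bar> \<le> B * W1p_norm p u" using assms(2) by simp
  then show ?thesis using assms(3,4) unfolding dual_space_def by blast
qed

text \<open>
  Integration by parts reduces this functional to one that acts on gradients.
\<close>

lemma integral_in_dual:
  assumes p: "1 < p" and k: "k \<in> borel_measurable unit_meas" "AE x in unit_meas. \<bar>k x\<bar> \<le> B"
  shows "(\<lambda>v. \<integral>x. k x * v x \<partial>unit_meas) \<in> W_dual p"
proof (rule W_dual_cong)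
  have "(\<lambda>x. - prim k x) \<in> borel_measurable unit_meas" using prim_measurable[OF bounded_integrable_unit[OF k]] by simp
  then show "(\<lambda>v. \<integral>x. - prim k x * wderiv v x \<partial>unit_meas) \<in> W_dual p"
    by (rule integral_wderiv_in_dual[OF p, of _ B]) (use abs_prim_le_bound[OF k] in auto)
  show "(\<integral>x. k x * v x \<partial>unit_meas) = (\<integral>x. - prim k x * wderiv v x \<partial>unit_meas)" if "v \<in> W01p p" for v
    using W01p_integral_by_parts[OF p k that] by simp
  have int: "integrable unit_meas (\<lambda>x. k x * v x)" if "v \<in> W01p p" for v
    by (rule integrable_bounded_mult[OF W01pD(4)[OF p that] k])
  show "(\<integral>x. k x * (u x + v x) \<partial>unit_meas) = (\<integral>x. k x * u x \<partial>unit_meas) + (\<integral>x. k x * v x \<partial>unit_meas)"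
    if "u \<in> W01p p" "v \<in> W01p p" for u v using int that by (simp add: distrib_left)
  show "(\<integral>x. k x * (c * u x) \<partial>unit_meas) = c * (\<integral>x. k x * u x \<partial>unit_meas)" for c u
    by (simp add: mult.left_commute)
qed

text \<open>
  The value at \<open>x\<close> of the continuous representative of \<open>v\<close> is the integral of the gradient up
  to \<open>x\<close>. Weak convergence therefore implies pointwise convergence of continuous
  representatives.
\<close>

lemma evaluation_in_dual:
  assumes p: "1 < p" shows "(\<lambda>v. prim (wderiv v) x) \<in> W_dual p"
  unfolding prim_def
  by (rule integral_wderiv_in_dual[OF p borel_measurable_indicator_atMost_unit, where B = 1]) (auto simp: indicator_def)

lemma Lp_norm_integral_in_dual:
  assumes q: "1 < q" shows "(\<lambda>g. \<integral>x. g x \<partial>unit_meas) \<in> dual_space (Lp_space q) (Lp_norm q)"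
proof -
  have int: "integrable unit_meas g" if "g \<in> Lp_space q" for g using Lp_integrable[OF that] q by simp
  have "\<bar>\<integral>x. g x \<partial>unit_meas\<bar> \<le> 1 * Lp_norm q g" if "g \<in> Lp_space q" for g
  proof -
    have "\<bar>\<integral>x. g x \<partial>unit_meas\<bar> \<le> (\<integral>x. \<bar>g x\<bar> \<partial>unit_meas)" by simp
    also have "\<dots> \<le> Lp_norm q g" unfolding Lp_norm_def by (rule abs_integral_le_Lp[OF q that])
    finally show ?thesis by simp
  qed
  then show ?thesis unfolding dual_space_def using int by (auto intro!: exI[of _ 1])
qed

section \<open>Weak solutions and the limit of the compliances\<close>

text \<open>
  The odd extension of \<open>t powr r\<close>. With exponent \<open>p - 1\<close> it maps gradients to fluxes, with the
  reciprocal exponent fluxes to gradients.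
\<close>

definition signed_powr :: "real \<Rightarrow> real \<Rightarrow> real" where
  "signed_powr r t = sgn t * \<bar>t\<bar> powr r"

lemma abs_powr_mult_eq_signed_powr: "\<bar>t\<bar> powr (p - 2) * t = signed_powr (p - 1) t"
proof (cases "t = 0")
  case False
  have "\<bar>t\<bar> powr (p - 2) * t = sgn t * (\<bar>t\<bar> powr (p - 2) * \<bar>t\<bar> powr 1)"
    using False by (simp add: sgn_mult_abs mult.left_commute)
  also have "\<bar>t\<bar> powr (p - 2) * \<bar>t\<bar> powr 1 = \<bar>t\<bar> powr (p - 1)"
    by (simp only: powr_add[symmetric]) simp
  finally show ?thesis by (simp add: signed_powr_def)
qed (simp add: signed_powr_def)

lemma signed_powr_0 [simp]: "signed_powr r 0 = 0" by (simp add: signed_powr_def)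
lemma signed_powr_1 [simp]: "signed_powr r 1 = 1" by (simp add: signed_powr_def)

lemma abs_signed_powr: "\<bar>signed_powr r t\<bar> = \<bar>t\<bar> powr r"
  by (cases "t = 0") (auto simp: signed_powr_def abs_mult abs_sgn_eq)

lemma signed_powr_nonneg: "0 \<le> t \<Longrightarrow> 0 \<le> signed_powr r t" and signed_powr_nonpos: "t \<le> 0 \<Longrightarrow> signed_powr r t \<le> 0"
  and signed_powr_neg: "t < 0 \<Longrightarrow> signed_powr r t < 0"
  by (auto simp: signed_powr_def sgn_if)

lemma signed_powr_eq: "0 < r \<Longrightarrow> signed_powr r t = (max t 0) powr r - (max (- t) 0) powr r"
  by (auto simp: signed_powr_def sgn_if max_def)

lemma continuous_signed_powr: assumes "0 < r" shows "continuous_on UNIV (signed_powr r)"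
proof -
  have "signed_powr r = (\<lambda>t. (max t 0) powr r - (max (- t) 0) powr r)" using signed_powr_eq[OF assms] by auto
  moreover have "continuous_on UNIV (\<lambda>t::real. (max t 0) powr r - (max (- t) 0) powr r)"
    using assms by (intro continuous_intros continuous_on_powr') auto
  ultimately show ?thesis by simp
qed

lemma tendsto_signed_powr: "0 < r \<Longrightarrow> (f \<longlongrightarrow> l) F \<Longrightarrow> ((\<lambda>x. signed_powr r (f x)) \<longlongrightarrow> signed_powr r l) F"
  using continuous_signed_powr[of r] by (auto simp: continuous_on_eq_continuous_at isCont_tendsto_compose)

lemma signed_powr_measurable: "0 < r \<Longrightarrow> f \<in> borel_measurable M \<Longrightarrow> (\<lambda>x. signed_powr r (f x)) \<in> borel_measurable M"
  using borel_measurable_continuous_onI[OF continuous_signed_powr[of r]] by (auto intro: measurable_compose)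

lemma signed_powr_mult_pos: "0 < c \<Longrightarrow> signed_powr r (c * t) = c powr r * signed_powr r t"
  by (simp add: signed_powr_def sgn_mult abs_mult powr_mult)

lemma signed_powr_signed_powr: "r * s = 1 \<Longrightarrow> signed_powr r (signed_powr s t) = t"
proof (cases "t = 0")
  case False
  assume "r * s = 1"
  then have "\<bar>signed_powr s t\<bar> powr r = \<bar>t\<bar>" using False by (simp add: abs_signed_powr powr_powr mult.commute)
  moreover have "sgn (signed_powr s t) = sgn t" using False by (simp add: signed_powr_def sgn_mult)
  ultimately show ?thesis by (simp add: signed_powr_def sgn_mult_abs)
qed simp

lemma flux_signed_powr: "flux p a u = (\<lambda>x. a x * signed_powr (p-1) (wderiv u x))"
  by (simp add: flux_def abs_powr_mult_eq_signed_powr)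

lemma flux_inverse:
  assumes "1 < p" "0 < a"
  shows "a * signed_powr (p-1) (a powr (-1/(p-1)) * signed_powr (1/(p-1)) t) = t"
proof -
  have "(a powr (-1/(p-1))) powr (p-1) = a powr (-1)" using assms by (simp only: powr_powr) simp
  moreover have "a * a powr (-1) = 1" using assms by (simp add: powr_minus)
  ultimately show ?thesis using assms by (simp add: signed_powr_mult_pos signed_powr_signed_powr mult.assoc[symmetric])
qed

lemma prim_mono:
  assumes "integrable unit_meas g" "AE t in unit_meas. 0 \<le> g t" "x \<le> y"
  shows "prim g x \<le> prim g y"
  unfolding prim_def
proof (rule integral_mono_AE)
  show "AE t in unit_meas. indicat_real {..x} t * g t \<le> indicat_real {..y} t * g t"
    using assms(2) by eventually_elim (use assms(3) in \<open>auto simp: indicator_def\<close>)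
qed (use assms integrable_indicator_mult_unit in auto)

lemma bounded_between_integrable: assumes "bounded_between l h f" shows "integrable unit_meas f"
proof (rule bounded_integrable_unit[OF bounded_between_measurable[OF assms]])
  show "AE t in unit_meas. \<bar>f t\<bar> \<le> \<bar>l\<bar> + \<bar>h\<bar>" using bounded_between_AE[OF assms] by eventually_elim auto
qed

lemma prim_const: "0 \<le> z \<Longrightarrow> z \<le> 1 \<Longrightarrow> prim (\<lambda>t. c) z = c * z"
  using prim_FTC[of "\<lambda>t. c * t" "\<lambda>t. c" z] by (auto intro!: derivative_eq_intros)

text \<open>
  Subtract the primitives of the constants \<open>l\<close> and \<open>h\<close> and use monotonicity.
\<close>

lemma prim_increment_bounds:
  assumes f: "bounded_between l h f" and xy: "0 \<le> x" "x \<le> y" "y \<le> 1"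
  shows "l * (y - x) \<le> prim f y - prim f x" "prim f y - prim f x \<le> h * (y - x)"
proof -
  note i = bounded_between_integrable[OF f]
  have "prim (\<lambda>t. f t - l) x \<le> prim (\<lambda>t. f t - l) y"
    by (rule prim_mono) (use i bounded_between_AE[OF f] xy in auto)
  then show "l * (y - x) \<le> prim f y - prim f x"
    using prim_diff[OF i, of "\<lambda>t. l"] prim_const[of x l] prim_const[of y l] xy by (simp add: algebra_simps)
  have "prim (\<lambda>t. h - f t) x \<le> prim (\<lambda>t. h - f t) y"
    by (rule prim_mono) (use i bounded_between_AE[OF f] xy in auto)
  then show "prim f y - prim f x \<le> h * (y - x)"
    using prim_diff[OF _ i, of "\<lambda>t. h"] prim_const[of x h] prim_const[of y h] xy by (simp add: algebra_simps)
qed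

text \<open>
  The gradient of a function whose flux for the coefficient \<open>a\<close> is \<open>\<xi>\<close>.
\<close>

definition grad_of_flux :: "real \<Rightarrow> (real \<Rightarrow> real) \<Rightarrow> (real \<Rightarrow> real) \<Rightarrow> real \<Rightarrow> real" where
  "grad_of_flux p a \<xi> x = compliance p a x * signed_powr (1/(p-1)) (\<xi> x)"

lemma grad_of_flux_bounds:
  assumes p: "1 < p" and l: "0 < l" and a: "bounded_between l h a"
    and \<xi>: "\<xi> \<in> borel_measurable unit_meas" "AE x in unit_meas. \<bar>\<xi> x\<bar> \<le> B"
  shows "grad_of_flux p a \<xi> \<in> borel_measurable unit_meas"
    "AE x in unit_meas. \<bar>grad_of_flux p a \<xi> x\<bar> \<le> l powr (-1/(p-1)) * B powr (1/(p-1))"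
proof -
  note C = bounded_between_compliance[OF p l a]
  show "grad_of_flux p a \<xi> \<in> borel_measurable unit_meas"
    unfolding grad_of_flux_def[abs_def] using bounded_between_measurable[OF C] signed_powr_measurable[OF _ \<xi>(1), of "1/(p-1)"] p by auto
  have "AE x in unit_meas. \<bar>compliance p a x\<bar> \<le> l powr (-1/(p-1))" by (rule bounded_between_abs[OF C]) simp
  with \<xi>(2) show "AE x in unit_meas. \<bar>grad_of_flux p a \<xi> x\<bar> \<le> l powr (-1/(p-1)) * B powr (1/(p-1))"
    by eventually_elim (use p in \<open>auto simp: grad_of_flux_def abs_mult abs_signed_powr intro!: mult_mono powr_mono2\<close>)
qed

text \<open>
  A flux determines the gradient; the primitive of the gradient vanishes at both endpoints exactly
  if the gradient has integral zero.
\<close>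

lemma weak_solution_of_flux:
  assumes p: "1 < p" and l: "0 < l" and a: "bounded_between l h a"
    and \<xi>: "\<xi> \<in> borel_measurable unit_meas" "AE x in unit_meas. \<bar>\<xi> x\<bar> \<le> B"
    and z: "(\<integral>x. grad_of_flux p a \<xi> x \<partial>unit_meas) = 0"
  defines "u \<equiv> prim (grad_of_flux p a \<xi>)"
  shows "weak_solution p a (\<lambda>v. \<integral>x. \<xi> x * wderiv v x \<partial>unit_meas) u"
    "AE x in unit_meas. flux p a u x = \<xi> x" "flux p a u \<in> borel_measurable unit_meas"
    "prim (wderiv u) x = prim (grad_of_flux p a \<xi>) x"
proof -
  note G = grad_of_flux_bounds[OF p l a \<xi>]
  note W = prim_in_W01p[OF p G z, folded u_def]
  note am = bounded_between_measurable[OF a]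
  have wm: "wderiv u \<in> borel_measurable unit_meas" using W01pD(5)[OF p W(1)] by simp
  show "prim (wderiv u) x = prim (grad_of_flux p a \<xi>) x" by (rule prim_cong[OF W(2) wm G(1)])
  show fm: "flux p a u \<in> borel_measurable unit_meas"
    unfolding flux_signed_powr using am signed_powr_measurable[OF _ wm, of "p-1"] p by simp
  show f: "AE x in unit_meas. flux p a u x = \<xi> x"
    using W(2) bounded_between_AE[OF a]
  proof eventually_elim
    case (elim x)
    then show ?case using flux_inverse[OF p, of "a x" "\<xi> x"] l
      by (simp add: flux_signed_powr grad_of_flux_def compliance_def)
  qed
  have "(\<integral>x. flux p a u x * wderiv v x \<partial>unit_meas) = (\<integral>x. \<xi> x * wderiv v x \<partial>unit_meas)" if "v \<in> W01p p" for v
  proof -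
    note [measurable] = fm \<xi>(1) borel_measurable_integrable[OF W01pD(5)[OF p that]]
    have "AE x in unit_meas. flux p a u x * wderiv v x = \<xi> x * wderiv v x" using f by eventually_elim simp
    then show ?thesis by (intro integral_cong_AE) measurable
  qed
  then show "weak_solution p a (\<lambda>v. \<integral>x. \<xi> x * wderiv v x \<partial>unit_meas) u"
    using W(1) by (simp add: weak_solution_def)
qed

text \<open>
  The integral of the gradient depends continuously on the constant added to the flux. It is
  nonnegative where the total flux is nonnegative and nonpositive where the total flux is
  nonpositive, so the intermediate value theorem applies.
\<close>

lemma exists_flux_constant:
  assumes p: "1 < p" and l: "0 < l" and a: "bounded_between l h a"
    and \<xi>: "\<xi> \<in> borel_measurable unit_meas" "AE x in unit_meas. \<bar>\<xi> x\<bar> \<le> B"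
  shows "\<exists>c. \<bar>c\<bar> \<le> B \<and> (\<integral>x. grad_of_flux p a (\<lambda>x. \<xi> x + c) x \<partial>unit_meas) = 0"
proof -
  define I where "I c = (\<integral>x. grad_of_flux p a (\<lambda>x. \<xi> x + c) x \<partial>unit_meas)" for c
  have B: "B \<ge> 0" using abs_integral_unit_le[OF \<xi>] by linarith
  have b: "AE x in unit_meas. \<bar>\<xi> x + c\<bar> \<le> B + D" if "\<bar>c\<bar> \<le> D" for c D
    using \<xi>(2) by eventually_elim (use that in linarith)
  have m: "(\<lambda>x. \<xi> x + c) \<in> borel_measurable unit_meas" for c using \<xi>(1) by simp
  note G = grad_of_flux_bounds[OF p l a m b]
  have cp: "AE x in unit_meas. 0 < a x" using bounded_between_AE[OF a] by eventually_elim (use l in auto)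
  have "continuous_on {-B..B} I"
    unfolding continuous_on_sequentially comp_def
  proof (intro allI ballI impI, elim conjE)
    fix y c assume c: "c \<in> {-B..B}" and y: "\<forall>n. y n \<in> {-B..B}" "y \<longlonglongrightarrow> c"
    show "(\<lambda>n. I (y n)) \<longlonglongrightarrow> I c" unfolding I_def
    proof (rule integral_dominated_convergence[where w = "\<lambda>x. l powr (-1/(p-1)) * (B + B) powr (1/(p-1))"])
      show "AE x in unit_meas. (\<lambda>n. grad_of_flux p a (\<lambda>x. \<xi> x + y n) x) \<longlonglongrightarrow> grad_of_flux p a (\<lambda>x. \<xi> x + c) x"
        unfolding grad_of_flux_def using p y(2) by (intro AE_I2 tendsto_intros tendsto_signed_powr) auto
      show "AE x in unit_meas. norm (grad_of_flux p a (\<lambda>x. \<xi> x + y n) x) \<le> l powr (-1/(p-1)) * (B + B) powr (1/(p-1))" for n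
        using G(2)[of "y n" B] y(1) by (simp add: abs_le_iff) (metis abs_le_iff minus_le_iff)
    qed (use G(1)[OF order_refl] in auto)
  qed
  moreover have "I (-B) \<le> 0"
  proof -
    have "I (-B) \<le> (\<integral>x. 0 \<partial>unit_meas)" unfolding I_def
    proof (rule integral_mono_AE)
      show "integrable unit_meas (grad_of_flux p a (\<lambda>x. \<xi> x + - B))"
        by (rule bounded_integrable_unit[OF G[OF order_refl]])
      show "AE x in unit_meas. grad_of_flux p a (\<lambda>x. \<xi> x + - B) x \<le> 0"
        using \<xi>(2) by eventually_elim (auto simp: grad_of_flux_def compliance_def intro!: mult_nonneg_nonpos signed_powr_nonpos)
    qed simp
    then show ?thesis by simp
  qed
  moreover have "I B \<ge> 0"
    unfolding I_def
  proof (rule Bochner_Integration.integral_nonneg_AE)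
    show "AE x in unit_meas. 0 \<le> grad_of_flux p a (\<lambda>x. \<xi> x + B) x"
      using \<xi>(2) by eventually_elim (auto simp: grad_of_flux_def compliance_def intro!: mult_nonneg_nonneg signed_powr_nonneg)
  qed
  ultimately obtain c where "-B \<le> c" "c \<le> B" "I c = 0" using IVT'[of I "-B" 0 B] B by auto
  then show ?thesis unfolding I_def by (intro exI[of _ c]) auto
qed

text \<open>
  A constant flux annihilates the gradients of the space, so adding a constant to \<open>\<xi>\<close> does not
  change the functional.
\<close>

lemma exists_weak_solution:
  assumes p: "1 < p" and l: "0 < l" and a: "bounded_between l h a"
    and \<xi>: "\<xi> \<in> borel_measurable unit_meas" "AE x in unit_meas. \<bar>\<xi> x\<bar> \<le> B"
  shows "\<exists>c u. \<bar>c\<bar> \<le> B \<and> weak_solution p a (\<lambda>v. \<integral>x. \<xi> x * wderiv v x \<partial>unit_meas) u \<and>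
     (AE x in unit_meas. flux p a u x = \<xi> x + c) \<and> flux p a u \<in> borel_measurable unit_meas \<and>
     (\<integral>x. grad_of_flux p a (\<lambda>x. \<xi> x + c) x \<partial>unit_meas) = 0 \<and>
     (\<forall>x. prim (wderiv u) x = prim (grad_of_flux p a (\<lambda>x. \<xi> x + c)) x)"
proof -
  obtain c where c: "\<bar>c\<bar> \<le> B" "(\<integral>x. grad_of_flux p a (\<lambda>x. \<xi> x + c) x \<partial>unit_meas) = 0"
    using exists_flux_constant[OF p l a \<xi>] by blast
  have m: "(\<lambda>x. \<xi> x + c) \<in> borel_measurable unit_meas" using \<xi>(1) by simp
  have b: "AE x in unit_meas. \<bar>\<xi> x + c\<bar> \<le> B + B"
    using \<xi>(2) by eventually_elim (use c in linarith)
  note S = weak_solution_of_flux[OF p l a m b c(2)]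
  let ?u = "prim (grad_of_flux p a (\<lambda>x. \<xi> x + c))"
  have "(\<integral>x. (\<xi> x + c) * wderiv v x \<partial>unit_meas) = (\<integral>x. \<xi> x * wderiv v x \<partial>unit_meas)" if "v \<in> W01p p" for v
  proof -
    note V = W01pD[OF p that]
    have "(\<integral>x. (\<xi> x + c) * wderiv v x \<partial>unit_meas) = (\<integral>x. \<xi> x * wderiv v x + c * wderiv v x \<partial>unit_meas)"
      by (simp add: distrib_right)
    also have "\<dots> = (\<integral>x. \<xi> x * wderiv v x \<partial>unit_meas)"
      using V integrable_bounded_mult[OF V(5) \<xi>] by simp
    finally show ?thesis .
  qed
  then have "weak_solution p a (\<lambda>v. \<integral>x. \<xi> x * wderiv v x \<partial>unit_meas) ?u"
    using S(1) by (simp add: weak_solution_def)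
  then show ?thesis using S c by blast
qed

text \<open>
  The dual norm is a supremum of reals, so boundedness is needed even for its nonnegativity.
\<close>

lemma dual_norm_bounds:
  assumes p: "1 < p" and "\<And>u. u \<in> W01p p \<Longrightarrow> W1p_norm p u \<le> 1 \<Longrightarrow> \<bar>F u\<bar> \<le> K"
  shows "0 \<le> dual_norm (W01p p) (W1p_norm p) F" "dual_norm (W01p p) (W1p_norm p) F \<le> K"
proof -
  have "W1p_norm p (\<lambda>x. 0) = 0" 
  proof -
    have "W1p_norm p (prim (\<lambda>x. 0)) \<le> 2 * 0" by (rule W1p_norm_prim_le[OF p]) auto
    moreover have "prim (\<lambda>x. 0) = (\<lambda>x. 0)" by (auto simp: prim_def)
    ultimately show ?thesis using W1p_norm_nonneg[of p "\<lambda>x. 0"] by simp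
  qed
  then have z: "(\<lambda>x. 0) \<in> {u \<in> W01p p. W1p_norm p u \<le> 1}" using W01p_zero[OF p] by simp
  show "dual_norm (W01p p) (W1p_norm p) F \<le> K" unfolding dual_norm_def
    by (rule cSUP_least) (use z assms(2) in auto)
  have "\<bar>F (\<lambda>x. 0)\<bar> \<le> dual_norm (W01p p) (W1p_norm p) F" unfolding dual_norm_def
    by (rule cSUP_upper[OF z]) (use assms(2) in \<open>auto intro!: bdd_aboveI2\<close>)
  then show "0 \<le> dual_norm (W01p p) (W1p_norm p) F" by linarith
qed

lemma weak_convD: "weak_conv X N w w0 F \<Longrightarrow> f \<in> dual_space X N \<Longrightarrow> ((\<lambda>i. f (w i)) \<longlongrightarrow> f w0) F"
  by (simp add: weak_conv_def)

lemma conj_exp_gt_1: "1 < p \<Longrightarrow> 1 < conj_exp p"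
  by (simp add: conj_exp_def)

text \<open>
  Take as right-hand side the functional given by a flux \<open>\<xi>\<close> that equals 1 on \<open>(0,x)\<close> and a
  negative constant on \<open>(x,1)\<close>, chosen so that \<open>\<xi>\<close> is the flux of a solution for the limit
  coefficient. The solution for \<open>a_eps \<epsilon>\<close> has flux \<open>\<xi> + c \<epsilon>\<close>. Convergence of the integrals of
  the fluxes gives \<open>c \<epsilon> \<rightarrow> 0\<close>, and evaluation of the solutions at \<open>x\<close> then gives convergence of
  the integral of the compliance up to \<open>x\<close>. The boundary condition at 1 yields the integral over
  the remaining interval.
\<close>

lemma G_converges_imp_prim_compliance:
  assumes p: "1 < p" and l: "0 < l"
    and ae: "\<And>\<epsilon>. 0 < \<epsilon> \<Longrightarrow> bounded_between l h (a_eps \<epsilon>)" and a: "bounded_between l h a"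
    and G: "G_converges p a_eps a" and x: "0 < x" "x < 1"
  shows "((\<lambda>\<epsilon>. prim (compliance p (a_eps \<epsilon>)) x) \<longlongrightarrow> prim (compliance p a) x) (at_right 0)"
    "((\<lambda>\<epsilon>. prim (compliance p (a_eps \<epsilon>)) 1) \<longlongrightarrow> prim (compliance p a) 1) (at_right 0)"
proof -
  define bl where "bl = h powr (-1/(p-1))"
  define bh where "bh = l powr (-1/(p-1))"
  have C: "bounded_between bl bh (compliance p a')" if "bounded_between l h a'" for a'
    unfolding bl_def bh_def by (rule bounded_between_compliance[OF p l that])
  have hpos: "0 < h" using bounded_between_le[OF a] l by linarith
  then have bl: "0 < bl" by (simp add: bl_def)
  have bi: "integrable unit_meas (compliance p a')" if "bounded_between l h a'" for a'
    by (rule bounded_integrable_unit[OF bounded_between_measurable[OF C[OF that]] bounded_between_abs[OF C[OF that]]]) (use bl in simp)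
  define q where "q = 1/(p-1)"
  have q: "q > 0" using p by (simp add: q_def)
  note lowx = prim_increment_bounds(1)[OF C[OF a]]
  let ?B = "prim (compliance p a) x" and ?T = "prim (compliance p a) 1"
  have Bpos: "?B > 0"
  proof -
    have "0 < bl * x" using x bl by simp
    also have "bl * x \<le> ?B" using lowx[of 0 x] x prim_0[of 0 "compliance p a"] by simp
    finally show ?thesis .
  qed
  have Rpos: "?T - ?B > 0"
  proof -
    have "0 < bl * (1 - x)" using x bl by simp
    also have "\<dots> \<le> ?T - ?B" using lowx[of x 1] x by simp
    finally show ?thesis .
  qed
  \<comment> \<open>The ratio of gradient to compliance on \<open>(x,1)\<close> that balances the ratio 1 on \<open>(0,x)\<close>.\<close>
  define \<kappa> where "\<kappa> = - (?B / (?T - ?B))"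
  have \<kappa>: "\<kappa> < 0" using Bpos Rpos by (simp add: \<kappa>_def)
  define \<mu> where "\<mu> = signed_powr (p-1) \<kappa>"
  have \<mu>: "\<mu> < 0" unfolding \<mu>_def by (rule signed_powr_neg[OF \<kappa>])
  have \<mu>\<kappa>: "signed_powr q \<mu> = \<kappa>" unfolding \<mu>_def by (rule signed_powr_signed_powr) (use p in \<open>simp add: q_def\<close>)
  define \<xi> where "\<xi> t = (1 - \<mu>) * indicat_real {..x} t + \<mu>" for t
  have \<xi>m: "\<xi> \<in> borel_measurable unit_meas" unfolding \<xi>_def[abs_def] by measurable
  have \<xi>b: "AE t in unit_meas. \<bar>\<xi> t\<bar> \<le> 1 + \<bar>\<mu>\<bar>" by (auto simp: \<xi>_def indicator_def)
  have gsplit: "grad_of_flux p a' (\<lambda>t. \<xi> t + c) t =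
      signed_powr q (1 + c) * (indicat_real {..x} t * compliance p a' t) + signed_powr q (\<mu> + c) * (compliance p a' t - indicat_real {..x} t * compliance p a' t)" for a' c t
    by (auto simp: grad_of_flux_def \<xi>_def indicator_def q_def)
  have gint: "(\<integral>t. grad_of_flux p a' (\<lambda>t. \<xi> t + c) t \<partial>unit_meas) =
      signed_powr q (1 + c) * prim (compliance p a') x + signed_powr q (\<mu> + c) * (prim (compliance p a') 1 - prim (compliance p a') x)" if a': "bounded_between l h a'" for a' c
    unfolding gsplit using bi[OF a'] integrable_indicator_mult_unit[OF bi[OF a']]
    by (simp add: prim_1) (simp add: prim_def)
  have gprim: "prim (grad_of_flux p a' (\<lambda>t. \<xi> t + c)) x = signed_powr q (1 + c) * prim (compliance p a') x" for a' c
  proof -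
    have "prim (grad_of_flux p a' (\<lambda>t. \<xi> t + c)) x = (\<integral>t. signed_powr q (1 + c) * (indicat_real {..x} t * compliance p a' t) \<partial>unit_meas)"
      unfolding prim_def by (rule Bochner_Integration.integral_cong) (auto simp: gsplit indicator_def)
    then show ?thesis by (simp add: prim_def)
  qed
  define f where "f v = (\<integral>t. \<xi> t * wderiv v t \<partial>unit_meas)" for v
  have fd: "f \<in> W_dual p" unfolding f_def[abs_def] by (rule integral_wderiv_in_dual[OF p \<xi>m \<xi>b])
  define R where "R \<epsilon> c u \<longleftrightarrow> weak_solution p (a_eps \<epsilon>) f u \<and>
     (AE t in unit_meas. flux p (a_eps \<epsilon>) u t = \<xi> t + c) \<and> flux p (a_eps \<epsilon>) u \<in> borel_measurable unit_meas \<and>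
     (\<integral>t. grad_of_flux p (a_eps \<epsilon>) (\<lambda>t. \<xi> t + c) t \<partial>unit_meas) = 0 \<and>
     (\<forall>x. prim (wderiv u) x = prim (grad_of_flux p (a_eps \<epsilon>) (\<lambda>t. \<xi> t + c)) x)" for \<epsilon> c u
  have "\<exists>c u. R \<epsilon> c u" if "\<epsilon> > 0" for \<epsilon>
    using exists_weak_solution[OF p l ae[OF that] \<xi>m \<xi>b] unfolding R_def f_def[abs_def] by blast
  then have "\<exists>c us. \<forall>\<epsilon>>0. R \<epsilon> (c \<epsilon>) (us \<epsilon>)" by metis
  then obtain c us where "\<And>\<epsilon>. \<epsilon> > 0 \<Longrightarrow> R \<epsilon> (c \<epsilon>) (us \<epsilon>)" by blast
  then have us: "\<And>\<epsilon>. \<epsilon> > 0 \<Longrightarrow> weak_solution p (a_eps \<epsilon>) f (us \<epsilon>)"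
    and usf: "\<And>\<epsilon>. \<epsilon> > 0 \<Longrightarrow> AE t in unit_meas. flux p (a_eps \<epsilon>) (us \<epsilon>) t = \<xi> t + c \<epsilon>"
    and usm: "\<And>\<epsilon>. \<epsilon> > 0 \<Longrightarrow> flux p (a_eps \<epsilon>) (us \<epsilon>) \<in> borel_measurable unit_meas"
    and usz: "\<And>\<epsilon>. \<epsilon> > 0 \<Longrightarrow> (\<integral>t. grad_of_flux p (a_eps \<epsilon>) (\<lambda>t. \<xi> t + c \<epsilon>) t \<partial>unit_meas) = 0"
    and usp: "\<And>\<epsilon> x. \<epsilon> > 0 \<Longrightarrow> prim (wderiv (us \<epsilon>)) x = prim (grad_of_flux p (a_eps \<epsilon>) (\<lambda>t. \<xi> t + c \<epsilon>)) x"
    unfolding R_def by blast+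
  define u where "u = prim (grad_of_flux p a \<xi>)"
  have z0: "(\<integral>t. grad_of_flux p a \<xi> t \<partial>unit_meas) = 0"
    using gint[OF a, of 0] \<mu>\<kappa> Rpos by (simp add: \<kappa>_def)
  note U = weak_solution_of_flux[OF p l a \<xi>m \<xi>b z0, folded u_def f_def[abs_def]]
  have strong: "strong_conv_W_dual p (\<lambda>\<epsilon>. f) f (at_right 0)"
    unfolding strong_conv_W_dual_def using dual_norm_bounds[OF p, of "\<lambda>u. f u - f u" 0]
    by (simp add: antisym)
  have conv: "weak_conv_W01p p us u (at_right 0)"
     "weak_conv_Lp (conj_exp p) (\<lambda>\<epsilon>. flux p (a_eps \<epsilon>) (us \<epsilon>)) (flux p a u) (at_right 0)"
    using G[unfolded G_converges_def, rule_format, of f "\<lambda>\<epsilon>. f" us u] fd strong us U(1) by blast+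
  have ev: "eventually (\<lambda>\<epsilon>::real. 0 < \<epsilon>) (at_right 0)" by (rule eventually_at_right_less)
  have \<xi>i: "integrable unit_meas \<xi>" by (rule bounded_integrable_unit[OF \<xi>m \<xi>b])
  have F1: "((\<lambda>\<epsilon>. \<integral>t. flux p (a_eps \<epsilon>) (us \<epsilon>) t \<partial>unit_meas) \<longlongrightarrow> (\<integral>t. flux p a u t \<partial>unit_meas)) (at_right 0)"
    using conv(2) Lp_norm_integral_in_dual[OF conj_exp_gt_1[OF p]] unfolding weak_conv_def by blast
  have F2: "(\<integral>t. flux p a u t \<partial>unit_meas) = (\<integral>t. \<xi> t \<partial>unit_meas)"
    by (rule integral_cong_AE[OF U(3) \<xi>m U(2)])
  have F3: "eventually (\<lambda>\<epsilon>. (\<integral>t. flux p (a_eps \<epsilon>) (us \<epsilon>) t \<partial>unit_meas) = (\<integral>t. \<xi> t \<partial>unit_meas) + c \<epsilon>) (at_right 0)"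
    using ev
  proof eventually_elim
    case (elim \<epsilon>)
    have "(\<integral>t. flux p (a_eps \<epsilon>) (us \<epsilon>) t \<partial>unit_meas) = (\<integral>t. \<xi> t + c \<epsilon> \<partial>unit_meas)"
      using \<xi>m by (intro integral_cong_AE usm usf elim) simp
    then show ?case using \<xi>i by simp
  qed
  have "((\<lambda>\<epsilon>. (\<integral>t. \<xi> t \<partial>unit_meas) + c \<epsilon>) \<longlongrightarrow> (\<integral>t. \<xi> t \<partial>unit_meas)) (at_right 0)"
    by (rule Lim_transform_eventually[OF F1[unfolded F2] F3])
  from tendsto_diff[OF this tendsto_const[of "\<integral>t. \<xi> t \<partial>unit_meas"]]
  have c0: "(c \<longlongrightarrow> 0) (at_right 0)" by simp
  have s1: "((\<lambda>\<epsilon>. signed_powr q (1 + c \<epsilon>)) \<longlongrightarrow> 1) (at_right 0)"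
    using tendsto_signed_powr[OF q tendsto_add[OF tendsto_const[of 1] c0]] by simp
  have s2: "((\<lambda>\<epsilon>. signed_powr q (\<mu> + c \<epsilon>)) \<longlongrightarrow> \<kappa>) (at_right 0)"
    using tendsto_signed_powr[OF q tendsto_add[OF tendsto_const[of \<mu>] c0]] \<mu>\<kappa> by simp
  have E1: "((\<lambda>\<epsilon>. prim (wderiv (us \<epsilon>)) x) \<longlongrightarrow> prim (wderiv u) x) (at_right 0)"
    by (rule weak_convD[OF conv(1) evaluation_in_dual[OF p]])
  have E2: "prim (wderiv u) x = ?B" using U(4)[of x] gprim[of a 0] by (simp add: u_def)
  have E3: "eventually (\<lambda>\<epsilon>. prim (wderiv (us \<epsilon>)) x = signed_powr q (1 + c \<epsilon>) * prim (compliance p (a_eps \<epsilon>)) x) (at_right 0)"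
    using ev by eventually_elim (simp add: usp gprim)
  have sB: "((\<lambda>\<epsilon>. signed_powr q (1 + c \<epsilon>) * prim (compliance p (a_eps \<epsilon>)) x) \<longlongrightarrow> ?B) (at_right 0)"
    by (rule Lim_transform_eventually[OF E1[unfolded E2] E3])
  have ev1: "eventually (\<lambda>\<epsilon>. signed_powr q (1 + c \<epsilon>) > 0) (at_right 0)" using order_tendstoD(1)[OF s1, of 0] by simp
  have ev2: "eventually (\<lambda>\<epsilon>. signed_powr q (\<mu> + c \<epsilon>) < 0) (at_right 0)" using order_tendstoD(2)[OF s2 \<kappa>] .
  show X: "((\<lambda>\<epsilon>. prim (compliance p (a_eps \<epsilon>)) x) \<longlongrightarrow> ?B) (at_right 0)"
  proof (rule Lim_transform_eventually)
    show "((\<lambda>\<epsilon>. (signed_powr q (1 + c \<epsilon>) * prim (compliance p (a_eps \<epsilon>)) x) / signed_powr q (1 + c \<epsilon>)) \<longlongrightarrow> ?B) (at_right 0)"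
      using tendsto_divide[OF sB s1] by simp
    show "eventually (\<lambda>\<epsilon>. (signed_powr q (1 + c \<epsilon>) * prim (compliance p (a_eps \<epsilon>)) x) / signed_powr q (1 + c \<epsilon>) = prim (compliance p (a_eps \<epsilon>)) x) (at_right 0)"
      using ev1 by eventually_elim simp
  qed
  show "((\<lambda>\<epsilon>. prim (compliance p (a_eps \<epsilon>)) 1) \<longlongrightarrow> prim (compliance p a) 1) (at_right 0)"
  proof (rule Lim_transform_eventually)
    have "((\<lambda>\<epsilon>. prim (compliance p (a_eps \<epsilon>)) x - (signed_powr q (1 + c \<epsilon>) * prim (compliance p (a_eps \<epsilon>)) x) / signed_powr q (\<mu> + c \<epsilon>)) \<longlongrightarrow> ?B - ?B / \<kappa>) (at_right 0)"
      using \<kappa> by (intro tendsto_intros X sB s2) auto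
    moreover have "?B - ?B / \<kappa> = ?T" using Bpos Rpos by (simp add: \<kappa>_def)
    ultimately show "((\<lambda>\<epsilon>. prim (compliance p (a_eps \<epsilon>)) x - (signed_powr q (1 + c \<epsilon>) * prim (compliance p (a_eps \<epsilon>)) x) / signed_powr q (\<mu> + c \<epsilon>)) \<longlongrightarrow> ?T) (at_right 0)"
      by simp
    show "eventually (\<lambda>\<epsilon>. prim (compliance p (a_eps \<epsilon>)) x - (signed_powr q (1 + c \<epsilon>) * prim (compliance p (a_eps \<epsilon>)) x) / signed_powr q (\<mu> + c \<epsilon>) = prim (compliance p (a_eps \<epsilon>)) 1) (at_right 0)"
      using ev2 ev
    proof eventually_elim
      case (elim \<epsilon>)
      then have "signed_powr q (1 + c \<epsilon>) * prim (compliance p (a_eps \<epsilon>)) x + signed_powr q (\<mu> + c \<epsilon>) * (prim (compliance p (a_eps \<epsilon>)) 1 - prim (compliance p (a_eps \<epsilon>)) x) = 0"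
        using usz[of \<epsilon>] gint[OF ae[of \<epsilon>], of "c \<epsilon>"] by simp
      then show ?case using elim by (simp add: field_simps)
    qed
  qed
qed

section \<open>Energy, mass and genus\<close>

definition energy :: "real \<Rightarrow> (real \<Rightarrow> real) \<Rightarrow> (real \<Rightarrow> real) \<Rightarrow> real" where
  "energy p b v = (\<integral>x. b x * \<bar>wderiv v x\<bar> powr p \<partial>unit_meas)"

definition mass :: "real \<Rightarrow> (real \<Rightarrow> real) \<Rightarrow> (real \<Rightarrow> real) \<Rightarrow> real" where
  "mass p \<sigma> v = (\<integral>x. \<sigma> x * \<bar>v x\<bar> powr p \<partial>unit_meas)"

lemma rayleigh_eq: "rayleigh p b \<sigma> v = energy p b v / mass p \<sigma> v"
  by (simp add: rayleigh_def energy_def mass_def)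

text \<open>
  A substitute for Minkowski's inequality that can be integrated directly: near \<open>x\<close> use
  continuity of the power, far from \<open>x\<close> both powers are dominated by the power of the
  difference.
\<close>

lemma powr_diff_bound:
  assumes p: "1 < (p::real)" and e: "0 < e"
  obtains C where "0 \<le> C" "\<And>x y. \<bar>\<bar>y\<bar> powr p - \<bar>x\<bar> powr p\<bar> \<le> e * \<bar>x\<bar> powr p + C * \<bar>y - x\<bar> powr p"
proof -
  have "isCont (\<lambda>h::real. \<bar>1 + h\<bar> powr p) 0" by (intro continuous_intros) auto
  then obtain d where d: "d > 0" and dd: "\<And>h. \<bar>h\<bar> < d \<Longrightarrow> \<bar>\<bar>1 + h\<bar> powr p - 1\<bar> < e"
    using e by (auto simp: continuous_at_eps_delta dist_real_def)
  define C where "C = (1/d + 1) powr p"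
  show ?thesis
  proof (rule that[of C])
    show "0 \<le> C" by (simp add: C_def)
    fix x y :: real
    show "\<bar>\<bar>y\<bar> powr p - \<bar>x\<bar> powr p\<bar> \<le> e * \<bar>x\<bar> powr p + C * \<bar>y - x\<bar> powr p"
    proof (cases "\<bar>y - x\<bar> < d * \<bar>x\<bar>")
      case True
      then have x: "x \<noteq> 0" by auto
      define h where "h = (y - x) / x"
      have "\<bar>h\<bar> < d" using True x by (simp add: h_def abs_divide field_simps)
      then have "\<bar>\<bar>1 + h\<bar> powr p - 1\<bar> \<le> e" using dd by fastforce
      then have "\<bar>x\<bar> powr p * \<bar>\<bar>1 + h\<bar> powr p - 1\<bar> \<le> \<bar>x\<bar> powr p * e" by (intro mult_left_mono) auto
      moreover have "y = x * (1 + h)" using x by (simp add: h_def field_simps)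
      then have "\<bar>y\<bar> powr p = \<bar>x\<bar> powr p * \<bar>1 + h\<bar> powr p" by (simp add: abs_mult powr_mult)
      then have "\<bar>\<bar>y\<bar> powr p - \<bar>x\<bar> powr p\<bar> = \<bar>x\<bar> powr p * \<bar>\<bar>1 + h\<bar> powr p - 1\<bar>"
        by (metis abs_mult abs_of_nonneg mult.right_neutral powr_ge_zero right_diff_distrib)
      moreover have "0 \<le> C * \<bar>y - x\<bar> powr p" by (simp add: C_def)
      ultimately show ?thesis by (simp add: mult.commute)
    next
      case False
      have xb: "\<bar>x\<bar> \<le> (1/d) * \<bar>y - x\<bar>" using False d by (simp add: field_simps)
      then have b1: "\<bar>x\<bar> \<le> (1/d + 1) * \<bar>y - x\<bar>" and b2: "\<bar>y\<bar> \<le> (1/d + 1) * \<bar>y - x\<bar>"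
        by (auto simp: distrib_right)
      have "\<bar>x\<bar> powr p \<le> C * \<bar>y - x\<bar> powr p"
        using powr_mono2[OF _ _ b1, of p] p d by (simp add: powr_mult C_def)
      moreover have "\<bar>y\<bar> powr p \<le> C * \<bar>y - x\<bar> powr p"
        using powr_mono2[OF _ _ b2, of p] p d by (simp add: powr_mult C_def)
      moreover have "0 \<le> \<bar>x\<bar> powr p" "0 \<le> \<bar>y\<bar> powr p" "0 \<le> e * \<bar>x\<bar> powr p" using e by auto
      ultimately show ?thesis by linarith
    qed
  qed
qed

lemma integrable_weighted_powr:
  assumes "bounded_between l h c" "0 \<le> l" "f \<in> Lp_space p"
  shows "integrable unit_meas (\<lambda>x. c x * \<bar>f x\<bar> powr p)"
  by (rule integrable_bounded_mult[OF Lp_integrable_powr[OF assms(3)] bounded_between_measurable[OF assms(1)] bounded_between_abs[OF assms(1,2)]])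

lemma weighted_integral_bounds:
  assumes c: "bounded_between l h c" "0 \<le> l" and f: "f \<in> Lp_space p"
  shows "l * (\<integral>x. \<bar>f x\<bar> powr p \<partial>unit_meas) \<le> (\<integral>x. c x * \<bar>f x\<bar> powr p \<partial>unit_meas)"
    "(\<integral>x. c x * \<bar>f x\<bar> powr p \<partial>unit_meas) \<le> h * (\<integral>x. \<bar>f x\<bar> powr p \<partial>unit_meas)"
proof -
  note i = integrable_weighted_powr[OF c f] Lp_integrable_powr[OF f]
  have "(\<integral>x. l * \<bar>f x\<bar> powr p \<partial>unit_meas) \<le> (\<integral>x. c x * \<bar>f x\<bar> powr p \<partial>unit_meas)"
  proof (rule integral_mono_AE)
    show "AE x in unit_meas. l * \<bar>f x\<bar> powr p \<le> c x * \<bar>f x\<bar> powr p"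
      using bounded_between_AE[OF c(1)] by eventually_elim (auto intro!: mult_right_mono)
  qed (use i in auto)
  then show "l * (\<integral>x. \<bar>f x\<bar> powr p \<partial>unit_meas) \<le> (\<integral>x. c x * \<bar>f x\<bar> powr p \<partial>unit_meas)" by simp
  have "(\<integral>x. c x * \<bar>f x\<bar> powr p \<partial>unit_meas) \<le> (\<integral>x. h * \<bar>f x\<bar> powr p \<partial>unit_meas)"
  proof (rule integral_mono_AE)
    show "AE x in unit_meas. c x * \<bar>f x\<bar> powr p \<le> h * \<bar>f x\<bar> powr p"
      using bounded_between_AE[OF c(1)] by eventually_elim (auto intro!: mult_right_mono)
  qed (use i in auto)
  then show "(\<integral>x. c x * \<bar>f x\<bar> powr p \<partial>unit_meas) \<le> h * (\<integral>x. \<bar>f x\<bar> powr p \<partial>unit_meas)" by simp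
qed

lemma weighted_powr_integral_continuous:
  assumes p: "1 < p" and c: "bounded_between l h c" "0 \<le> l" and f: "f \<in> Lp_space p" and e: "0 < e"
  obtains r where "0 < r" "\<And>g. g \<in> Lp_space p \<Longrightarrow> (\<integral>x. \<bar>g x - f x\<bar> powr p \<partial>unit_meas) < r \<Longrightarrow>
    \<bar>(\<integral>x. c x * \<bar>g x\<bar> powr p \<partial>unit_meas) - (\<integral>x. c x * \<bar>f x\<bar> powr p \<partial>unit_meas)\<bar> \<le> e"
proof -
  have h: "0 \<le> h" using bounded_between_le[OF c(1)] c(2) by linarith
  define A where "A = (\<integral>x. \<bar>f x\<bar> powr p \<partial>unit_meas)"
  have A: "0 \<le> A" by (simp add: A_def)
  define e1 where "e1 = e / (2 * (h * A + 1))"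
  have hA: "0 \<le> h * A" using h A by simp
  have e1: "0 < e1" using e hA by (simp add: e1_def add_nonneg_pos)
  obtain C where C: "0 \<le> C" "\<And>x y. \<bar>\<bar>y\<bar> powr p - \<bar>x\<bar> powr p\<bar> \<le> e1 * \<bar>x\<bar> powr p + C * \<bar>y - x\<bar> powr p"
    using powr_diff_bound[OF p e1] by blast
  define r where "r = e / (2 * (h * C + 1))"
  have hC: "0 \<le> h * C" using h C by simp
  have r: "0 < r" using e hC by (simp add: r_def add_nonneg_pos)
  show ?thesis
  proof (rule that[OF r])
    fix g assume g: "g \<in> Lp_space p" and gr: "(\<integral>x. \<bar>g x - f x\<bar> powr p \<partial>unit_meas) < r"
    have d: "(\<lambda>x. g x - f x) \<in> Lp_space p" using Lp_lincomb[OF g f, of 1 "-1"] p by simp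
    note ig = integrable_weighted_powr[OF c g] and jf = integrable_weighted_powr[OF c f]
    have "\<bar>(\<integral>x. c x * \<bar>g x\<bar> powr p \<partial>unit_meas) - (\<integral>x. c x * \<bar>f x\<bar> powr p \<partial>unit_meas)\<bar>
       = \<bar>\<integral>x. c x * \<bar>g x\<bar> powr p - c x * \<bar>f x\<bar> powr p \<partial>unit_meas\<bar>" using ig jf by simp
    also have "\<dots> \<le> (\<integral>x. \<bar>c x * \<bar>g x\<bar> powr p - c x * \<bar>f x\<bar> powr p\<bar> \<partial>unit_meas)" by simp
    also have "\<dots> \<le> (\<integral>x. h * (e1 * \<bar>f x\<bar> powr p + C * \<bar>g x - f x\<bar> powr p) \<partial>unit_meas)"
    proof (rule integral_mono_AE)
      show "AE x in unit_meas. \<bar>c x * \<bar>g x\<bar> powr p - c x * \<bar>f x\<bar> powr p\<bar> \<le> h * (e1 * \<bar>f x\<bar> powr p + C * \<bar>g x - f x\<bar> powr p)"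
        using bounded_between_AE[OF c(1)]
      proof eventually_elim
        case (elim x)
        have "\<bar>c x * \<bar>g x\<bar> powr p - c x * \<bar>f x\<bar> powr p\<bar> = \<bar>c x\<bar> * \<bar>\<bar>g x\<bar> powr p - \<bar>f x\<bar> powr p\<bar>"
          by (simp add: abs_mult[symmetric] right_diff_distrib)
        also have "\<dots> \<le> h * (e1 * \<bar>f x\<bar> powr p + C * \<bar>g x - f x\<bar> powr p)"
          by (rule mult_mono) (use elim c(2) C h in auto)
        finally show ?case .
      qed
    qed (use ig jf Lp_integrable_powr[OF f] Lp_integrable_powr[OF d] in auto)
    also have "\<dots> = h * (e1 * A + C * (\<integral>x. \<bar>g x - f x\<bar> powr p \<partial>unit_meas))"
      using Lp_integrable_powr[OF f] Lp_integrable_powr[OF d] by (simp add: A_def)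
    also have "\<dots> \<le> h * (e1 * A + C * r)"
      using h C gr by (intro mult_left_mono add_left_mono) auto
    also have "\<dots> = (h * A) * e1 + (h * C) * r" by (simp add: algebra_simps)
    also have "\<dots> \<le> e / 2 + e / 2"
    proof (rule add_mono)
      show "(h * A) * e1 \<le> e / 2" using e hA by (simp add: e1_def field_simps)
      show "(h * C) * r \<le> e / 2" using e hC by (simp add: r_def field_simps)
    qed
    finally show "\<bar>(\<integral>x. c x * \<bar>g x\<bar> powr p \<partial>unit_meas) - (\<integral>x. c x * \<bar>f x\<bar> powr p \<partial>unit_meas)\<bar> \<le> e" by simp
  qed
qed

lemma energy_mass_continuous:
  assumes p: "1 < p" and b: "bounded_between l h b" "0 \<le> l" and \<sigma>: "bounded_between l' h' \<sigma>" "0 \<le> l'"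
    and u: "u \<in> W01p p" and e: "0 < e"
  obtains r where "0 < r" "\<And>v. v \<in> W01p p \<Longrightarrow> W1p_norm p (\<lambda>x. v x - u x) < r \<Longrightarrow>
    \<bar>energy p b v - energy p b u\<bar> \<le> e \<and> \<bar>mass p \<sigma> v - mass p \<sigma> u\<bar> \<le> e"
proof -
  note U = W01pD[OF p u]
  obtain r1 where r1: "0 < r1" "\<And>g. g \<in> Lp_space p \<Longrightarrow> (\<integral>x. \<bar>g x - wderiv u x\<bar> powr p \<partial>unit_meas) < r1 \<Longrightarrow>
    \<bar>(\<integral>x. b x * \<bar>g x\<bar> powr p \<partial>unit_meas) - (\<integral>x. b x * \<bar>wderiv u x\<bar> powr p \<partial>unit_meas)\<bar> \<le> e"
    by (rule weighted_powr_integral_continuous[OF p b U(3) e]) blast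
  obtain r2 where r2: "0 < r2" "\<And>g. g \<in> Lp_space p \<Longrightarrow> (\<integral>x. \<bar>g x - u x\<bar> powr p \<partial>unit_meas) < r2 \<Longrightarrow>
    \<bar>(\<integral>x. \<sigma> x * \<bar>g x\<bar> powr p \<partial>unit_meas) - (\<integral>x. \<sigma> x * \<bar>u x\<bar> powr p \<partial>unit_meas)\<bar> \<le> e"
    by (rule weighted_powr_integral_continuous[OF p \<sigma> U(1) e]) blast
  \<comment> \<open>The \<open>p\<close>-th power of the Sobolev norm dominates both integrals.\<close>
  define r where "r = (min r1 r2) powr (1/p)"
  have rp: "r powr p = min r1 r2" using p r1(1) r2(1) by (simp add: r_def powr_powr)
  show ?thesis
  proof (rule that[of r])
    show "0 < r" using r1 r2 by (simp add: r_def)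
    fix v assume v: "v \<in> W01p p" and vr: "W1p_norm p (\<lambda>x. v x - u x) < r"
    note V = W01pD[OF p v]
    have "W1p_norm p (\<lambda>x. v x - u x) powr p < r powr p"
      using vr p W1p_norm_nonneg by (intro powr_less_mono2) auto
    then have n: "W1p_norm p (\<lambda>x. v x - u x) powr p < min r1 r2" by (simp add: rp)
    note D = wderiv_diff[OF V(2) U(2)]
    have "(\<lambda>x. wderiv v x - wderiv u x) \<in> borel_measurable unit_meas" using V(5) U(5) by simp
    then have "(\<integral>x. \<bar>wderiv (\<lambda>x. v x - u x) x\<bar> powr p \<partial>unit_meas) = (\<integral>x. \<bar>wderiv v x - wderiv u x\<bar> powr p \<partial>unit_meas)"
      by (rule integral_abs_powr_cong[OF D(1,2)])
    then have "(\<integral>x. \<bar>wderiv v x - wderiv u x\<bar> powr p \<partial>unit_meas) < r1"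
      using integral_abs_powr_le_norm(2)[of p "\<lambda>x. v x - u x"] n p by simp
    moreover have "(\<integral>x. \<bar>v x - u x\<bar> powr p \<partial>unit_meas) < r2"
      using integral_abs_powr_le_norm(1)[of p "\<lambda>x. v x - u x"] n p by simp
    ultimately show "\<bar>energy p b v - energy p b u\<bar> \<le> e \<and> \<bar>mass p \<sigma> v - mass p \<sigma> u\<bar> \<le> e"
      using r1(2)[OF V(3)] r2(2)[OF V(1)] by (auto simp: energy_def mass_def)
  qed
qed

text \<open>
  The lower bound on the mass keeps the set away from the origin, so that it is closed in the whole
  space although 0 itself has to be excluded from admissible sets.
\<close>

definition sublevel :: "real \<Rightarrow> (real \<Rightarrow> real) \<Rightarrow> (real \<Rightarrow> real) \<Rightarrow> real \<Rightarrow> real \<Rightarrow> (real \<Rightarrow> real) set" where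
  "sublevel p b \<sigma> s \<delta> = {w \<in> W01p p. energy p b w \<le> s * mass p \<sigma> w \<and> \<delta> \<le> mass p \<sigma> w}"

lemma closedin_sublevel:
  assumes p: "1 < p" and b: "bounded_between l h b" "0 \<le> l" and \<sigma>: "bounded_between l' h' \<sigma>" "0 \<le> l'"
  shows "closedin (W01p_topology p) (sublevel p b \<sigma> s \<delta>)"
proof -
  have "openin (W01p_topology p) (W01p p - sublevel p b \<sigma> s \<delta>)"
    unfolding openin_W01p_topology
  proof (intro conjI ballI)
    fix u assume "u \<in> W01p p - sublevel p b \<sigma> s \<delta>"
    then have u: "u \<in> W01p p" and "energy p b u > s * mass p \<sigma> u \<or> \<delta> > mass p \<sigma> u"
      by (auto simp: sublevel_def)
    then consider "energy p b u > s * mass p \<sigma> u" | "\<delta> > mass p \<sigma> u" by blast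
    then show "\<exists>r>0. \<forall>v\<in>W01p p. W1p_norm p (\<lambda>x. v x - u x) < r \<longrightarrow> v \<in> W01p p - sublevel p b \<sigma> s \<delta>"
    proof cases
      case 1
      define e where "e = (energy p b u - s * mass p \<sigma> u) / (2 * (1 + \<bar>s\<bar>))"
      have e: "0 < e" using 1 by (simp add: e_def)
      obtain r where r: "0 < r" "\<And>v. v \<in> W01p p \<Longrightarrow> W1p_norm p (\<lambda>x. v x - u x) < r \<Longrightarrow>
        \<bar>energy p b v - energy p b u\<bar> \<le> e \<and> \<bar>mass p \<sigma> v - mass p \<sigma> u\<bar> \<le> e"
        by (rule energy_mass_continuous[OF p b \<sigma> u e]) blast
      have "v \<notin> sublevel p b \<sigma> s \<delta>" if v: "v \<in> W01p p" "W1p_norm p (\<lambda>x. v x - u x) < r" for v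
      proof
        assume "v \<in> sublevel p b \<sigma> s \<delta>"
        then have a: "energy p b v \<le> s * mass p \<sigma> v" by (simp add: sublevel_def)
        have c: "\<bar>energy p b v - energy p b u\<bar> \<le> e" "\<bar>mass p \<sigma> v - mass p \<sigma> u\<bar> \<le> e" using r(2)[OF v] by auto
        have "s * (mass p \<sigma> v - mass p \<sigma> u) \<le> \<bar>s\<bar> * e"
          using mult_left_mono[OF c(2), of "\<bar>s\<bar>"] abs_ge_self[of "s * (mass p \<sigma> v - mass p \<sigma> u)"] by (simp add: abs_mult)
        then have "energy p b u - s * mass p \<sigma> u \<le> e + \<bar>s\<bar> * e" using a c(1) by (simp add: algebra_simps)
        also have "\<dots> = (1 + \<bar>s\<bar>) * e" by (simp add: algebra_simps)
        also have "\<dots> = (energy p b u - s * mass p \<sigma> u) / 2"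
        proof -
          have "t * (X / (2 * t)) = X / 2" if "t \<noteq> 0" for t X :: real using that by simp
          moreover have "1 + \<bar>s\<bar> \<noteq> 0" by linarith
          ultimately show ?thesis unfolding e_def by blast
        qed
        finally have "energy p b u - s * mass p \<sigma> u \<le> (energy p b u - s * mass p \<sigma> u) / 2" .
        moreover have "X \<le> 0" if "X \<le> X / 2" for X :: real using that by simp
        ultimately show False using 1 by (metis diff_gt_0_iff_gt not_le)
      qed
      then show ?thesis using r(1) by blast
    next
      case 2
      define e where "e = (\<delta> - mass p \<sigma> u) / 2"
      have e: "0 < e" using 2 by (simp add: e_def)
      obtain r where r: "0 < r" "\<And>v. v \<in> W01p p \<Longrightarrow> W1p_norm p (\<lambda>x. v x - u x) < r \<Longrightarrow>
        \<bar>energy p b v - energy p b u\<bar> \<le> e \<and> \<bar>mass p \<sigma> v - mass p \<sigma> u\<bar> \<le> e"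
        by (rule energy_mass_continuous[OF p b \<sigma> u e]) blast
      have "v \<notin> sublevel p b \<sigma> s \<delta>" if v: "v \<in> W01p p" "W1p_norm p (\<lambda>x. v x - u x) < r" for v
      proof -
        have "\<bar>mass p \<sigma> v - mass p \<sigma> u\<bar> \<le> e" using r(2)[OF v] by auto
        moreover have "X < \<delta>" if "\<bar>X - Y\<bar> \<le> (\<delta> - Y) / 2" "Y < \<delta>" for X Y :: real
        proof -
          have "X - Y \<le> (\<delta> - Y) / 2" using that(1) by (rule order_trans[OF abs_ge_self])
          then show ?thesis using that(2) by (simp add: field_simps)
        qed
        ultimately have "mass p \<sigma> v < \<delta>" using 2 unfolding e_def by blast
        then show ?thesis by (simp add: sublevel_def)
      qed
      then show ?thesis using r(1) by blast
    qed
  qed auto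
  moreover have "sublevel p b \<sigma> s \<delta> \<subseteq> W01p p" by (auto simp: sublevel_def)
  ultimately show ?thesis by (simp add: closedin_def topspace_W01p_topology)
qed

text \<open>
  An odd map of \<open>D\<close> into a Euclidean space without the origin, composed with \<open>\<Phi>\<close>, is such a map
  for \<open>C\<close>.
\<close>

lemma genus_mono_map:
  assumes \<Phi>: "continuous_map (W01p_topology p) (W01p_topology p) \<Phi>" "\<Phi> ` C \<subseteq> D"
    and odd: "\<And>u. u \<in> C \<Longrightarrow> \<Phi> (\<lambda>x. - u x) = (\<lambda>x. - \<Phi> u x)"
  shows "genus p C \<le> genus p D"
  unfolding genus_def
proof (rule Inf_superset_mono, safe)
  fix m h
  assume h: "continuous_map (subtopology (W01p_topology p) D) (Euclidean_space m) h"
    "\<forall>u\<in>D. h u \<noteq> (\<lambda>i. 0)" "\<forall>u\<in>D. h (\<lambda>x. - u x) = (\<lambda>i. - h u i)"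
  have "continuous_map (subtopology (W01p_topology p) C) (subtopology (W01p_topology p) D) \<Phi>"
    using \<Phi> by (auto simp: continuous_map_in_subtopology intro: continuous_map_from_subtopology)
  then have "continuous_map (subtopology (W01p_topology p) C) (Euclidean_space m) (h \<circ> \<Phi>)"
    using h(1) by (rule continuous_map_compose)
  moreover have "\<forall>u\<in>C. (h \<circ> \<Phi>) u \<noteq> (\<lambda>i. 0)" "\<forall>u\<in>C. (h \<circ> \<Phi>) (\<lambda>x. - u x) = (\<lambda>i. - (h \<circ> \<Phi>) u i)"
    using h(2,3) \<Phi>(2) odd by (auto simp: image_subset_iff)
  ultimately show "\<exists>m'. enat m = enat m' \<and> (\<exists>h. continuous_map (subtopology (W01p_topology p) C) (Euclidean_space m') h \<and>
     (\<forall>u\<in>C. h u \<noteq> (\<lambda>i. 0)) \<and> (\<forall>u\<in>C. h (\<lambda>x. - u x) = (\<lambda>i. - h u i)))" by blast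
qed

lemma genus_empty: "genus p {} = 0"
proof -
  have "continuous_map (subtopology (W01p_topology p) {}) (Euclidean_space 0) (\<lambda>x. undefined)"
    by (simp add: continuous_map_def)
  then have "genus p {} \<le> enat 0" unfolding genus_def by (intro Inf_lower) auto
  then show ?thesis by (simp add: zero_enat_def[symmetric])
qed

lemma genus_family_nonempty: "C \<in> genus_family p k \<Longrightarrow> 1 \<le> k \<Longrightarrow> C \<noteq> {}"
  by (auto simp: genus_family_def genus_empty zero_enat_def)

lemma energy_mass_uminus:
  assumes p: "1 < p" and u: "u \<in> W01p p" and b: "b \<in> borel_measurable unit_meas"
  shows "energy p b (\<lambda>x. - u x) = energy p b u" "mass p \<sigma> (\<lambda>x. - u x) = mass p \<sigma> u"
proof -
  note M = wderiv_uminus[OF W01pD(2)[OF p u]]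
  have "AE x in unit_meas. b x * \<bar>wderiv (\<lambda>x. - u x) x\<bar> powr p = b x * \<bar>wderiv u x\<bar> powr p"
    using M(1) by eventually_elim simp
  then show "energy p b (\<lambda>x. - u x) = energy p b u" unfolding energy_def
    using M(2) b W01pD(5)[OF p u] by (intro integral_cong_AE) auto
  show "mass p \<sigma> (\<lambda>x. - u x) = mass p \<sigma> u" by (simp add: mass_def)
qed

text \<open>
  Sublevel sets are closed and symmetric, so only the genus has to be estimated in order to use them
  as competitors in the variational problem.
\<close>

lemma sublevel_in_genus_family:
  assumes p: "1 < p" and b: "bounded_between l h b" "0 \<le> l" and \<sigma>: "bounded_between l' h' \<sigma>" "0 \<le> l'"
    and \<delta>: "0 < \<delta>" and g: "enat k \<le> genus p (sublevel p b \<sigma> s \<delta>)"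
  shows "sublevel p b \<sigma> s \<delta> \<in> genus_family p k"
proof -
  have "\<not> (AE x in unit_meas. u x = 0)" if "u \<in> sublevel p b \<sigma> s \<delta>" for u
  proof
    assume z: "AE x in unit_meas. u x = 0"
    have um: "u \<in> borel_measurable unit_meas" using that W01pD(4)[OF p] by (auto simp: sublevel_def)
    have "AE x in unit_meas. \<sigma> x * \<bar>u x\<bar> powr p = 0" using z by eventually_elim simp
    then have "mass p \<sigma> u = (\<integral>x. 0 \<partial>unit_meas)" unfolding mass_def
      using um bounded_between_measurable[OF \<sigma>(1)] by (intro integral_cong_AE) auto
    then show False using that \<delta> by (simp add: sublevel_def)
  qed
  moreover have "(\<lambda>x. - u x) \<in> sublevel p b \<sigma> s \<delta>" if "u \<in> sublevel p b \<sigma> s \<delta>" for u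
    using that W01p_uminus[OF p] energy_mass_uminus[OF p _ bounded_between_measurable[OF b(1)]] by (auto simp: sublevel_def)
  ultimately show ?thesis unfolding genus_family_def using closedin_sublevel[OF p b \<sigma>] g by blast
qed

lemma eigenvalue_le_sublevel:
  assumes "sublevel p b \<sigma> s \<delta> \<in> genus_family p k" "0 < \<delta>"
  shows "eigenvalue p b \<sigma> k \<le> ereal s"
  unfolding eigenvalue_def
proof (rule INF_lower2[OF assms(1)], rule SUP_least)
  fix v assume "v \<in> sublevel p b \<sigma> s \<delta>"
  then show "ereal (rayleigh p b \<sigma> v) \<le> ereal s"
    using assms(2) by (simp add: sublevel_def rayleigh_eq divide_le_eq)
qed

text \<open>
  The complement of an admissible set is open and contains the origin.
\<close>

lemma genus_family_bounded_away:
  assumes p: "1 < p" and C: "C \<in> genus_family p k"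
  obtains r where "0 < r" "\<And>v. v \<in> C \<Longrightarrow> v \<in> W01p p \<and> r \<le> W1p_norm p v"
proof -
  have cl: "closedin (W01p_topology p) C" and nz: "\<forall>u\<in>C. \<not> (AE x in unit_meas. u x = 0)"
    using C by (auto simp: genus_family_def)
  have sub: "C \<subseteq> W01p p" using closedin_subset[OF cl] by (simp add: topspace_W01p_topology)
  have "openin (W01p_topology p) (W01p p - C)" using cl by (simp add: closedin_def topspace_W01p_topology)
  moreover have "(\<lambda>x. 0) \<in> W01p p - C" using W01p_zero[OF p] nz by auto
  ultimately obtain r where r: "r > 0" "\<And>v. v \<in> W01p p \<Longrightarrow> W1p_norm p (\<lambda>x. v x - 0) < r \<Longrightarrow> v \<in> W01p p - C"
    unfolding openin_W01p_topology by meson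
  show ?thesis
  proof (rule that[OF r(1)])
    fix v assume "v \<in> C"
    then show "v \<in> W01p p \<and> r \<le> W1p_norm p v" using r(2)[of v] sub by force
  qed
qed

lemma mass_pos:
  assumes p: "1 < p" and \<sigma>: "bounded_between l' h' \<sigma>" "0 < l'" and v: "v \<in> W01p p"
    and nz: "\<not> (AE x in unit_meas. v x = 0)"
  shows "0 < mass p \<sigma> v"
proof -
  note V = W01pD[OF p v]
  have "0 \<le> (\<integral>x. \<bar>v x\<bar> powr p \<partial>unit_meas)" by simp
  moreover have "(\<integral>x. \<bar>v x\<bar> powr p \<partial>unit_meas) \<noteq> 0"
  proof
    assume "(\<integral>x. \<bar>v x\<bar> powr p \<partial>unit_meas) = 0"
    then have "AE x in unit_meas. \<bar>v x\<bar> powr p = 0"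
      using Lp_integrable_powr[OF V(1)] by (subst (asm) integral_nonneg_eq_0_iff_AE) auto
    then have "AE x in unit_meas. v x = 0" by eventually_elim simp
    then show False using nz by simp
  qed
  ultimately have "0 < (\<integral>x. \<bar>v x\<bar> powr p \<partial>unit_meas)" by linarith
  then have "0 < l' * (\<integral>x. \<bar>v x\<bar> powr p \<partial>unit_meas)" using \<sigma> by simp
  then show ?thesis unfolding mass_def using weighted_integral_bounds(1)[OF \<sigma>(1) _ V(1)] \<sigma>(2) by linarith
qed

lemma energy_nonneg: "bounded_between l h b \<Longrightarrow> 0 \<le> l \<Longrightarrow> 0 \<le> energy p b v"
  unfolding energy_def by (rule Bochner_Integration.integral_nonneg_AE) (auto dest!: bounded_between_AE elim!: eventually_mono)

lemma eigenvalue_lessE: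
  assumes p: "1 < p" and b: "bounded_between l h b" "0 \<le> l" and \<sigma>: "bounded_between l' h' \<sigma>" "0 < l'"
    and s: "eigenvalue p b \<sigma> k < ereal s"
  obtains C where "C \<in> genus_family p k" "\<And>v. v \<in> C \<Longrightarrow> v \<in> W01p p \<and> 0 < mass p \<sigma> v \<and> energy p b v \<le> s * mass p \<sigma> v"
proof -
  obtain C where C: "C \<in> genus_family p k" and sup: "(SUP v\<in>C. ereal (rayleigh p b \<sigma> v)) < ereal s"
    using s unfolding eigenvalue_def INF_less_iff by blast
  have sub: "C \<subseteq> W01p p" and nz: "\<forall>u\<in>C. \<not> (AE x in unit_meas. u x = 0)"
    using C closedin_subset[of "W01p_topology p" C] by (auto simp: genus_family_def topspace_W01p_topology)
  show ?thesis
  proof (rule that[OF C])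
    fix v assume v: "v \<in> C"
    have m: "0 < mass p \<sigma> v" by (rule mass_pos[OF p \<sigma>]) (use v sub nz in auto)
    have "ereal (rayleigh p b \<sigma> v) \<le> (SUP v\<in>C. ereal (rayleigh p b \<sigma> v))" by (rule SUP_upper[OF v])
    also have "\<dots> < ereal s" by (rule sup)
    finally have "rayleigh p b \<sigma> v \<le> s" by simp
    then show "v \<in> W01p p \<and> 0 < mass p \<sigma> v \<and> energy p b v \<le> s * mass p \<sigma> v"
      using m v sub by (auto simp: rayleigh_eq divide_le_eq)
  qed
qed

lemma eigenvalue_nonneg:
  assumes b: "bounded_between l h b" "0 \<le> l" and \<sigma>: "bounded_between l' h' \<sigma>" "0 \<le> l'" and k: "1 \<le> k"
  shows "0 \<le> eigenvalue p b \<sigma> k"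
  unfolding eigenvalue_def
proof (rule INF_greatest)
  fix C assume "C \<in> genus_family p k"
  then obtain v where v: "v \<in> C" using genus_family_nonempty[OF _ k] by blast
  have "0 \<le> mass p \<sigma> v" unfolding mass_def
    by (rule Bochner_Integration.integral_nonneg_AE) (use bounded_between_AE[OF \<sigma>(1)] \<sigma>(2) in \<open>auto elim!: eventually_mono\<close>)
  then have "0 \<le> rayleigh p b \<sigma> v" using energy_nonneg[OF b] by (simp add: rayleigh_eq)
  then show "0 \<le> (SUP v\<in>C. ereal (rayleigh p b \<sigma> v))" by (intro SUP_upper2[OF v]) simp
qed

text \<open>
  The Rayleigh quotients of two problems with the same bounds differ at most by a constant factor,
  and the admissible sets are the same for both.
\<close>

lemma eigenvalue_finite_transfer:
  assumes p: "1 < p" and b: "bounded_between l h b" "0 < l" and \<sigma>: "bounded_between l' h' \<sigma>" "0 < l'"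
    and b2: "bounded_between l h b2" and \<sigma>2: "bounded_between l' h' \<sigma>2"
    and s: "eigenvalue p b \<sigma> k < ereal s"
  shows "eigenvalue p b2 \<sigma>2 k \<le> ereal ((h * h' / (l * l')) * \<bar>s\<bar>)"
proof -
  obtain C where C: "C \<in> genus_family p k"
    and CR: "\<And>v. v \<in> C \<Longrightarrow> v \<in> W01p p \<and> 0 < mass p \<sigma> v \<and> energy p b v \<le> s * mass p \<sigma> v"
    by (rule eigenvalue_lessE[OF p b(1) less_imp_le[OF b(2)] \<sigma> s]) blast
  have nz: "\<forall>u\<in>C. \<not> (AE x in unit_meas. u x = 0)" using C by (auto simp: genus_family_def)
  have hh: "0 < h" "0 < h'" using bounded_between_le[OF b(1)] bounded_between_le[OF \<sigma>(1)] b(2) \<sigma>(2) by linarith+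
  show ?thesis unfolding eigenvalue_def
  proof (rule INF_lower2[OF C], rule SUP_least)
    fix v assume v: "v \<in> C"
    note V = W01pD[OF p, of v]
    have vW: "v \<in> W01p p" and R: "energy p b v \<le> s * mass p \<sigma> v" using CR[OF v] by auto
    define X where "X = (\<integral>x. \<bar>wderiv v x\<bar> powr p \<partial>unit_meas)"
    define Y where "Y = (\<integral>x. \<bar>v x\<bar> powr p \<partial>unit_meas)"
    have e: "l * X \<le> energy p b v" "energy p b2 v \<le> h * X"
      using weighted_integral_bounds[OF _ _ V(3)[OF vW]] b b2 unfolding X_def energy_def by auto
    have m: "mass p \<sigma> v \<le> h' * Y" "l' * Y \<le> mass p \<sigma>2 v"
      using weighted_integral_bounds[OF _ _ V(1)[OF vW]] \<sigma> \<sigma>2 unfolding Y_def mass_def by auto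
    have mp: "0 < mass p \<sigma> v" "0 < mass p \<sigma>2 v" using mass_pos[OF p \<sigma> vW] mass_pos[OF p \<sigma>2 \<sigma>(2) vW] nz v by auto
    have "l * X \<le> \<bar>s\<bar> * (h' * Y)"
    proof -
      have "l * X \<le> s * mass p \<sigma> v" using e(1) R by linarith
      also have "\<dots> \<le> \<bar>s\<bar> * mass p \<sigma> v" using mp by (intro mult_right_mono) auto
      also have "\<dots> \<le> \<bar>s\<bar> * (h' * Y)" using m by (intro mult_left_mono) auto
      finally show ?thesis .
    qed
    then have "X \<le> \<bar>s\<bar> * h' / l * Y" using b(2) by (simp add: field_simps)
    then have "energy p b2 v \<le> h * (\<bar>s\<bar> * h' / l * Y)"
      using e(2) hh(1) mult_left_mono[of X _ h] by fastforce
    also have "\<dots> = (h * h' / (l * l')) * \<bar>s\<bar> * (l' * Y)" using b(2) \<sigma>(2) by (simp add: field_simps)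
    also have "\<dots> \<le> (h * h' / (l * l')) * \<bar>s\<bar> * mass p \<sigma>2 v"
      using hh b(2) \<sigma>(2) m by (intro mult_left_mono) auto
    finally show "ereal (rayleigh p b2 \<sigma>2 v) \<le> ereal ((h * h' / (l * l')) * \<bar>s\<bar>)"
      using mp by (simp add: rayleigh_eq divide_le_eq)
  qed
qed

section \<open>Energy-minimizing interpolation\<close>

definition seg :: "nat \<Rightarrow> nat \<Rightarrow> real set" where
  "seg M i = {real i / real M <.. real (Suc i) / real M}"

definition increment :: "(real \<Rightarrow> real) \<Rightarrow> nat \<Rightarrow> nat \<Rightarrow> real" where
  "increment g M i = prim g (real (Suc i) / real M) - prim g (real i / real M)"

lemma seg_borel: "seg M i \<in> sets borel"
  by (simp add: seg_def)

text \<open>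
  The index is the ceiling of \<open>M * t\<close> minus one, since the cells are open on the left and closed on
  the right. It also determines the value of every cell indicator at \<open>t\<close>.
\<close>

lemma exists_seg:
  assumes M: "0 < M" and t: "0 < t" "t < 1"
  obtains i where "i < M" "real i / real M < t" "t \<le> real (Suc i) / real M"
    "\<And>j. indicat_real (seg M j) t = (if j = i then 1 else 0)"
proof -
  have Mt: "0 < real M * t" "real M * t < real M" using M t by auto
  have c: "1 \<le> \<lceil>real M * t\<rceil>" "\<lceil>real M * t\<rceil> \<le> int M"
    using Mt t by (auto simp: ceiling_le_iff one_le_ceiling)
  define i where "i = nat (\<lceil>real M * t\<rceil> - 1)"
  have i: "int i + 1 = \<lceil>real M * t\<rceil>" using c by (simp add: i_def)
  have mem: "t \<in> seg M j \<longleftrightarrow> j = i" for j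
  proof -
    have "t \<in> seg M j \<longleftrightarrow> real j < real M * t \<and> real M * t \<le> real j + 1"
      using M by (simp add: seg_def field_simps)
    also have "\<dots> \<longleftrightarrow> \<lceil>real M * t\<rceil> = int j + 1" by (simp add: ceiling_eq_iff)
    also have "\<dots> \<longleftrightarrow> j = i" using i by auto
    finally show ?thesis .
  qed
  show ?thesis
  proof (rule that[of i])
    show "i < M" using c i by linarith
    show "real i / real M < t" "t \<le> real (Suc i) / real M" using mem[of i] by (auto simp: seg_def)
    show "indicat_real (seg M j) t = (if j = i then 1 else 0)" for j using mem[of j] by (auto simp: indicator_def)
  qed
qed

lemma integral_seg:
  assumes "integrable unit_meas g"
  shows "(\<integral>t. indicat_real (seg M i) t * g t \<partial>unit_meas) = increment g M i"
proof -
  have "real i / real M \<le> real (Suc i) / real M" by (intro divide_right_mono) auto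
  then have "indicat_real (seg M i) t * g t = indicat_real {..real (Suc i) / real M} t * g t - indicat_real {..real i / real M} t * g t" for t
    by (auto simp: seg_def indicator_def)
  then show ?thesis using assms integrable_indicator_mult_unit by (simp add: increment_def prim_def)
qed

lemma sum_increment:
  shows "(\<Sum>i<n. increment g M i) = prim g (real n / real M)"
  unfolding increment_def using sum_lessThan_telescope[of "\<lambda>i. prim g (real i / real M)" n] by (simp add: prim_0)

lemma sum_increment_all: "0 < M \<Longrightarrow> (\<Sum>i<M. increment g M i) = (\<integral>t. g t \<partial>unit_meas)"
  unfolding sum_increment by (simp add: prim_1)

lemma integral_step_mult:
  assumes "integrable unit_meas g"
  shows "integrable unit_meas (\<lambda>t. g t * (\<Sum>i<M. indicat_real (seg M i) t * c i))"
    "(\<integral>t. g t * (\<Sum>i<M. indicat_real (seg M i) t * c i) \<partial>unit_meas) = (\<Sum>i<M. c i * increment g M i)"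
proof -
  have i: "integrable unit_meas (\<lambda>t. c i * (indicat_real (seg M i) t * g t))" for i
    by (intro integrable_mult_right integrable_indicator_borel assms seg_borel)
  have eq: "g t * (\<Sum>i<M. indicat_real (seg M i) t * c i) = (\<Sum>i<M. c i * (indicat_real (seg M i) t * g t))" for t
    unfolding sum_distrib_left by (rule sum.cong) (simp_all only: mult_ac)
  show "integrable unit_meas (\<lambda>t. g t * (\<Sum>i<M. indicat_real (seg M i) t * c i))"
    unfolding eq using i by simp
  show "(\<integral>t. g t * (\<Sum>i<M. indicat_real (seg M i) t * c i) \<partial>unit_meas) = (\<Sum>i<M. c i * increment g M i)"
    unfolding eq using i by (simp add: Bochner_Integration.integral_sum integral_seg[OF assms])
qed

lemma step_eval:
  fixes c :: "nat \<Rightarrow> real"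
  assumes "\<And>j. indicat_real (seg M j) t = (if j = i then 1 else 0)" "i < M"
  shows "(\<Sum>j<M. indicat_real (seg M j) t * c j) = c i"
  using assms by (simp add: if_distrib[of "\<lambda>x. x * _"] sum.delta cong: if_cong)

text \<open>
  On each cell a constant multiple of the compliance, with the integral over the cell equal to the
  increment of the nodal values \<open>z\<close>.
\<close>

definition interp_grad :: "real \<Rightarrow> (real \<Rightarrow> real) \<Rightarrow> nat \<Rightarrow> (nat \<Rightarrow> real) \<Rightarrow> real \<Rightarrow> real" where
  "interp_grad p a M z t =
     compliance p a t * (\<Sum>i<M. indicat_real (seg M i) t * ((z (Suc i) - z i) / increment (compliance p a) M i))"

lemma increment_bounds:
  assumes f: "bounded_between l h f" and M: "i < M"
  shows "l / real M \<le> increment f M i" "increment f M i \<le> h / real M"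
proof -
  have "real (Suc i) / real M - real i / real M = 1 / real M" by (simp add: diff_divide_distrib[symmetric])
  moreover have "real (Suc i) / real M \<le> 1" using M by simp
  moreover have "real i / real M \<le> real (Suc i) / real M" by (intro divide_right_mono) auto
  ultimately show "l / real M \<le> increment f M i" "increment f M i \<le> h / real M"
    using prim_increment_bounds[OF f, of "real i / real M" "real (Suc i) / real M"] by (auto simp: increment_def)
qed

lemma compliance_integrable: "1 < p \<Longrightarrow> 0 < l \<Longrightarrow> bounded_between l h a \<Longrightarrow> integrable unit_meas (compliance p a)"
  using bounded_between_integrable bounded_between_compliance by blast

lemma increment_compliance_pos:
  assumes "1 < p" "0 < l" "bounded_between l h a" "i < M"
  shows "0 < increment (compliance p a) M i" "h powr (-1/(p-1)) / real M \<le> increment (compliance p a) M i"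
proof -
  have h: "0 < h" using bounded_between_le[OF assms(3)] assms(2) by linarith
  show b: "h powr (-1/(p-1)) / real M \<le> increment (compliance p a) M i" by (rule increment_bounds(1)[OF bounded_between_compliance[OF assms(1-3)] assms(4)])
  have "0 < h powr (-1/(p-1)) / real M" using h assms(4) by simp
  with b show "0 < increment (compliance p a) M i" by linarith
qed

lemma interp_grad_integrable:
  assumes "1 < p" "0 < l" "bounded_between l h a"
  shows "integrable unit_meas (interp_grad p a M z)"
  unfolding interp_grad_def[abs_def] by (rule integral_step_mult(1)[OF compliance_integrable[OF assms]])

lemma interp_grad_measurable:
  assumes "1 < p" "0 < l" "bounded_between l h a"
  shows "interp_grad p a M z \<in> borel_measurable unit_meas"
  by (rule borel_measurable_integrable[OF interp_grad_integrable[OF assms]])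

lemma interp_grad_diff:
  "interp_grad p a M z t - interp_grad p a M w t = interp_grad p a M (\<lambda>j. z j - w j) t"
proof -
  have "y * ((b - c) / B) - y * ((d - e) / B) = y * (((b - d) - (c - e)) / B)" for y b c d e B :: real
    by (simp add: right_diff_distrib[symmetric] diff_divide_distrib[symmetric])
  then show ?thesis
    unfolding interp_grad_def right_diff_distrib[symmetric] sum_subtractf[symmetric] by presburger
qed

lemma interp_grad_uminus:
  "interp_grad p a M (\<lambda>j. - z j) = (\<lambda>t. - interp_grad p a M z t)"
proof
  fix t show "interp_grad p a M (\<lambda>j. - z j) t = - interp_grad p a M z t"
    using interp_grad_diff[of p a M "\<lambda>j. 0" t z] by (simp add: interp_grad_def)
qed

lemma interp_grad_bound:
  assumes p: "1 < p" and l: "0 < l" and a: "bounded_between l h a" and M: "0 < M"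
    and D: "\<And>i. i < M \<Longrightarrow> \<bar>z (Suc i) - z i\<bar> \<le> D"
  shows "AE t in unit_meas. \<bar>interp_grad p a M z t\<bar> \<le> l powr (-1/(p-1)) * (real M / h powr (-1/(p-1))) * D"
proof -
  have h: "0 < h" using bounded_between_le[OF a] l by linarith
  define b where "b = h powr (-1/(p-1))"
  have b: "0 < b" using h by (simp add: b_def)
  have D0: "0 \<le> D" using D[OF M] by linarith
  have cb: "AE t in unit_meas. \<bar>compliance p a t\<bar> \<le> l powr (-1/(p-1))"
    by (rule bounded_between_abs[OF bounded_between_compliance[OF p l a]]) simp
  moreover have "AE t in unit_meas. 0 < t \<and> t < 1" by (rule AE_unitI) auto
  ultimately show ?thesis
  proof eventually_elim
    case (elim t)
    obtain i where i: "i < M" "\<And>j. indicat_real (seg M j) t = (if j = i then 1 else 0)"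
      using exists_seg[OF M] elim by metis
    have "\<bar>(z (Suc i) - z i) / increment (compliance p a) M i\<bar> = \<bar>z (Suc i) - z i\<bar> / increment (compliance p a) M i"
      using increment_compliance_pos(1)[OF p l a i(1)] by simp
    also have "\<dots> \<le> D / (b / real M)"
      using D[OF i(1)] increment_compliance_pos[OF p l a i(1)] b M D0 by (intro frac_le) (auto simp: b_def)
    finally have "\<bar>interp_grad p a M z t\<bar> \<le> l powr (-1/(p-1)) * (D / (b / real M))"
      unfolding interp_grad_def step_eval[OF i(2,1)] abs_mult using elim by (intro mult_mono) auto
    then show ?case by (simp add: b_def mult_ac)
  qed
qed

lemma increment_interp_grad:
  assumes p: "1 < p" and l: "0 < l" and a: "bounded_between l h a" and i: "i < M"
  shows "increment (interp_grad p a M z) M i = z (Suc i) - z i"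
proof -
  have M: "0 < M" using i by simp
  define c where "c k = (z (Suc k) - z k) / increment (compliance p a) M k" for k
  have "increment (interp_grad p a M z) M i = (\<integral>t. indicat_real (seg M i) t * interp_grad p a M z t \<partial>unit_meas)"
    by (rule integral_seg[OF interp_grad_integrable[OF p l a], symmetric])
  also have "\<dots> = (\<integral>t. c i * (indicat_real (seg M i) t * compliance p a t) \<partial>unit_meas)"
  proof (rule Bochner_Integration.integral_cong)
    fix t assume "t \<in> space unit_meas"
    then have "0 < t" "t < 1" by auto
    then obtain k where k: "k < M" "\<And>j. indicat_real (seg M j) t = (if j = k then 1 else 0)"
      using exists_seg[OF M] by metis
    show "indicat_real (seg M i) t * interp_grad p a M z t = c i * (indicat_real (seg M i) t * compliance p a t)"
      unfolding interp_grad_def step_eval[OF k(2,1)] by (simp add: k(2) c_def)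
  qed simp
  also have "\<dots> = c i * increment (compliance p a) M i" using integral_seg[OF compliance_integrable[OF p l a]] by simp
  also have "\<dots> = z (Suc i) - z i" using increment_compliance_pos(1)[OF p l a i] by (simp add: c_def)
  finally show ?thesis .
qed

lemma prim_interp_grad:
  assumes p: "1 < p" and l: "0 < l" and a: "bounded_between l h a" and j: "j \<le> M"
  shows "prim (interp_grad p a M z) (real j / real M) = z j - z 0"
proof -
  have "prim (interp_grad p a M z) (real j / real M) = (\<Sum>i<j. increment (interp_grad p a M z) M i)"
    by (simp add: sum_increment)
  also have "\<dots> = (\<Sum>i<j. z (Suc i) - z i)"
    using j by (intro sum.cong increment_interp_grad[OF p l a]) auto
  also have "\<dots> = z j - z 0" by (rule sum_lessThan_telescope)
  finally show ?thesis .
qed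

lemma compliance_powr: assumes "1 < p" "0 < a x" shows "a x * compliance p a x powr p = compliance p a x"
proof -
  have "1 + -1/(p-1) * p = -1/(p-1)" using assms(1) by (simp add: field_simps)
  moreover have "a x * compliance p a x powr p = a x powr (1 + -1/(p-1) * p)"
    using assms(2) by (simp only: powr_add compliance_def powr_powr) simp
  ultimately show ?thesis by (simp add: compliance_def)
qed

text \<open>
  The interpolant attains equality in the minimum principle on every cell, because \<open>a\<close> times the
  \<open>p\<close>-th power of the compliance is again the compliance.
\<close>

lemma energy_interp_grad:
  assumes p: "1 < p" and l: "0 < l" and a: "bounded_between l h a" and M: "0 < M"
  shows "(\<integral>t. a t * \<bar>interp_grad p a M z t\<bar> powr p \<partial>unit_meas) =
     (\<Sum>i<M. \<bar>z (Suc i) - z i\<bar> powr p / increment (compliance p a) M i powr (p-1))"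
proof -
  define c where "c k = (z (Suc k) - z k) / increment (compliance p a) M k" for k
  have "(\<integral>t. a t * \<bar>interp_grad p a M z t\<bar> powr p \<partial>unit_meas) =
      (\<integral>t. compliance p a t * (\<Sum>i<M. indicat_real (seg M i) t * \<bar>c i\<bar> powr p) \<partial>unit_meas)"
  proof (rule integral_cong_AE)
    show "(\<lambda>t. a t * \<bar>interp_grad p a M z t\<bar> powr p) \<in> borel_measurable unit_meas"
      using bounded_between_measurable[OF a] interp_grad_measurable[OF p l a] by simp
    show "(\<lambda>t. compliance p a t * (\<Sum>i<M. indicat_real (seg M i) t * \<bar>c i\<bar> powr p)) \<in> borel_measurable unit_meas"
      by (rule borel_measurable_integrable[OF integral_step_mult(1)[OF compliance_integrable[OF p l a]]])
    have "AE t in unit_meas. 0 < t \<and> t < 1" by (rule AE_unitI) auto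
    then show "AE t in unit_meas. a t * \<bar>interp_grad p a M z t\<bar> powr p = compliance p a t * (\<Sum>i<M. indicat_real (seg M i) t * \<bar>c i\<bar> powr p)"
      using bounded_between_AE[OF a]
    proof eventually_elim
      case (elim t)
      obtain k where k: "k < M" "\<And>j. indicat_real (seg M j) t = (if j = k then 1 else 0)"
        using exists_seg[OF M] elim by metis
      have "a t * \<bar>interp_grad p a M z t\<bar> powr p = a t * \<bar>compliance p a t * c k\<bar> powr p"
        unfolding interp_grad_def step_eval[OF k(2,1)] by (simp add: c_def)
      also have "\<dots> = (a t * compliance p a t powr p) * \<bar>c k\<bar> powr p"
        by (simp add: abs_mult powr_mult compliance_def)
      also have "\<dots> = compliance p a t * \<bar>c k\<bar> powr p" using compliance_powr[OF p, of a t] elim l by simp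
      finally show ?case unfolding step_eval[OF k(2,1)] .
    qed
  qed
  also have "\<dots> = (\<Sum>i<M. \<bar>c i\<bar> powr p * increment (compliance p a) M i)"
    by (rule integral_step_mult(2)[OF compliance_integrable[OF p l a]])
  also have "\<dots> = (\<Sum>i<M. \<bar>z (Suc i) - z i\<bar> powr p / increment (compliance p a) M i powr (p-1))"
  proof (rule sum.cong[OF refl])
    fix i assume "i \<in> {..<M}"
    then have B: "0 < increment (compliance p a) M i" using increment_compliance_pos(1)[OF p l a] by simp
    then show "\<bar>c i\<bar> powr p * increment (compliance p a) M i = \<bar>z (Suc i) - z i\<bar> powr p / increment (compliance p a) M i powr (p-1)"
      by (simp add: c_def abs_divide powr_divide powr_diff)
  qed
  finally show ?thesis .
qed

text \<open>
  The minimum principle, applied on each cell and summed.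
\<close>

lemma energy_lower_bound_sum:
  assumes p: "1 < p" and l: "0 < l" and a: "bounded_between l h a" and M: "0 < M" and g: "g \<in> Lp_space p"
  shows "(\<Sum>i<M. \<bar>increment g M i\<bar> powr p / increment (compliance p a) M i powr (p-1)) \<le> (\<integral>t. a t * \<bar>g t\<bar> powr p \<partial>unit_meas)"
proof -
  have gi: "integrable unit_meas g" using Lp_integrable[OF g] p by simp
  have ai: "integrable unit_meas (\<lambda>t. a t * \<bar>g t\<bar> powr p)" by (rule integrable_weighted_powr[OF a _ g]) (use l in simp)
  have "(\<Sum>i<M. \<bar>increment g M i\<bar> powr p / increment (compliance p a) M i powr (p-1)) \<le> (\<Sum>i<M. increment (\<lambda>t. a t * \<bar>g t\<bar> powr p) M i)"
  proof (rule sum_mono)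
    fix i assume "i \<in> {..<M}"
    then have i: "i < M" by simp
    show "\<bar>increment g M i\<bar> powr p / increment (compliance p a) M i powr (p-1) \<le> increment (\<lambda>t. a t * \<bar>g t\<bar> powr p) M i"
      using energy_lower_bound[OF p l a g seg_borel, of M i] increment_compliance_pos(1)[OF p l a i]
      by (simp add: integral_seg gi ai compliance_integrable[OF p l a])
  qed
  then show ?thesis by (simp add: sum_increment_all[OF M])
qed

definition interp :: "real \<Rightarrow> (real \<Rightarrow> real) \<Rightarrow> nat \<Rightarrow> (real \<Rightarrow> real) \<Rightarrow> real \<Rightarrow> real" where
  "interp p a M v = prim (interp_grad p a M (\<lambda>j. prim (wderiv v) (real j / real M)))"

lemma interp_props:
  assumes p: "1 < p" and l: "0 < l" and a: "bounded_between l h a" and M: "0 < M" and v: "v \<in> W01p p"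
  shows "interp p a M v \<in> W01p p"
    "j \<le> M \<Longrightarrow> prim (wderiv (interp p a M v)) (real j / real M) = prim (wderiv v) (real j / real M)"
    "energy p a (interp p a M v) = (\<Sum>i<M. \<bar>increment (wderiv v) M i\<bar> powr p / increment (compliance p a) M i powr (p-1))"
proof -
  let ?z = "\<lambda>j. prim (wderiv v) (real j / real M)"
  let ?g = "interp_grad p a M ?z"
  have "\<bar>?z (Suc i) - ?z i\<bar> \<le> 2 * W1p_norm p v" for i
    using abs_prim_wderiv_le[OF p v, of "real (Suc i) / real M"] abs_prim_wderiv_le[OF p v, of "real i / real M"] by linarith
  then have gb: "AE t in unit_meas. \<bar>?g t\<bar> \<le> l powr (-1/(p-1)) * (real M / h powr (-1/(p-1))) * (2 * W1p_norm p v)"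
    by (intro interp_grad_bound[OF p l a M])
  note gm = interp_grad_measurable[OF p l a, of M ?z]
  have gz: "(\<integral>t. ?g t \<partial>unit_meas) = 0"
    using prim_interp_grad[OF p l a order_refl, of M ?z] M W01pD(6)[OF p v] by (simp add: prim_1 prim_0)
  note W = prim_in_W01p[OF p gm gb gz, folded interp_def]
  show w: "interp p a M v \<in> W01p p" by (rule W(1))
  have wm: "wderiv (interp p a M v) \<in> borel_measurable unit_meas" using W01pD(5)[OF p w] by simp
  show "prim (wderiv (interp p a M v)) (real j / real M) = ?z j" if "j \<le> M"
    using prim_cong[OF W(2) wm gm, of "real j / real M"] prim_interp_grad[OF p l a that, of ?z] by (simp add: prim_0)
  have "AE x in unit_meas. a x * \<bar>wderiv (interp p a M v) x\<bar> powr p = a x * \<bar>?g x\<bar> powr p"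
    using W(2) by eventually_elim simp
  then have "energy p a (interp p a M v) = (\<integral>t. a t * \<bar>?g t\<bar> powr p \<partial>unit_meas)"
    unfolding energy_def using bounded_between_measurable[OF a] wm gm by (intro integral_cong_AE) auto
  then show "energy p a (interp p a M v) = (\<Sum>i<M. \<bar>increment (wderiv v) M i\<bar> powr p / increment (compliance p a) M i powr (p-1))"
    unfolding energy_interp_grad[OF p l a M] by (simp add: increment_def)
qed

lemma interp_uminus:
  assumes p: "1 < p" and v: "v \<in> W01p p"
  shows "interp p a M (\<lambda>x. - v x) = (\<lambda>x. - interp p a M v x)"
proof -
  note D = wderiv_uminus[OF W01pD(2)[OF p v]]
  have "prim (wderiv (\<lambda>x. - v x)) y = - prim (wderiv v) y" for y
    using prim_cong[OF D(1,2), of y] W01pD(5)[OF p v] by (simp add: prim_uminus)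
  then have z: "(\<lambda>j. prim (wderiv (\<lambda>x. - v x)) (real j / real M)) = (\<lambda>j. - prim (wderiv v) (real j / real M))"
    by (intro ext)
  show ?thesis unfolding interp_def z interp_grad_uminus by (rule ext) (rule prim_uminus)
qed

text \<open>
  The interpolation is linear, and the gradient of the interpolant of a difference is bounded by the
  increments of its nodal values, which the Sobolev norm controls. The constant grows with \<open>M\<close>;
  only its finiteness matters, for continuity.
\<close>

lemma interp_diff_norm:
  assumes p: "1 < p" and l: "0 < l" and a: "bounded_between l h a" and M: "0 < M" and u: "u \<in> W01p p" and v: "v \<in> W01p p"
  shows "W1p_norm p (\<lambda>x. interp p a M v x - interp p a M u x)
    \<le> 4 * (l powr (-1/(p-1)) * (real M / h powr (-1/(p-1)))) * W1p_norm p (\<lambda>x. v x - u x)"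
proof -
  note U = W01pD[OF p u] and V = W01pD[OF p v]
  let ?zu = "\<lambda>j. prim (wderiv u) (real j / real M)"
  let ?zv = "\<lambda>j. prim (wderiv v) (real j / real M)"
  define N where "N = W1p_norm p (\<lambda>x. v x - u x)"
  have dL: "(\<lambda>x. wderiv v x - wderiv u x) \<in> Lp_space p" using Lp_lincomb[OF V(3) U(3), of 1 "-1"] p by simp
  have "(\<integral>x. \<bar>wderiv v x - wderiv u x\<bar> \<partial>unit_meas) \<le> N"
  proof -
    have "(\<integral>x. \<bar>wderiv v x - wderiv u x\<bar> \<partial>unit_meas) \<le> (\<integral>x. \<bar>wderiv v x - wderiv u x\<bar> powr p \<partial>unit_meas) powr (1/p)"
      by (rule abs_integral_le_Lp[OF p dL])
    also have "\<dots> \<le> N" unfolding N_def W1p_norm_eq[OF wderiv_diff(3)[OF V(2) U(2)]] using p by (intro powr_mono2) auto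
    finally show ?thesis .
  qed
  then have pb: "\<bar>prim (wderiv v) y - prim (wderiv u) y\<bar> \<le> N" for y
    using abs_prim_le[OF Bochner_Integration.integrable_diff[OF V(5) U(5)], of y] prim_diff[OF V(5) U(5), of y] by simp
  have db: "\<bar>(\<lambda>j. ?zv j - ?zu j) (Suc i) - (\<lambda>j. ?zv j - ?zu j) i\<bar> \<le> 2 * N" for i
    using pb[of "real (Suc i) / real M"] pb[of "real i / real M"] by simp
  have "(\<lambda>x. interp p a M v x - interp p a M u x) = prim (interp_grad p a M (\<lambda>j. ?zv j - ?zu j))"
    unfolding interp_def interp_grad_diff[symmetric]
    by (rule ext, rule prim_diff[OF interp_grad_integrable[OF p l a] interp_grad_integrable[OF p l a], symmetric])
  then have "W1p_norm p (\<lambda>x. interp p a M v x - interp p a M u x) \<le> 2 * (l powr (-1/(p-1)) * (real M / h powr (-1/(p-1))) * (2 * N))"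
    using W1p_norm_prim_le[OF p interp_grad_measurable[OF p l a] interp_grad_bound[OF p l a M, where z = "\<lambda>j. ?zv j - ?zu j" and D = "2 * N"]] db by simp
  then show ?thesis by (simp add: N_def mult_ac)
qed

lemma continuous_map_interp:
  assumes p: "1 < p" and l: "0 < l" and a: "bounded_between l h a" and M: "0 < M"
  shows "continuous_map (W01p_topology p) (W01p_topology p) (interp p a M)"
  unfolding continuous_map_def topspace_W01p_topology
proof (intro conjI allI impI)
  show "interp p a M \<in> W01p p \<rightarrow> W01p p" using interp_props(1)[OF p l a M] by auto
  fix S assume S: "openin (W01p_topology p) S"
  define K where "K = 4 * (l powr (-1/(p-1)) * (real M / h powr (-1/(p-1))))"
  have K: "0 \<le> K" by (simp add: K_def)
  show "openin (W01p_topology p) {u \<in> W01p p. interp p a M u \<in> S}"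
    unfolding openin_W01p_topology
  proof (intro conjI ballI)
    fix u assume "u \<in> {u \<in> W01p p. interp p a M u \<in> S}"
    then have u: "u \<in> W01p p" "interp p a M u \<in> S" by auto
    then obtain r where r: "r > 0" "\<And>w. w \<in> W01p p \<Longrightarrow> W1p_norm p (\<lambda>x. w x - interp p a M u x) < r \<Longrightarrow> w \<in> S"
      using S unfolding openin_W01p_topology by blast
    show "\<exists>r>0. \<forall>v\<in>W01p p. W1p_norm p (\<lambda>x. v x - u x) < r \<longrightarrow> v \<in> {u \<in> W01p p. interp p a M u \<in> S}"
    proof (intro exI[of _ "r / (K + 1)"] conjI ballI impI)
      show "0 < r / (K + 1)" using r K by simp
      fix v assume v: "v \<in> W01p p" and n: "W1p_norm p (\<lambda>x. v x - u x) < r / (K + 1)"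
      have "W1p_norm p (\<lambda>x. interp p a M v x - interp p a M u x) \<le> K * W1p_norm p (\<lambda>x. v x - u x)"
        unfolding K_def by (rule interp_diff_norm[OF p l a M u(1) v])
      also have "\<dots> \<le> (K + 1) * W1p_norm p (\<lambda>x. v x - u x)" using W1p_norm_nonneg by (intro mult_right_mono) auto
      also have "\<dots> < r" using n K by (simp add: field_simps)
      finally show "v \<in> {u \<in> W01p p. interp p a M u \<in> S}" using v r(2)[OF interp_props(1)[OF p l a M v]] by simp
    qed
  qed auto
qed

text \<open>
  The tangent to the power function at the larger point lies below its graph. That tangent inequality
  is Young's inequality.
\<close>

lemma powr_lipschitz:
  fixes x y X p :: real
  assumes p: "1 < p" and "0 \<le> x" "0 \<le> y" "x \<le> X" "y \<le> X"
  shows "\<bar>x powr p - y powr p\<bar> \<le> p * X powr (p - 1) * \<bar>x - y\<bar>"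
proof -
  have tangent: "x powr p - y powr p \<le> p * X powr (p - 1) * \<bar>x - y\<bar>" if "0 \<le> x" "0 \<le> y" "x \<le> X" for x y
  proof (cases "x \<le> y")
    case True
    then have "x powr p \<le> y powr p" using p that by (intro powr_mono2) auto
    moreover have "0 \<le> p * X powr (p - 1) * \<bar>x - y\<bar>" using p by simp
    ultimately show ?thesis by linarith
  next
    case False
    have "y * x powr (p-1) \<le> 1 * \<bar>y\<bar> powr p / p + (1 - 1/p) * (1 powr (-1/(p-1)) * \<bar>x powr (p-1)\<bar> powr (p/(p-1)))"
      by (rule young_weighted[OF p]) simp
    then have "y * x powr (p-1) \<le> y powr p / p + (1 - 1/p) * x powr p"
      using that p by (simp add: powr_powr)
    then have "p * (y * x powr (p-1)) \<le> p * (y powr p / p + (1 - 1/p) * x powr p)" using p by simp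
    also have "\<dots> = y powr p + (p - 1) * x powr p" using p by (simp add: field_simps)
    finally have "x powr p - y powr p \<le> p * (x * x powr (p-1)) - p * (y * x powr (p-1))"
      using powr_mult_self[OF that(1), of p] by (simp add: algebra_simps)
    also have "\<dots> = p * x powr (p-1) * (x - y)" by (simp add: algebra_simps)
    also have "\<dots> \<le> p * X powr (p - 1) * \<bar>x - y\<bar>"
      using False p that by (intro mult_mono powr_mono2) auto
    finally show ?thesis .
  qed
  show ?thesis using tangent[of x y] tangent[of y x] assms by (simp add: abs_le_iff abs_minus_commute)
qed

lemma abs_prim_powr_le:
  assumes p: "1 < p" and g: "g \<in> Lp_space p"
  shows "\<bar>prim g x\<bar> powr p \<le> (\<integral>t. \<bar>g t\<bar> powr p \<partial>unit_meas)"
proof -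
  have "\<bar>prim g x\<bar> powr p \<le> (\<integral>t. \<bar>g t\<bar> \<partial>unit_meas) powr p"
    using abs_prim_le[of g x] Lp_integrable[OF g] p by (intro powr_mono2) auto
  also have "\<dots> \<le> (\<integral>t. \<bar>g t\<bar> powr p \<partial>unit_meas)" by (rule abs_integral_powr_le[OF p g])
  finally show ?thesis .
qed

text \<open>
  The minimum principle for the constant coefficient 1 on the interval from \<open>x\<close> to \<open>y\<close>.
\<close>

lemma prim_Hoelder:
  assumes p: "1 < p" and g: "g \<in> Lp_space p" and xy: "0 \<le> x" "x < y" "y \<le> 1"
  shows "\<bar>prim g y - prim g x\<bar> \<le> (\<integral>t. \<bar>g t\<bar> powr p \<partial>unit_meas) powr (1/p) * (y - x) powr ((p-1)/p)"
proof -
  have gi: "integrable unit_meas g" using Lp_integrable[OF g] p by simp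
  define X where "X = (\<integral>t. \<bar>g t\<bar> powr p \<partial>unit_meas)"
  have ind: "(\<integral>t. indicat_real {x<..y} t * f t \<partial>unit_meas) = prim f y - prim f x" if "integrable unit_meas f" for f
  proof -
    have "indicat_real {x<..y} t * f t = indicat_real {..y} t * f t - indicat_real {..x} t * f t" for t
      using xy by (auto simp: indicator_def)
    then show ?thesis using that integrable_indicator_mult_unit by (simp add: prim_def)
  qed
  have c1: "compliance p (\<lambda>x. 1) = (\<lambda>x. 1)" by (auto simp: compliance_def)
  have B: "(\<integral>t. indicat_real {x<..y} t * compliance p (\<lambda>x. 1) t \<partial>unit_meas) = y - x"
    using ind[of "\<lambda>x. 1"] prim_const[of x 1] prim_const[of y 1] xy by (simp add: c1)
  have "\<bar>prim g y - prim g x\<bar> powr p / (y - x) powr (p-1) \<le> (\<integral>t. indicat_real {x<..y} t * (1 * \<bar>g t\<bar> powr p) \<partial>unit_meas)"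
    using energy_lower_bound[OF p _ bounded_between_1 g, of "{x<..y}"] xy unfolding B ind[OF gi] by simp
  also have "\<dots> \<le> X" unfolding X_def
    by (rule integral_mono) (use integrable_indicator_borel[OF Lp_integrable_powr[OF g], of "{x<..y}"] Lp_integrable_powr[OF g] in \<open>auto simp: indicator_def\<close>)
  finally have "\<bar>prim g y - prim g x\<bar> powr p \<le> X * (y - x) powr (p-1)" using xy by (simp add: divide_le_eq)
  then have "(\<bar>prim g y - prim g x\<bar> powr p) powr (1/p) \<le> (X * (y - x) powr (p-1)) powr (1/p)"
    using p by (intro powr_mono2) auto
  then show ?thesis using p by (simp add: powr_mult powr_powr X_def)
qed

text \<open>
  Replacing \<open>v\<close> by its value at the left end of each cell changes the mass little, uniformly for
  bounded gradients in \<open>Lp_space p\<close>: by Hoelder continuity with exponent \<open>(p-1)/p\<close>, the oscillation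
  on a cell is at most a constant times \<open>M powr (-(p-1)/p)\<close>. The approximating sum involves the
  weight only through its integrals over the cells.
\<close>

lemma mass_quadrature:
  assumes p: "1 < p" and \<sigma>: "bounded_between l h \<sigma>" "0 \<le> l" and v: "v \<in> W01p p" and M: "0 < M"
  shows "\<bar>mass p \<sigma> v - (\<Sum>i<M. \<bar>prim (wderiv v) (real i / real M)\<bar> powr p * increment \<sigma> M i)\<bar>
    \<le> h * p * real M powr (-(p-1)/p) * (\<integral>x. \<bar>wderiv v x\<bar> powr p \<partial>unit_meas)"
proof -
  note V = W01pD[OF p v]
  define X where "X = (\<integral>x. \<bar>wderiv v x\<bar> powr p \<partial>unit_meas)"
  have X: "0 \<le> X" by (simp add: X_def)
  define z where "z i = prim (wderiv v) (real i / real M)" for i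
  define q where "q t = (\<Sum>i<M. indicat_real (seg M i) t * \<bar>z i\<bar> powr p)" for t
  have h: "0 \<le> h" using bounded_between_le[OF \<sigma>(1)] \<sigma>(2) by linarith
  define D where "D = p * real M powr (-(p-1)/p) * X"
  have zb: "\<bar>prim (wderiv v) y\<bar> \<le> X powr (1/p)" for y
  proof -
    have "(\<bar>prim (wderiv v) y\<bar> powr p) powr (1/p) \<le> X powr (1/p)"
      using abs_prim_powr_le[OF p V(3), of y] p by (intro powr_mono2) (auto simp: X_def)
    then show ?thesis using p by (simp add: powr_powr)
  qed
  have ptw: "\<bar>\<bar>prim (wderiv v) t\<bar> powr p - q t\<bar> \<le> D" if t: "0 < t" "t < 1" for t
  proof -
    obtain i where i: "i < M" "real i / real M < t" "t \<le> real (Suc i) / real M"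
      and e: "\<And>j. indicat_real (seg M j) t = (if j = i then 1 else 0)" using exists_seg[OF M t] by blast
    have "t - real i / real M \<le> real (Suc i) / real M - real i / real M" using i by simp
    also have "\<dots> = 1 / real M" by (simp add: diff_divide_distrib[symmetric])
    finally have tl: "t - real i / real M \<le> 1 / real M" .
    have "\<bar>prim (wderiv v) t - z i\<bar> \<le> X powr (1/p) * (t - real i / real M) powr ((p-1)/p)"
      unfolding z_def X_def by (rule prim_Hoelder[OF p V(3)]) (use i t in auto)
    also have "\<dots> \<le> X powr (1/p) * (1 / real M) powr ((p-1)/p)"
      using tl i p by (intro mult_left_mono powr_mono2) auto
    finally have "\<bar>prim (wderiv v) t - z i\<bar> \<le> X powr (1/p) * (1 / real M) powr ((p-1)/p)" .
    moreover have "(1 / real M) powr ((p-1)/p) = real M powr (-(p-1)/p)"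
    proof -
      have "(1 / real M) powr ((p-1)/p) = real M powr (-((p-1)/p))"
        using M by (simp add: powr_divide powr_minus_divide)
      also have "-((p-1)/p) = -(p-1)/p" by (rule minus_divide_left)
      finally show ?thesis .
    qed
    ultimately have d: "\<bar>prim (wderiv v) t - z i\<bar> \<le> X powr (1/p) * real M powr (-(p-1)/p)" by simp
    have "\<bar>\<bar>prim (wderiv v) t\<bar> powr p - \<bar>z i\<bar> powr p\<bar> \<le> p * (X powr (1/p)) powr (p - 1) * \<bar>\<bar>prim (wderiv v) t\<bar> - \<bar>z i\<bar>\<bar>"
      by (rule powr_lipschitz[OF p]) (use zb in \<open>auto simp: z_def\<close>)
    also have "\<dots> \<le> p * (X powr (1/p)) powr (p - 1) * (X powr (1/p) * real M powr (-(p-1)/p))"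
      using d abs_triangle_ineq3[of "prim (wderiv v) t" "z i"] p by (intro mult_left_mono) auto
    also have "\<dots> = p * real M powr (-(p-1)/p) * (X powr (1/p) * (X powr (1/p)) powr (p - 1))" by (simp only: mult_ac)
    also have "X powr (1/p) * (X powr (1/p)) powr (p - 1) = (X powr (1/p)) powr p" by (rule powr_mult_self) simp
    also have "\<dots> = X" using X p by (simp add: powr_powr)
    finally show ?thesis unfolding q_def step_eval[OF e i(1)] D_def .
  qed
  have si: "integrable unit_meas \<sigma>" by (rule bounded_between_integrable[OF \<sigma>(1)])
  have qi: "integrable unit_meas (\<lambda>t. \<sigma> t * q t)" and qe: "(\<integral>t. \<sigma> t * q t \<partial>unit_meas) = (\<Sum>i<M. \<bar>z i\<bar> powr p * increment \<sigma> M i)"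
    unfolding q_def by (rule integral_step_mult[OF si])+
  have mi: "integrable unit_meas (\<lambda>t. \<sigma> t * \<bar>v t\<bar> powr p)" by (rule integrable_weighted_powr[OF \<sigma> V(1)])
  have "\<bar>(\<integral>t. \<sigma> t * \<bar>v t\<bar> powr p - \<sigma> t * q t \<partial>unit_meas)\<bar> \<le> h * D"
  proof (rule abs_integral_unit_le)
    show "(\<lambda>t. \<sigma> t * \<bar>v t\<bar> powr p - \<sigma> t * q t) \<in> borel_measurable unit_meas" using mi qi by simp
    have "AE t in unit_meas. \<bar>\<bar>prim (wderiv v) t\<bar> powr p - q t\<bar> \<le> D" by (rule AE_unitI) (rule ptw)
    then show "AE t in unit_meas. \<bar>\<sigma> t * \<bar>v t\<bar> powr p - \<sigma> t * q t\<bar> \<le> h * D"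
      using V(7) bounded_between_AE[OF \<sigma>(1)]
    proof eventually_elim
      case (elim t)
      have "\<bar>\<sigma> t * \<bar>v t\<bar> powr p - \<sigma> t * q t\<bar> = \<bar>\<sigma> t\<bar> * \<bar>\<bar>v t\<bar> powr p - q t\<bar>" by (simp add: abs_mult[symmetric] right_diff_distrib)
      also have "\<dots> \<le> h * D" using elim \<sigma>(2) h by (intro mult_mono) auto
      finally show ?case .
    qed
  qed
  then show ?thesis using mi qi qe by (simp add: mass_def z_def D_def X_def mult.assoc)
qed

section \<open>Stability and convergence of the eigenvalues\<close>

text \<open>
  Energies are compared cell by cell: the exact energy of the interpolant in the second problem
  against the minimum principle for \<open>v\<close> in the first. Masses are compared through their quadrature
  sums, which use the same nodal values for \<open>v\<close> and for its interpolant.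
\<close>

lemma interp_estimate:
  assumes p: "1 < p" and \<alpha>: "0 < \<alpha>" and a1: "bounded_between \<alpha> \<beta> a1" and a2: "bounded_between \<alpha> \<beta> a2"
    and sl: "0 \<le> sl" and \<sigma>1: "bounded_between sl sh \<sigma>1" and \<sigma>2: "bounded_between sl sh \<sigma>2" and M: "0 < M"
    and \<theta>: "0 \<le> \<theta>" "(1 + \<theta>) powr (p - 1) \<le> 2"
    and B: "\<And>i. i < M \<Longrightarrow> increment (compliance p a1) M i \<le> (1 + \<theta>) * increment (compliance p a2) M i"
    and S: "\<And>i. i < M \<Longrightarrow> \<bar>increment \<sigma>1 M i - increment \<sigma>2 M i\<bar> \<le> \<eta>"
    and v: "v \<in> W01p p"
  defines "w \<equiv> interp p a2 M v" and "c0 \<equiv> sh * p * real M powr (-(p-1)/p)"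
  shows "energy p a2 w \<le> (1 + \<theta>) powr (p - 1) * energy p a1 v"
    "\<bar>mass p \<sigma>2 w - mass p \<sigma>1 v\<bar> \<le> (3 * c0 + real M * \<eta>) / \<alpha> * energy p a1 v"
proof -
  note V = W01pD[OF p v]
  note I = interp_props[OF p \<alpha> a2 M v, folded w_def]
  note W = W01pD[OF p I(1)]
  define X1 where "X1 = (\<integral>x. \<bar>wderiv v x\<bar> powr p \<partial>unit_meas)"
  define X2 where "X2 = (\<integral>x. \<bar>wderiv w x\<bar> powr p \<partial>unit_meas)"
  let ?E = "energy p a1 v"
  have term_le: "\<bar>increment (wderiv v) M i\<bar> powr p / increment (compliance p a2) M i powr (p-1)
      \<le> (1 + \<theta>) powr (p - 1) * (\<bar>increment (wderiv v) M i\<bar> powr p / increment (compliance p a1) M i powr (p-1))" if i: "i < M" for i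
  proof -
    note P1 = increment_compliance_pos(1)[OF p \<alpha> a1 i] and P2 = increment_compliance_pos(1)[OF p \<alpha> a2 i]
    have "increment (compliance p a1) M i powr (p-1) \<le> ((1 + \<theta>) * increment (compliance p a2) M i) powr (p-1)"
      using B[OF i] P1 p by (intro powr_mono2) auto
    also have "\<dots> = (1 + \<theta>) powr (p - 1) * increment (compliance p a2) M i powr (p-1)"
      using \<theta> P2 by (simp add: powr_mult)
    finally have *: "increment (compliance p a1) M i powr (p-1) \<le> (1 + \<theta>) powr (p - 1) * increment (compliance p a2) M i powr (p-1)" .
    have "x / y2 \<le> t * (x / y1)" if "0 \<le> x" "0 < y1" "0 < y2" "y1 \<le> t * y2" for x y1 y2 t :: real
      using mult_left_mono[OF that(4,1)] that by (simp add: field_simps)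
    then show ?thesis using * P1 P2 by simp
  qed
  have "energy p a2 w \<le> (\<Sum>i<M. (1 + \<theta>) powr (p - 1) * (\<bar>increment (wderiv v) M i\<bar> powr p / increment (compliance p a1) M i powr (p-1)))"
    unfolding I(3) by (rule sum_mono) (use term_le in simp)
  also have "\<dots> \<le> (1 + \<theta>) powr (p - 1) * ?E"
    unfolding sum_distrib_left[symmetric] energy_def
    by (intro mult_left_mono energy_lower_bound_sum[OF p \<alpha> a1 M V(3)]) auto
  finally show e2: "energy p a2 w \<le> (1 + \<theta>) powr (p - 1) * ?E" .
  have E0: "0 \<le> ?E" using energy_nonneg[OF a1] \<alpha> by simp
  have x1: "\<alpha> * X1 \<le> ?E" unfolding X1_def energy_def by (rule weighted_integral_bounds(1)[OF a1 _ V(3)]) (use \<alpha> in simp)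
  have "\<alpha> * X2 \<le> energy p a2 w" unfolding X2_def energy_def by (rule weighted_integral_bounds(1)[OF a2 _ W(3)]) (use \<alpha> in simp)
  also have "\<dots> \<le> 2 * ?E" using e2 mult_right_mono[OF \<theta>(2) E0] by linarith
  finally have x2: "\<alpha> * X2 \<le> 2 * ?E" .
  define z where "z i = \<bar>prim (wderiv v) (real i / real M)\<bar> powr p" for i
  have zX: "z i \<le> X1" for i unfolding z_def X1_def by (rule abs_prim_powr_le[OF p V(3)])
  have z0: "0 \<le> z i" for i by (simp add: z_def)
  have q1: "\<bar>mass p \<sigma>1 v - (\<Sum>i<M. z i * increment \<sigma>1 M i)\<bar> \<le> c0 * X1"
    unfolding z_def X1_def c0_def by (rule mass_quadrature[OF p \<sigma>1 sl v M])
  have "\<bar>mass p \<sigma>2 w - (\<Sum>i<M. \<bar>prim (wderiv w) (real i / real M)\<bar> powr p * increment \<sigma>2 M i)\<bar> \<le> c0 * X2"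
    unfolding X2_def c0_def by (rule mass_quadrature[OF p \<sigma>2 sl I(1) M])
  moreover have "(\<Sum>i<M. \<bar>prim (wderiv w) (real i / real M)\<bar> powr p * increment \<sigma>2 M i) = (\<Sum>i<M. z i * increment \<sigma>2 M i)"
    by (rule sum.cong) (auto simp: I(2) z_def)
  ultimately have q2: "\<bar>mass p \<sigma>2 w - (\<Sum>i<M. z i * increment \<sigma>2 M i)\<bar> \<le> c0 * X2" by simp
  have "\<bar>(\<Sum>i<M. z i * increment \<sigma>2 M i) - (\<Sum>i<M. z i * increment \<sigma>1 M i)\<bar> = \<bar>\<Sum>i<M. z i * (increment \<sigma>2 M i - increment \<sigma>1 M i)\<bar>"
    by (simp add: sum_subtractf right_diff_distrib)
  also have "\<dots> \<le> (\<Sum>i<M. \<bar>z i * (increment \<sigma>2 M i - increment \<sigma>1 M i)\<bar>)" by (rule sum_abs)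
  also have "\<dots> \<le> (\<Sum>i<M. X1 * \<eta>)"
  proof (rule sum_mono)
    fix i assume "i \<in> {..<M}"
    then have "\<bar>increment \<sigma>2 M i - increment \<sigma>1 M i\<bar> \<le> \<eta>" using S[of i] by (simp add: abs_minus_commute)
    then show "\<bar>z i * (increment \<sigma>2 M i - increment \<sigma>1 M i)\<bar> \<le> X1 * \<eta>"
      unfolding abs_mult using zX[of i] z0[of i] by (intro mult_mono) auto
  qed
  also have "\<dots> = real M * \<eta> * X1" by simp
  finally have q3: "\<bar>(\<Sum>i<M. z i * increment \<sigma>2 M i) - (\<Sum>i<M. z i * increment \<sigma>1 M i)\<bar> \<le> real M * \<eta> * X1" .
  have c0: "0 \<le> c0" using bounded_between_le[OF \<sigma>1] sl p by (simp add: c0_def)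
  have \<eta>: "0 \<le> \<eta>" using S[OF M] by linarith
  have "\<bar>mass p \<sigma>2 w - mass p \<sigma>1 v\<bar> \<le> c0 * X2 + c0 * X1 + real M * \<eta> * X1"
    using q1 q2 q3 by linarith
  also have "\<dots> \<le> c0 * (2 * ?E / \<alpha>) + c0 * (?E / \<alpha>) + real M * \<eta> * (?E / \<alpha>)"
    using x1 x2 \<alpha> c0 \<eta> by (intro add_mono mult_left_mono) (auto simp: field_simps)
  also have "\<dots> = (3 * c0 + real M * \<eta>) / \<alpha> * ?E" using \<alpha> by (simp add: field_simps)
  finally show "\<bar>mass p \<sigma>2 w - mass p \<sigma>1 v\<bar> \<le> (3 * c0 + real M * \<eta>) / \<alpha> * ?E" .
qed

text \<open>
  Closeness of finitely many integrals suffices to compare the \<open>k\<close>-th eigenvalues of two problems,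
  with a partition and a tolerance that depend on the coefficients only through their bounds. An admissible
  set almost optimal for the first problem is mapped by the interpolation into a sublevel set of the
  second.
\<close>

lemma eigenvalue_stability:
  assumes p: "1 < p" and \<alpha>: "0 < \<alpha>" "\<alpha> \<le> \<beta>" and sl: "0 < sl" "sl \<le> sh" and s: "0 \<le> s" and e: "0 < e"
  obtains M \<eta> where "0 < M" "0 < \<eta>"
    "\<And>a1 a2 \<sigma>1 \<sigma>2 k. bounded_between \<alpha> \<beta> a1 \<Longrightarrow> bounded_between \<alpha> \<beta> a2 \<Longrightarrow> bounded_between sl sh \<sigma>1 \<Longrightarrow> bounded_between sl sh \<sigma>2 \<Longrightarrow>
       (\<And>i. i < M \<Longrightarrow> \<bar>increment (compliance p a1) M i - increment (compliance p a2) M i\<bar> \<le> \<eta>) \<Longrightarrow>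
       (\<And>i. i < M \<Longrightarrow> \<bar>increment \<sigma>1 M i - increment \<sigma>2 M i\<bar> \<le> \<eta>) \<Longrightarrow>
       eigenvalue p a1 \<sigma>1 k < ereal s \<Longrightarrow> eigenvalue p a2 \<sigma>2 k \<le> ereal (s + e)"
proof -
  \<comment> \<open>The relative error allowed in both energy and mass: it satisfies \<open>(1 + \<kappa>) * s \<le> (s + e) * (1 - \<kappa>)\<close>.\<close>
  define \<kappa> where "\<kappa> = e / (2 * s + 2 * e)"
  have \<kappa>: "0 < \<kappa>" "\<kappa> \<le> 1/2" using s e by (auto simp: \<kappa>_def field_simps)
  have \<kappa>s: "(1 + \<kappa>) * s \<le> (s + e) * (1 - \<kappa>)"
  proof -
    have "2 * s + 2 * e \<noteq> 0" using s e by linarith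
    then have "\<kappa> * (2 * s + 2 * e) = e" by (simp add: \<kappa>_def)
    moreover have "0 \<le> \<kappa> * e" using \<kappa> e by simp
    ultimately show ?thesis by (simp add: algebra_simps)
  qed
  define \<theta> where "\<theta> = (1 + \<kappa>) powr (1/(p-1)) - 1"
  have \<theta>: "0 < \<theta>" using \<kappa> p by (simp add: \<theta>_def)
  have \<theta>p: "(1 + \<theta>) powr (p - 1) = 1 + \<kappa>" using \<kappa> p by (simp add: \<theta>_def powr_powr)
  define bl where "bl = \<beta> powr (-1/(p-1))"
  have bl: "0 < bl" using \<alpha> by (simp add: bl_def)
  have "((\<lambda>M. 3 * (sh * p * real M powr (-(p-1)/p)) / \<alpha> * s) \<longlongrightarrow> 3 * (sh * p * 0) / \<alpha> * s) sequentially"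
    using p \<alpha> by (intro tendsto_intros tendsto_neg_powr filterlim_real_sequentially) (auto simp: field_simps)
  then have lim0: "((\<lambda>M. 3 * (sh * p * real M powr (-(p-1)/p)) / \<alpha> * s) \<longlongrightarrow> 0) sequentially"
    by simp
  have "eventually (\<lambda>M. 3 * (sh * p * real M powr (-(p-1)/p)) / \<alpha> * s < \<kappa> / 2) sequentially"
    by (rule order_tendstoD(2)[OF lim0]) (use \<kappa> in simp)
  from eventually_conj[OF this eventually_gt_at_top[of 0]]
  obtain M where M: "0 < M" and Mb: "3 * (sh * p * real M powr (-(p-1)/p)) / \<alpha> * s < \<kappa> / 2"
    using eventually_happens' by (metis (no_types, lifting) sequentially_bot)
  \<comment> \<open>The first bound makes the compliances close relative to \<open>bl / M\<close>, the second controls the masses.\<close>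
  define \<eta> where "\<eta> = min (\<theta> * bl / real M) (\<kappa> * \<alpha> / (2 * real M * (s + 1)))"
  have \<eta>: "0 < \<eta>" using \<theta> bl M \<kappa> \<alpha> s by (auto simp: \<eta>_def)
  have \<eta>1: "\<eta> \<le> \<theta> * bl / real M" by (simp add: \<eta>_def)
  have \<eta>2: "real M * \<eta> / \<alpha> * s \<le> \<kappa> / 2"
  proof -
    have "real M * \<eta> / \<alpha> * s \<le> real M * (\<kappa> * \<alpha> / (2 * real M * (s + 1))) / \<alpha> * s"
      using \<alpha> s M by (intro mult_right_mono divide_right_mono mult_left_mono) (auto simp: \<eta>_def)
    also have "\<dots> = \<kappa> / 2 * (s / (s + 1))"
    proof -
      have "m * (\<kappa> * c / (2 * m * t)) / c * s = \<kappa> / 2 * (s / t)" if "m \<noteq> 0" "c \<noteq> 0" "t \<noteq> 0" for m c t :: real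
        using that by (simp add: field_simps)
      moreover have "real M \<noteq> 0" "\<alpha> \<noteq> 0" "s + 1 \<noteq> 0" using \<alpha> s M by auto
      ultimately show ?thesis by blast
    qed
    also have "\<dots> \<le> \<kappa> / 2 * 1" using \<kappa> s by (intro mult_left_mono) auto
    finally show ?thesis by simp
  qed
  show ?thesis
  proof (rule that[OF M \<eta>])
    fix a1 a2 \<sigma>1 \<sigma>2 k
    assume a1: "bounded_between \<alpha> \<beta> a1" and a2: "bounded_between \<alpha> \<beta> a2" and \<sigma>1: "bounded_between sl sh \<sigma>1" and \<sigma>2: "bounded_between sl sh \<sigma>2"
      and D1: "\<And>i. i < M \<Longrightarrow> \<bar>increment (compliance p a1) M i - increment (compliance p a2) M i\<bar> \<le> \<eta>"
      and D2: "\<And>i. i < M \<Longrightarrow> \<bar>increment \<sigma>1 M i - increment \<sigma>2 M i\<bar> \<le> \<eta>"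
      and lam: "eigenvalue p a1 \<sigma>1 k < ereal s"
    obtain C where C: "C \<in> genus_family p k"
      and CR: "\<And>v. v \<in> C \<Longrightarrow> v \<in> W01p p \<and> 0 < mass p \<sigma>1 v \<and> energy p a1 v \<le> s * mass p \<sigma>1 v"
      by (rule eigenvalue_lessE[OF p a1 less_imp_le[OF \<alpha>(1)] \<sigma>1 sl(1) lam]) blast
    obtain r where r: "0 < r" "\<And>v. v \<in> C \<Longrightarrow> v \<in> W01p p \<and> r \<le> W1p_norm p v"
      by (rule genus_family_bounded_away[OF p C]) blast
    have B: "increment (compliance p a1) M i \<le> (1 + \<theta>) * increment (compliance p a2) M i" if i: "i < M" for i
    proof -
      have "\<eta> \<le> \<theta> * (bl / real M)" using \<eta>1 by simp
      also have "\<dots> \<le> \<theta> * increment (compliance p a2) M i"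
        using increment_compliance_pos(2)[OF p \<alpha>(1) a2 i] \<theta> by (intro mult_left_mono) (auto simp: bl_def)
      finally show ?thesis using D1[OF i] by (simp add: algebra_simps abs_le_iff)
    qed
    \<comment> \<open>On \<open>C\<close> energy is bounded by mass, so the distance \<open>r\<close> from the origin bounds the mass below.\<close>
    define \<delta> where "\<delta> = (r powr p / (1 / sl + s / \<alpha>)) / 2"
    have den: "0 < 1 / sl + s / \<alpha>" using sl s \<alpha> by (simp add: add_pos_nonneg)
    have \<delta>: "0 < \<delta>" unfolding \<delta>_def by (rule half_gt_zero, rule divide_pos_pos[OF _ den]) (use r in simp)
    have in_sub: "interp p a2 M v \<in> sublevel p a2 \<sigma>2 (s + e) \<delta>" if vC: "v \<in> C" for v
    proof -
      have v: "v \<in> W01p p" and m1: "0 < mass p \<sigma>1 v" and R: "energy p a1 v \<le> s * mass p \<sigma>1 v" using CR[OF vC] by auto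
      note V = W01pD[OF p v]
      let ?w = "interp p a2 M v"
      have "(1 + \<theta>) powr (p - 1) \<le> 2" using \<theta>p \<kappa> by simp
      note E = interp_estimate[OF p \<alpha>(1) a1 a2 less_imp_le[OF sl(1)] \<sigma>1 \<sigma>2 M less_imp_le[OF \<theta>] this B D2 v]
      let ?c = "(3 * (sh * p * real M powr (-(p-1)/p)) + real M * \<eta>) / \<alpha>"
      have c0: "0 \<le> ?c" using sl p \<alpha> \<eta> by (intro divide_nonneg_pos add_nonneg_nonneg mult_nonneg_nonneg) auto
      have "\<bar>mass p \<sigma>2 ?w - mass p \<sigma>1 v\<bar> \<le> ?c * (s * mass p \<sigma>1 v)"
        using E(2) mult_left_mono[OF R c0] by linarith
      also have "\<dots> = (?c * s) * mass p \<sigma>1 v" by (simp only: mult.assoc)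
      also have "\<dots> \<le> \<kappa> * mass p \<sigma>1 v"
      proof (rule mult_right_mono)
        have "?c * s = 3 * (sh * p * real M powr (-(p-1)/p)) / \<alpha> * s + real M * \<eta> / \<alpha> * s"
          by (simp only: add_divide_distrib distrib_right)
        then show "?c * s \<le> \<kappa>" using Mb \<eta>2 by linarith
      qed (use m1 in simp)
      finally have m2: "(1 - \<kappa>) * mass p \<sigma>1 v \<le> mass p \<sigma>2 ?w" by (simp add: algebra_simps abs_le_iff)
      have "energy p a2 ?w \<le> (1 + \<kappa>) * energy p a1 v" using E(1) by (simp add: \<theta>p)
      also have "\<dots> \<le> (1 + \<kappa>) * (s * mass p \<sigma>1 v)" using R \<kappa> by (intro mult_left_mono) auto
      also have "\<dots> = ((1 + \<kappa>) * s) * mass p \<sigma>1 v" by simp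
      also have "\<dots> \<le> ((s + e) * (1 - \<kappa>)) * mass p \<sigma>1 v" using \<kappa>s m1 by (intro mult_right_mono) auto
      also have "\<dots> = (s + e) * ((1 - \<kappa>) * mass p \<sigma>1 v)" by simp
      also have "\<dots> \<le> (s + e) * mass p \<sigma>2 ?w" using m2 s e by (intro mult_left_mono) auto
      finally have en: "energy p a2 ?w \<le> (s + e) * mass p \<sigma>2 ?w" .
      have "r powr p \<le> W1p_norm p v powr p" using r vC p by (intro powr_mono2) auto
      also have "\<dots> = (\<integral>x. \<bar>v x\<bar> powr p \<partial>unit_meas) + (\<integral>x. \<bar>wderiv v x\<bar> powr p \<partial>unit_meas)"
        by (rule W1p_norm_powr) (use p in simp)
      also have "\<dots> \<le> mass p \<sigma>1 v / sl + s * mass p \<sigma>1 v / \<alpha>"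
      proof (rule add_mono)
        show "(\<integral>x. \<bar>v x\<bar> powr p \<partial>unit_meas) \<le> mass p \<sigma>1 v / sl"
          using weighted_integral_bounds(1)[OF \<sigma>1 _ V(1)] sl by (simp add: mass_def field_simps)
        have "\<alpha> * (\<integral>x. \<bar>wderiv v x\<bar> powr p \<partial>unit_meas) \<le> s * mass p \<sigma>1 v"
          using weighted_integral_bounds(1)[OF a1 _ V(3)] \<alpha> R by (simp add: energy_def)
        then show "(\<integral>x. \<bar>wderiv v x\<bar> powr p \<partial>unit_meas) \<le> s * mass p \<sigma>1 v / \<alpha>" using \<alpha> by (simp add: field_simps)
      qed
      also have "\<dots> = mass p \<sigma>1 v * (1 / sl + s / \<alpha>)" by (simp add: algebra_simps)
      finally have "r powr p / (1 / sl + s / \<alpha>) \<le> mass p \<sigma>1 v" using den by (simp add: divide_le_eq)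
      then have "\<delta> \<le> (1/2) * mass p \<sigma>1 v" unfolding \<delta>_def by (simp only: mult.commute[of "1/2"] divide_right_mono times_divide_eq_right mult_1_right)
      also have "\<dots> \<le> (1 - \<kappa>) * mass p \<sigma>1 v" using \<kappa> m1 by (intro mult_right_mono) auto
      also have "\<dots> \<le> mass p \<sigma>2 ?w" by (rule m2)
      finally show ?thesis using en interp_props(1)[OF p \<alpha>(1) a2 M v] by (simp add: sublevel_def)
    qed
    have "enat k \<le> genus p C" using C by (simp add: genus_family_def)
    also have "\<dots> \<le> genus p (sublevel p a2 \<sigma>2 (s + e) \<delta>)"
    proof (rule genus_mono_map[OF continuous_map_interp[OF p \<alpha>(1) a2 M]])
      show "interp p a2 M ` C \<subseteq> sublevel p a2 \<sigma>2 (s + e) \<delta>" using in_sub by blast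
      show "interp p a2 M (\<lambda>x. - u x) = (\<lambda>x. - interp p a2 M u x)" if "u \<in> C" for u
        using interp_uminus[OF p] CR[OF that] by blast
    qed
    finally have "sublevel p a2 \<sigma>2 (s + e) \<delta> \<in> genus_family p k"
      using sublevel_in_genus_family[OF p a2 _ \<sigma>2 _ \<delta>] \<alpha> sl by simp
    then show "eigenvalue p a2 \<sigma>2 k \<le> ereal (s + e)" by (rule eigenvalue_le_sublevel[OF _ \<delta>])
  qed
qed

text \<open>
  Test with the indicator of the set where the bound fails.
\<close>

lemma AE_ge_of_integral:
  fixes l :: real and \<rho> :: "real \<Rightarrow> real"
  assumes \<rho>: "integrable unit_meas \<rho>"
    and le: "\<And>g. g \<in> borel_measurable unit_meas \<Longrightarrow> (\<And>x. 0 \<le> g x \<and> g x \<le> 1) \<Longrightarrow>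
      l * (\<integral>x. g x \<partial>unit_meas) \<le> (\<integral>x. \<rho> x * g x \<partial>unit_meas)"
  shows "AE x in unit_meas. l \<le> \<rho> x"
proof -
  define g where "g x = (if \<rho> x < l then 1 else 0::real)" for x
  have [measurable]: "\<rho> \<in> borel_measurable unit_meas" using \<rho> by simp
  have gm: "g \<in> borel_measurable unit_meas" unfolding g_def[abs_def] by measurable
  have gi: "integrable unit_meas g" by (rule bounded_integrable_unit[OF gm, of 1]) (auto simp: g_def)
  have rg: "integrable unit_meas (\<lambda>x. \<rho> x * g x)"
    using integrable_bounded_mult[OF \<rho> gm, of 1] by (simp add: g_def mult.commute)
  have i: "integrable unit_meas (\<lambda>x. (l - \<rho> x) * g x)" using rg gi by (simp add: left_diff_distrib)
  have nn: "0 \<le> (l - \<rho> x) * g x" for x by (simp add: g_def)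
  have "(\<integral>x. (l - \<rho> x) * g x \<partial>unit_meas) = l * (\<integral>x. g x \<partial>unit_meas) - (\<integral>x. \<rho> x * g x \<partial>unit_meas)"
    using rg gi by (simp add: left_diff_distrib)
  also have "\<dots> \<le> 0" using le[OF gm] by (simp add: g_def)
  finally have "(\<integral>x. (l - \<rho> x) * g x \<partial>unit_meas) = 0"
    using Bochner_Integration.integral_nonneg[of unit_meas "\<lambda>x. (l - \<rho> x) * g x"] nn by (simp add: antisym)
  then have "AE x in unit_meas. (l - \<rho> x) * g x = 0"
    using i nn by (subst (asm) integral_nonneg_eq_0_iff_AE) auto
  then show ?thesis by eventually_elim (auto simp: g_def split: if_splits)
qed

lemma Lp1_bounded: "g \<in> borel_measurable unit_meas \<Longrightarrow> (\<And>x. 0 \<le> g x \<and> g x \<le> 1) \<Longrightarrow> g \<in> Lp_space 1"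
  by (rule bounded_Lp[of _ 1]) auto

lemma weak_star_limit_bounded_between:
  fixes \<rho>_eps :: "real \<Rightarrow> real \<Rightarrow> real"
  assumes \<rho>e: "\<And>\<epsilon>. 0 < \<epsilon> \<Longrightarrow> bounded_between l h (\<rho>_eps \<epsilon>)" and w: "weak_star_conv_Linf \<rho>_eps \<rho> (at_right 0)"
  shows "bounded_between l h \<rho>"
proof -
  obtain B where \<rho>m: "\<rho> \<in> borel_measurable unit_meas" and B: "AE x in unit_meas. \<bar>\<rho> x\<bar> \<le> B"
    using w by (auto simp: weak_star_conv_Linf_def Linf_space_def)
  have \<rho>i: "integrable unit_meas \<rho>" by (rule bounded_integrable_unit[OF \<rho>m B])
  have conv: "((\<lambda>\<epsilon>. \<integral>x. \<rho>_eps \<epsilon> x * g x \<partial>unit_meas) \<longlongrightarrow> (\<integral>x. \<rho> x * g x \<partial>unit_meas)) (at_right 0)"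
    if "g \<in> Lp_space 1" for g using w that by (simp add: weak_star_conv_Linf_def)
  have ev: "eventually (\<lambda>\<epsilon>::real. 0 < \<epsilon>) (at_right 0)" by (rule eventually_at_right_less)
  have nb: "l * (\<integral>x. g x \<partial>unit_meas) \<le> (\<integral>x. \<rho>_eps \<epsilon> x * g x \<partial>unit_meas) \<and> (\<integral>x. \<rho>_eps \<epsilon> x * g x \<partial>unit_meas) \<le> h * (\<integral>x. g x \<partial>unit_meas)"
    if \<epsilon>: "0 < \<epsilon>" and g: "g \<in> borel_measurable unit_meas" "\<And>x. 0 \<le> g x \<and> g x \<le> 1" for \<epsilon> g
  proof -
    have gi: "integrable unit_meas g" by (rule bounded_integrable_unit[OF g(1), of 1]) (use g in auto)
    have ri: "integrable unit_meas (\<lambda>x. \<rho>_eps \<epsilon> x * g x)"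
      using integrable_bounded_mult[OF bounded_between_integrable[OF \<rho>e[OF \<epsilon>]] g(1), of 1] g(2) by (simp add: mult.commute)
    have "(\<integral>x. l * g x \<partial>unit_meas) \<le> (\<integral>x. \<rho>_eps \<epsilon> x * g x \<partial>unit_meas)"
    proof (rule integral_mono_AE)
      show "AE x in unit_meas. l * g x \<le> \<rho>_eps \<epsilon> x * g x"
        using bounded_between_AE[OF \<rho>e[OF \<epsilon>]] by eventually_elim (use g in \<open>auto intro!: mult_right_mono\<close>)
    qed (use gi ri in auto)
    moreover have "(\<integral>x. \<rho>_eps \<epsilon> x * g x \<partial>unit_meas) \<le> (\<integral>x. h * g x \<partial>unit_meas)"
    proof (rule integral_mono_AE)
      show "AE x in unit_meas. \<rho>_eps \<epsilon> x * g x \<le> h * g x"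
        using bounded_between_AE[OF \<rho>e[OF \<epsilon>]] by eventually_elim (use g in \<open>auto intro!: mult_right_mono\<close>)
    qed (use gi ri in auto)
    ultimately show ?thesis by simp
  qed
  have "AE x in unit_meas. l \<le> \<rho> x"
  proof (rule AE_ge_of_integral[OF \<rho>i])
    fix g assume g: "g \<in> borel_measurable unit_meas" "\<And>x. 0 \<le> g x \<and> g x \<le> (1::real)"
    have "eventually (\<lambda>\<epsilon>. l * (\<integral>x. g x \<partial>unit_meas) \<le> (\<integral>x. \<rho>_eps \<epsilon> x * g x \<partial>unit_meas)) (at_right 0)"
      using ev by eventually_elim (use nb g in blast)
    then show "l * (\<integral>x. g x \<partial>unit_meas) \<le> (\<integral>x. \<rho> x * g x \<partial>unit_meas)"
      using tendsto_lowerbound[OF conv[OF Lp1_bounded[OF g]]] by simp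
  qed
  moreover have "AE x in unit_meas. - h \<le> - \<rho> x"
  proof (rule AE_ge_of_integral)
    fix g assume g: "g \<in> borel_measurable unit_meas" "\<And>x. 0 \<le> g x \<and> g x \<le> (1::real)"
    have "eventually (\<lambda>\<epsilon>. (\<integral>x. \<rho>_eps \<epsilon> x * g x \<partial>unit_meas) \<le> h * (\<integral>x. g x \<partial>unit_meas)) (at_right 0)"
      using ev by eventually_elim (use nb g in blast)
    then have "(\<integral>x. \<rho> x * g x \<partial>unit_meas) \<le> h * (\<integral>x. g x \<partial>unit_meas)"
      using tendsto_upperbound[OF conv[OF Lp1_bounded[OF g]]] by simp
    then show "- h * (\<integral>x. g x \<partial>unit_meas) \<le> (\<integral>x. - \<rho> x * g x \<partial>unit_meas)" by simp
  qed (use \<rho>i in simp)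
  ultimately have "AE x in unit_meas. l \<le> \<rho> x \<and> \<rho> x \<le> h" by eventually_elim simp
  then show ?thesis using \<rho>m by (simp add: bounded_between_def)
qed

lemma weak_star_prim:
  assumes "weak_star_conv_Linf \<rho>_eps \<rho> F"
  shows "((\<lambda>\<epsilon>. prim (\<rho>_eps \<epsilon>) x) \<longlongrightarrow> prim \<rho> x) F"
proof -
  have "(\<lambda>t. indicat_real {..x} t) \<in> Lp_space 1"
    by (rule Lp1_bounded[OF borel_measurable_indicator_atMost_unit]) (auto simp: indicator_def)
  then have "((\<lambda>\<epsilon>. \<integral>t. \<rho>_eps \<epsilon> t * indicat_real {..x} t \<partial>unit_meas) \<longlongrightarrow> (\<integral>t. \<rho> t * indicat_real {..x} t \<partial>unit_meas)) F"
    using assms unfolding weak_star_conv_Linf_def by blast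
  then show ?thesis unfolding prim_def by (simp only: mult.commute[of "indicat_real {..x} _"])
qed

text \<open>
  Stability is applied in both directions. Working below and above the limit eigenvalue in the
  extended reals covers an infinite limit as well.
\<close>

lemma eigenvalue_tendsto:
  fixes a_eps \<rho>_eps :: "real \<Rightarrow> real \<Rightarrow> real"
  assumes p: "1 < p" and \<alpha>: "0 < \<alpha>" and sl: "0 < sl"
    and ae: "\<And>\<epsilon>. 0 < \<epsilon> \<Longrightarrow> bounded_between \<alpha> \<beta> (a_eps \<epsilon>)" and a: "bounded_between \<alpha> \<beta> a"
    and \<rho>e: "\<And>\<epsilon>. 0 < \<epsilon> \<Longrightarrow> bounded_between sl sh (\<rho>_eps \<epsilon>)" and \<rho>: "bounded_between sl sh \<rho>"
    and la: "\<And>x. 0 \<le> x \<Longrightarrow> x \<le> 1 \<Longrightarrow> ((\<lambda>\<epsilon>. prim (compliance p (a_eps \<epsilon>)) x) \<longlongrightarrow> prim (compliance p a) x) (at_right 0)"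
    and lr: "\<And>x. 0 \<le> x \<Longrightarrow> x \<le> 1 \<Longrightarrow> ((\<lambda>\<epsilon>. prim (\<rho>_eps \<epsilon>) x) \<longlongrightarrow> prim \<rho> x) (at_right 0)"
    and k: "1 \<le> k"
  shows "((\<lambda>\<epsilon>. eigenvalue p (a_eps \<epsilon>) (\<rho>_eps \<epsilon>) k) \<longlongrightarrow> eigenvalue p a \<rho> k) (at_right 0)"
proof -
  have ab: "\<alpha> \<le> \<beta>" and ss: "sl \<le> sh" using bounded_between_le[OF a] bounded_between_le[OF \<rho>] .
  have ev: "eventually (\<lambda>\<epsilon>::real. 0 < \<epsilon>) (at_right 0)" by (rule eventually_at_right_less)
  have increment_close: "eventually (\<lambda>\<epsilon>. \<forall>i<M. \<bar>increment (f \<epsilon>) M i - increment f0 M i\<bar> \<le> \<eta>) (at_right 0)"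
    if l: "\<And>x. 0 \<le> x \<Longrightarrow> x \<le> 1 \<Longrightarrow> ((\<lambda>\<epsilon>. prim (f \<epsilon>) x) \<longlongrightarrow> prim f0 x) (at_right 0)" and M: "0 < M" and \<eta>: "0 < \<eta>"
    for f :: "real \<Rightarrow> real \<Rightarrow> real" and f0 M \<eta>
  proof -
    have "eventually (\<lambda>\<epsilon>. \<bar>increment (f \<epsilon>) M i - increment f0 M i\<bar> \<le> \<eta>) (at_right 0)" if i: "i < M" for i
    proof -
      have "((\<lambda>\<epsilon>. increment (f \<epsilon>) M i) \<longlongrightarrow> increment f0 M i) (at_right 0)"
        unfolding increment_def by (intro tendsto_diff l) (use i in auto)
      then have "eventually (\<lambda>\<epsilon>. dist (increment (f \<epsilon>) M i) (increment f0 M i) < \<eta>) (at_right 0)" using \<eta> by (rule tendstoD)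
      then show ?thesis by eventually_elim (simp add: dist_real_def)
    qed
    then have "eventually (\<lambda>\<epsilon>. \<forall>i\<in>{..<M}. \<bar>increment (f \<epsilon>) M i - increment f0 M i\<bar> \<le> \<eta>) (at_right 0)"
      by (intro eventually_ball_finite) auto
    then show ?thesis by eventually_elim auto
  qed
  have close: "eventually (\<lambda>\<epsilon>. \<forall>i<M. \<bar>increment (compliance p (a_eps \<epsilon>)) M i - increment (compliance p a) M i\<bar> \<le> \<eta>) (at_right 0)"
    "eventually (\<lambda>\<epsilon>. \<forall>i<M. \<bar>increment (\<rho>_eps \<epsilon>) M i - increment \<rho> M i\<bar> \<le> \<eta>) (at_right 0)"
    if M: "0 < M" "0 < \<eta>" for M \<eta>
    by (rule increment_close[OF _ M], rule la, assumption+) (rule increment_close[OF _ M], rule lr, assumption+)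
  have lam0: "0 \<le> eigenvalue p a \<rho> k"
    by (rule eigenvalue_nonneg[OF a _ \<rho> _ k]) (use \<alpha> sl in auto)
  show ?thesis
  proof (rule order_tendstoI)
    fix y assume y: "y < eigenvalue p a \<rho> k"
    show "eventually (\<lambda>\<epsilon>. y < eigenvalue p (a_eps \<epsilon>) (\<rho>_eps \<epsilon>) k) (at_right 0)"
    proof (cases "y < 0")
      case True
      show ?thesis using ev
      proof eventually_elim
        case (elim \<epsilon>)
        have "0 \<le> eigenvalue p (a_eps \<epsilon>) (\<rho>_eps \<epsilon>) k"
          by (rule eigenvalue_nonneg[OF ae[OF elim] _ \<rho>e[OF elim] _ k]) (use \<alpha> sl in auto)
        then show ?case using True by (rule less_le_trans[rotated])
      qed
    next
      case False
      obtain s where s: "y < ereal s" "ereal s < eigenvalue p a \<rho> k" using ereal_dense2[OF y] by blast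
      \<comment> \<open>An eigenvalue below \<open>s\<close> near the limit would make the limit eigenvalue at most \<open>t\<close>.\<close>
      obtain t where t: "ereal s < ereal t" "ereal t < eigenvalue p a \<rho> k" using ereal_dense2[OF s(2)] by blast
      have s0: "0 \<le> s"
      proof -
        have "(0::ereal) < ereal s" using False s(1) by (meson not_less le_less_trans)
        then show ?thesis by simp
      qed
      have st: "0 < t - s" using t(1) by simp
      obtain M \<eta> where M: "0 < M" "0 < \<eta>" and stab: "\<And>a1 a2 \<sigma>1 \<sigma>2 k. bounded_between \<alpha> \<beta> a1 \<Longrightarrow> bounded_between \<alpha> \<beta> a2 \<Longrightarrow> bounded_between sl sh \<sigma>1 \<Longrightarrow> bounded_between sl sh \<sigma>2 \<Longrightarrow>
       (\<And>i. i < M \<Longrightarrow> \<bar>increment (compliance p a1) M i - increment (compliance p a2) M i\<bar> \<le> \<eta>) \<Longrightarrow>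
       (\<And>i. i < M \<Longrightarrow> \<bar>increment \<sigma>1 M i - increment \<sigma>2 M i\<bar> \<le> \<eta>) \<Longrightarrow>
       eigenvalue p a1 \<sigma>1 k < ereal s \<Longrightarrow> eigenvalue p a2 \<sigma>2 k \<le> ereal (s + (t - s))"
        by (rule eigenvalue_stability[OF p \<alpha> ab sl ss s0 st]) blast
      show ?thesis using ev close[OF M]
      proof eventually_elim
        case (elim \<epsilon>)
        have "\<not> eigenvalue p (a_eps \<epsilon>) (\<rho>_eps \<epsilon>) k < ereal s"
        proof
          assume "eigenvalue p (a_eps \<epsilon>) (\<rho>_eps \<epsilon>) k < ereal s"
          then have "eigenvalue p a \<rho> k \<le> ereal (s + (t - s))"
            using elim by (intro stab[OF ae[OF elim(1)] a \<rho>e[OF elim(1)] \<rho>]) auto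
          then show False using t(2) by simp
        qed
        then show ?case using s(1) by (meson not_less less_le_trans)
      qed
    qed
  next
    fix y assume y: "eigenvalue p a \<rho> k < y"
    obtain s where s: "eigenvalue p a \<rho> k < ereal s" "ereal s < y" using ereal_dense2[OF y] by blast
    obtain t where t: "ereal s < ereal t" "ereal t < y" using ereal_dense2[OF s(2)] by blast
    have s0: "0 \<le> s"
    proof -
      have "(0::ereal) < ereal s" using lam0 s(1) by (rule le_less_trans)
      then show ?thesis by simp
    qed
    have st: "0 < t - s" using t(1) by simp
    obtain M \<eta> where M: "0 < M" "0 < \<eta>" and stab: "\<And>a1 a2 \<sigma>1 \<sigma>2 k. bounded_between \<alpha> \<beta> a1 \<Longrightarrow> bounded_between \<alpha> \<beta> a2 \<Longrightarrow> bounded_between sl sh \<sigma>1 \<Longrightarrow> bounded_between sl sh \<sigma>2 \<Longrightarrow>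
       (\<And>i. i < M \<Longrightarrow> \<bar>increment (compliance p a1) M i - increment (compliance p a2) M i\<bar> \<le> \<eta>) \<Longrightarrow>
       (\<And>i. i < M \<Longrightarrow> \<bar>increment \<sigma>1 M i - increment \<sigma>2 M i\<bar> \<le> \<eta>) \<Longrightarrow>
       eigenvalue p a1 \<sigma>1 k < ereal s \<Longrightarrow> eigenvalue p a2 \<sigma>2 k \<le> ereal (s + (t - s))"
      by (rule eigenvalue_stability[OF p \<alpha> ab sl ss s0 st]) blast
    show "eventually (\<lambda>\<epsilon>. eigenvalue p (a_eps \<epsilon>) (\<rho>_eps \<epsilon>) k < y) (at_right 0)"
      using ev close[OF M]
    proof eventually_elim
      case (elim \<epsilon>)
      have "eigenvalue p (a_eps \<epsilon>) (\<rho>_eps \<epsilon>) k \<le> ereal (s + (t - s))"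
        using elim by (intro stab[OF a ae[OF elim(1)] \<rho> \<rho>e[OF elim(1)] _ _ s(1)]) (auto simp: abs_minus_commute)
      then show ?case using t(2) by simp
    qed
  qed
qed

section \<open>Convergence of the eigenfunctions\<close>

lemma Lp_norm_eq_1:
  assumes "0 < p" "Lp_norm p u = 1" shows "(\<integral>x. \<bar>u x\<bar> powr p \<partial>unit_meas) = 1"
proof -
  have "(\<integral>x. \<bar>u x\<bar> powr p \<partial>unit_meas) = ((\<integral>x. \<bar>u x\<bar> powr p \<partial>unit_meas) powr (1/p)) powr p"
    using assms(1) by (simp add: powr_powr)
  also have "\<dots> = 1" using assms(2) by (simp add: Lp_norm_def)
  finally show ?thesis .
qed

lemma signed_powr_mult_self: "1 < p \<Longrightarrow> signed_powr (p - 1) t * t = \<bar>t\<bar> powr p"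
proof -
  assume "1 < p"
  have "signed_powr (p - 1) t * t = (sgn t * t) * \<bar>t\<bar> powr (p-1)" by (simp add: signed_powr_def)
  also have "sgn t * t = \<bar>t\<bar>" by (simp add: abs_sgn mult.commute)
  finally show ?thesis by (simp add: powr_mult_self)
qed

text \<open>
  Test the equation with the eigenfunction itself.
\<close>

lemma eigenfunction_energy:
  assumes p: "1 < p" and e: "eigenfunction p b \<sigma> (ereal l) u"
  shows "u \<in> W01p p" "energy p b u = l * mass p \<sigma> u"
proof -
  have ws: "weak_solution p b (\<lambda>v. l * (\<integral>x. \<sigma> x * (\<bar>u x\<bar> powr (p - 2) * u x) * v x \<partial>unit_meas)) u"
    using e by (simp add: eigenfunction_def)
  then show u: "u \<in> W01p p" by (simp add: weak_solution_def)
  have "(\<integral>x. flux p b u x * wderiv u x \<partial>unit_meas) = l * (\<integral>x. \<sigma> x * (\<bar>u x\<bar> powr (p - 2) * u x) * u x \<partial>unit_meas)"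
    using ws u by (simp add: weak_solution_def)
  then show "energy p b u = l * mass p \<sigma> u"
    by (simp add: energy_def mass_def flux_signed_powr abs_powr_mult_eq_signed_powr mult.assoc signed_powr_mult_self[OF p])
qed

lemma normalized_eigenfunction_bounds:
  assumes p: "1 < p" and b: "bounded_between \<alpha> \<beta> b" "0 < \<alpha>" and \<sigma>: "bounded_between sl sh \<sigma>" "0 < sl"
    and e: "eigenfunction p b \<sigma> (ereal l) u" and n: "Lp_norm p u = 1"
  shows "(\<integral>x. \<bar>wderiv u x\<bar> powr p \<partial>unit_meas) \<le> \<bar>l\<bar> * sh / \<alpha>"
proof -
  note E = eigenfunction_energy[OF p e]
  note U = W01pD[OF p E(1)]
  have m1: "(\<integral>x. \<bar>u x\<bar> powr p \<partial>unit_meas) = 1" using Lp_norm_eq_1[OF _ n] p by simp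
  have "\<alpha> * (\<integral>x. \<bar>wderiv u x\<bar> powr p \<partial>unit_meas) \<le> energy p b u"
    unfolding energy_def by (rule weighted_integral_bounds(1)[OF b(1) _ U(3)]) (use b in simp)
  also have "\<dots> \<le> \<bar>l\<bar> * \<bar>mass p \<sigma> u\<bar>" unfolding E(2) by (metis abs_ge_self abs_mult)
  also have "\<dots> \<le> \<bar>l\<bar> * sh"
  proof (rule mult_left_mono)
    have "mass p \<sigma> u \<le> sh" "0 \<le> mass p \<sigma> u"
      using weighted_integral_bounds[OF \<sigma>(1) _ U(1)] \<sigma>(2) unfolding mass_def m1 by auto
    then show "\<bar>mass p \<sigma> u\<bar> \<le> sh" by simp
  qed simp
  finally show ?thesis using b(2) by (simp add: field_simps)
qed

text \<open>
  A form of Hoelder's inequality with a free parameter \<open>\<kappa>\<close>: the bound becomes small by choosing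
  first \<open>\<kappa>\<close> small and then \<open>D\<close> small in the dual exponent.
\<close>

lemma integral_wderiv_le_young:
  assumes p: "1 < p" and D: "D \<in> borel_measurable unit_meas" "AE x in unit_meas. \<bar>D x\<bar> \<le> B"
    and v: "v \<in> W01p p" "W1p_norm p v \<le> 1" and \<kappa>: "0 < \<kappa>"
  shows "\<bar>\<integral>x. D x * wderiv v x \<partial>unit_meas\<bar>
    \<le> \<kappa> powr p + (\<integral>x. \<bar>D x\<bar> powr (conj_exp p) \<partial>unit_meas) / \<kappa> powr (conj_exp p)"
proof -
  let ?q = "conj_exp p"
  note V = W01pD[OF p v(1)]
  have q: "1 < ?q" "1/p + 1/?q = 1" using p by (auto simp: conj_exp_def field_simps)
  have Di: "integrable unit_meas (\<lambda>x. \<bar>D x\<bar> powr ?q)" by (rule Lp_integrable_powr[OF bounded_Lp[OF D]]) (use q in simp)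
  have vi: "integrable unit_meas (\<lambda>x. \<bar>wderiv v x\<bar> powr p)" by (rule Lp_integrable_powr[OF V(3)])
  have i: "integrable unit_meas (\<lambda>x. D x * wderiv v x)" by (rule integrable_bounded_mult[OF V(5) D])
  have pt: "\<bar>d * w\<bar> \<le> \<kappa> powr p * \<bar>w\<bar> powr p + \<bar>d\<bar> powr ?q / \<kappa> powr ?q" for d w
  proof -
    have "\<bar>d * w\<bar> = (\<kappa> * \<bar>w\<bar>) * (\<bar>d\<bar> / \<kappa>)" using \<kappa> by (simp add: abs_mult)
    also have "\<dots> \<le> (\<kappa> * \<bar>w\<bar>) powr p / p + (\<bar>d\<bar> / \<kappa>) powr ?q / ?q"
      by (rule Youngs_inequality) (use p q \<kappa> in auto)
    also have "\<dots> \<le> (\<kappa> * \<bar>w\<bar>) powr p / 1 + (\<bar>d\<bar> / \<kappa>) powr ?q / 1"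
      using p q by (intro add_mono divide_left_mono) auto
    finally show ?thesis using \<kappa> by (simp add: powr_mult powr_divide)
  qed
  have "\<bar>\<integral>x. D x * wderiv v x \<partial>unit_meas\<bar> \<le> (\<integral>x. \<bar>D x * wderiv v x\<bar> \<partial>unit_meas)" by simp
  also have "\<dots> \<le> (\<integral>x. \<kappa> powr p * \<bar>wderiv v x\<bar> powr p + \<bar>D x\<bar> powr ?q / \<kappa> powr ?q \<partial>unit_meas)"
    by (rule integral_mono) (use i Di vi pt in auto)
  also have "\<dots> = \<kappa> powr p * (\<integral>x. \<bar>wderiv v x\<bar> powr p \<partial>unit_meas) + (\<integral>x. \<bar>D x\<bar> powr ?q \<partial>unit_meas) / \<kappa> powr ?q"
    using Di vi by simp
  also have "\<dots> \<le> \<kappa> powr p * 1 + (\<integral>x. \<bar>D x\<bar> powr ?q \<partial>unit_meas) / \<kappa> powr ?q"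
  proof (intro add_right_mono mult_left_mono)
    have "(\<integral>x. \<bar>wderiv v x\<bar> powr p \<partial>unit_meas) \<le> W1p_norm p v powr p" by (rule integral_abs_powr_le_norm(2)) (use p in simp)
    also have "\<dots> \<le> 1" using powr_mono2[of p "W1p_norm p v" 1] v(2) W1p_norm_nonneg p by simp
    finally show "(\<integral>x. \<bar>wderiv v x\<bar> powr p \<partial>unit_meas) \<le> 1" .
  qed simp
  finally show ?thesis by simp
qed

text \<open>
  Bounded gradients give a uniform Hoelder modulus, hence equicontinuity.
\<close>

lemma W01p_compact_in_C:
  assumes p: "1 < p" and u: "\<And>n::nat. u n \<in> W01p p" and X: "\<And>n. (\<integral>x. \<bar>wderiv (u n) x\<bar> powr p \<partial>unit_meas) \<le> X"
  obtains g r where "continuous_on {0..1} g" "strict_mono (r :: nat \<Rightarrow> nat)"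
    "\<And>x. 0 \<le> x \<Longrightarrow> x \<le> 1 \<Longrightarrow> (\<lambda>n. prim (wderiv (u (r n))) x) \<longlonglongrightarrow> g x"
proof -
  define Y where "Y = X powr (1/p)"
  have Y: "0 \<le> Y" by (simp add: Y_def)
  note V = W01pD[OF p u]
  have XY: "(\<integral>x. \<bar>wderiv (u n) x\<bar> powr p \<partial>unit_meas) powr (1/p) \<le> Y" for n
    unfolding Y_def using X[of n] p by (intro powr_mono2) auto
  have bd: "norm (prim (wderiv (u n)) x) \<le> Y" for n x
    using abs_prim_le[OF V(5)[of n], of x] abs_integral_le_Lp[OF p V(3)[of n]] XY[of n] by simp
  have H: "\<bar>prim (wderiv (u n)) x - prim (wderiv (u n)) y\<bar> \<le> Y * \<bar>x - y\<bar> powr ((p-1)/p)"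
    if xy: "x \<in> {0..1}" "y \<in> {0..1}" for n x y
  proof -
    have aux: "\<bar>prim (wderiv (u n)) y - prim (wderiv (u n)) x\<bar> \<le> Y * \<bar>y - x\<bar> powr ((p-1)/p)"
      if "0 \<le> x" "x < y" "y \<le> 1" for x y
    proof -
      have "\<bar>prim (wderiv (u n)) y - prim (wderiv (u n)) x\<bar> \<le> (\<integral>x. \<bar>wderiv (u n) x\<bar> powr p \<partial>unit_meas) powr (1/p) * (y - x) powr ((p-1)/p)"
        by (rule prim_Hoelder[OF p V(3) that])
      also have "\<dots> \<le> Y * (y - x) powr ((p-1)/p)" using XY by (intro mult_right_mono) auto
      finally show ?thesis using that by simp
    qed
    consider "x < y" | "x = y" | "y < x" by linarith
    then show ?thesis
      by cases (use aux[of x y] aux[of y x] xy Y in \<open>auto simp: abs_minus_commute\<close>)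
  qed
  have equi: "\<exists>d>0. \<forall>n y. y \<in> {0..1} \<and> norm (x - y) < d \<longrightarrow> norm (prim (wderiv (u n)) x - prim (wderiv (u n)) y) < e"
    if x: "x \<in> {0..1}" and e: "0 < e" for x e
  proof -
    let ?s = "(p-1)/p"
    have s: "0 < ?s" using p by simp
    define d where "d = (e / (Y + 1)) powr (1 / ?s)"
    have d: "0 < d" using e Y by (simp add: d_def)
    have ds: "d powr ?s = e / (Y + 1)" using e Y s p by (simp add: d_def powr_powr)
    show ?thesis
    proof (intro exI[of _ d] conjI d allI impI, elim conjE)
      fix n y assume y: "y \<in> {0..1}" and xy: "norm (x - y) < d"
      have "norm (prim (wderiv (u n)) x - prim (wderiv (u n)) y) \<le> Y * \<bar>x - y\<bar> powr ?s"
        using H[OF x y] by simp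
      also have "\<dots> \<le> Y * d powr ?s" using Y xy s by (intro mult_left_mono powr_mono2) auto
      also have "\<dots> = Y / (Y + 1) * e" unfolding ds by simp
      also have "\<dots> < 1 * e" using Y e by (intro mult_strict_right_mono) auto
      finally show "norm (prim (wderiv (u n)) x - prim (wderiv (u n)) y) < e" by simp
    qed
  qed
  obtain g r where g: "continuous_on {0..1} g" "strict_mono (r :: nat \<Rightarrow> nat)"
    and conv: "\<And>e. 0 < e \<Longrightarrow> \<exists>N. \<forall>n x. n \<ge> N \<and> x \<in> {0..1} \<longrightarrow> norm (prim (wderiv (u (r n))) x - g x) < e"
    using Arzela_Ascoli[of "{0..1::real}" "\<lambda>n. prim (wderiv (u n))" Y] bd equi by (metis compact_Icc)
  show ?thesis
  proof (rule that[OF g])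
    fix x :: real assume x: "0 \<le> x" "x \<le> 1"
    show "(\<lambda>n. prim (wderiv (u (r n))) x) \<longlonglongrightarrow> g x"
      unfolding LIMSEQ_iff
    proof (intro allI impI)
      fix e :: real assume "0 < e"
      then show "\<exists>no. \<forall>n\<ge>no. norm (prim (wderiv (u (r n))) x - g x) < e" using conv[of e] x by force
    qed
  qed
qed

text \<open>
  Near 0 a positive sequence can only be met at late indices, since the early terms are finitely
  many positive numbers. This turns a limit along a sequence into a limit along all
  \<open>\<epsilon>\<close>.
\<close>

lemma eventually_at_right_range:
  fixes e :: "nat \<Rightarrow> real"
  assumes e: "\<And>n. 0 < e n"
  shows "eventually (\<lambda>\<epsilon>. \<forall>n. \<epsilon> = e n \<longrightarrow> N \<le> n) (at_right 0)"
proof -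
  define b where "b = Min (insert 1 (e ` {..<N}))"
  have b: "0 < b" unfolding b_def using e by (subst Min_gr_iff) auto
  have "\<forall>n. \<epsilon> = e n \<longrightarrow> N \<le> n" if "\<epsilon> < b" for \<epsilon>
  proof (intro allI impI, rule ccontr)
    fix n assume "\<epsilon> = e n" "\<not> N \<le> n"
    then have "b \<le> \<epsilon>" unfolding b_def by (intro Min_le) auto
    then show False using that by simp
  qed
  then show ?thesis unfolding eventually_at_right_field using b by blast
qed

text \<open>
  G-convergence speaks about families indexed by all \<open>\<epsilon> > 0\<close>, whereas compactness selects a
  sequence. The family used here consists of the eigenfunctions on the range of the selected sequence
  and of solutions with the limit right-hand side elsewhere.
\<close>

lemma eigenfunctions_converge:
  fixes a_eps \<rho>_eps u :: "real \<Rightarrow> real \<Rightarrow> real" and l :: "real \<Rightarrow> real" and e :: "nat \<Rightarrow> real"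
  assumes p: "1 < p" and \<alpha>: "0 < \<alpha>" and sl: "0 < sl"
    and ae: "\<And>\<epsilon>. 0 < \<epsilon> \<Longrightarrow> bounded_between \<alpha> \<beta> (a_eps \<epsilon>)" and a: "bounded_between \<alpha> \<beta> a"
    and \<rho>e: "\<And>\<epsilon>. 0 < \<epsilon> \<Longrightarrow> bounded_between sl sh (\<rho>_eps \<epsilon>)" and \<rho>: "bounded_between sl sh \<rho>"
    and G: "G_converges p a_eps a" and w: "weak_star_conv_Linf \<rho>_eps \<rho> (at_right 0)"
    and ef: "\<And>\<epsilon>. 0 < \<epsilon> \<Longrightarrow> eigenfunction p (a_eps \<epsilon>) (\<rho>_eps \<epsilon>) (ereal (l \<epsilon>)) (u \<epsilon>)"
    and nm: "\<And>\<epsilon>. 0 < \<epsilon> \<Longrightarrow> Lp_norm p (u \<epsilon>) = 1"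
    and e: "\<And>n. 0 < e n" "e \<longlonglongrightarrow> 0" and lim: "(\<lambda>n. l (e n)) \<longlonglongrightarrow> L"
  obtains r u0 where "strict_mono r" "eigenfunction p a \<rho> (ereal L) u0"
    "weak_conv_W01p p (\<lambda>n. u (e (r n))) u0 sequentially"
proof -
  have ss: "0 \<le> sh" using bounded_between_le[OF \<rho>] sl by linarith
  obtain Lb where Lb: "\<And>n. \<bar>l (e n)\<bar> \<le> Lb"
    using convergent_imp_Bseq[OF convergentI[OF lim]] unfolding Bseq_def by auto
  have Lb0: "0 \<le> Lb" using Lb[of 0] by linarith
  have uW: "u \<epsilon> \<in> W01p p" if "0 < \<epsilon>" for \<epsilon> by (rule eigenfunction_energy(1)[OF p ef[OF that]])
  have X: "(\<integral>x. \<bar>wderiv (u (e n)) x\<bar> powr p \<partial>unit_meas) \<le> Lb * sh / \<alpha>" for n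
  proof -
    have "(\<integral>x. \<bar>wderiv (u (e n)) x\<bar> powr p \<partial>unit_meas) \<le> \<bar>l (e n)\<bar> * sh / \<alpha>"
      by (rule normalized_eigenfunction_bounds[OF p ae[OF e(1)] \<alpha> \<rho>e[OF e(1)] sl ef[OF e(1)] nm[OF e(1)]])
    also have "\<dots> \<le> Lb * sh / \<alpha>" using Lb[of n] ss \<alpha> by (intro divide_right_mono mult_right_mono) auto
    finally show ?thesis .
  qed
  obtain g r where gc: "continuous_on {0..1} g" and r: "strict_mono (r :: nat \<Rightarrow> nat)"
    and gl: "\<And>x. 0 \<le> x \<Longrightarrow> x \<le> 1 \<Longrightarrow> (\<lambda>n. prim (wderiv (u (e (r n)))) x) \<longlonglongrightarrow> g x"
    by (rule W01p_compact_in_C[where u = "\<lambda>n. u (e n)", OF p uW[OF e(1)] X]) blast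
  define \<epsilon> where "\<epsilon> n = e (r n)" for n
  have \<epsilon>p: "0 < \<epsilon> n" for n by (simp add: \<epsilon>_def e)
  have \<epsilon>0: "\<epsilon> \<longlonglongrightarrow> 0" using LIMSEQ_subseq_LIMSEQ[OF e(2) r] by (simp add: \<epsilon>_def[abs_def] comp_def)
  have \<epsilon>f: "filterlim \<epsilon> (at_right 0) sequentially"
    unfolding filterlim_at using \<epsilon>0 \<epsilon>p less_imp_neq[OF \<epsilon>p, symmetric] by (auto intro!: always_eventually)
  have ll: "(\<lambda>n. l (\<epsilon> n)) \<longlonglongrightarrow> L" using LIMSEQ_subseq_LIMSEQ[OF lim r] by (simp add: \<epsilon>_def[abs_def] comp_def)
  define f where "f n = prim (wderiv (u (\<epsilon> n)))" for n
  have fl: "(\<lambda>n. f n x) \<longlonglongrightarrow> g x" if "0 \<le> x" "x \<le> 1" for x using gl[OF that] by (simp add: f_def \<epsilon>_def)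
  have fAE: "AE x in unit_meas. u (\<epsilon> n) x = f n x" for n unfolding f_def by (rule W01pD(7)[OF p uW[OF \<epsilon>p]])
  have um [measurable]: "u (\<epsilon> n) \<in> borel_measurable unit_meas" for n using W01pD(4)[OF p uW[OF \<epsilon>p]] by simp
  have fm [measurable]: "f n \<in> borel_measurable unit_meas" for n unfolding f_def by (rule prim_measurable[OF W01pD(5)[OF p uW[OF \<epsilon>p]]])
  define Y where "Y = (Lb * sh / \<alpha>) powr (1/p)"
  have fB: "\<bar>f n x\<bar> \<le> Y" for n x
  proof -
    note V = W01pD[OF p uW[OF \<epsilon>p[of n]]]
    have "\<bar>f n x\<bar> \<le> (\<integral>x. \<bar>wderiv (u (\<epsilon> n)) x\<bar> powr p \<partial>unit_meas) powr (1/p)"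
      unfolding f_def using abs_prim_le[OF V(5), of x] abs_integral_le_Lp[OF p V(3)] by linarith
    also have "\<dots> \<le> Y" unfolding Y_def using X[of "r n"] p by (intro powr_mono2) (auto simp: \<epsilon>_def)
    finally show ?thesis .
  qed
  have Y0: "0 \<le> Y" by (simp add: Y_def)
  have gB: "\<bar>g x\<bar> \<le> Y" if "0 \<le> x" "x \<le> 1" for x
    by (rule LIMSEQ_le_const2[OF tendsto_rabs[OF fl[OF that]]]) (use fB in auto)
  have gm [measurable]: "g \<in> borel_measurable unit_meas"
    by (rule continuous_imp_measurable_on_sets_lebesgue[OF continuous_on_subset[OF gc]]) auto
  define P where "P = p - 1"
  have P: "0 < P" using p by (simp add: P_def)
  define K where "K = Y powr P"
  have K0: "0 \<le> K" by (simp add: K_def)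
  have sK: "\<bar>signed_powr P t\<bar> \<le> K" if "\<bar>t\<bar> \<le> Y" for t
    unfolding abs_signed_powr K_def using that P by (intro powr_mono2) auto
  note spm = signed_powr_measurable[OF P]
  define kn where "kn n x = l (\<epsilon> n) * (\<rho>_eps (\<epsilon> n) x * signed_powr P (u (\<epsilon> n) x))" for n x
  define kk where "kk x = L * (\<rho> x * signed_powr P (g x))" for x
  have rm [measurable]: "\<rho>_eps (\<epsilon> n) \<in> borel_measurable unit_meas" for n by (rule bounded_between_measurable[OF \<rho>e[OF \<epsilon>p]])
  have rm' [measurable]: "\<rho> \<in> borel_measurable unit_meas" by (rule bounded_between_measurable[OF \<rho>])
  have rb: "AE x in unit_meas. \<bar>\<rho>_eps (\<epsilon> n) x\<bar> \<le> sh" for n by (rule bounded_between_abs[OF \<rho>e[OF \<epsilon>p]]) (use sl in simp)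
  have rb': "AE x in unit_meas. \<bar>\<rho> x\<bar> \<le> sh" by (rule bounded_between_abs[OF \<rho>]) (use sl in simp)
  have [measurable]: "(\<lambda>x. signed_powr P (u (\<epsilon> n) x)) \<in> borel_measurable unit_meas" "(\<lambda>x. signed_powr P (f n x)) \<in> borel_measurable unit_meas"
    "(\<lambda>x. signed_powr P (g x)) \<in> borel_measurable unit_meas" for n by (intro spm um fm gm)+
  have knm [measurable]: "kn n \<in> borel_measurable unit_meas" for n unfolding kn_def[abs_def] by measurable
  have kkm [measurable]: "kk \<in> borel_measurable unit_meas" unfolding kk_def[abs_def] by measurable
  have lb: "\<bar>l (\<epsilon> n)\<bar> \<le> Lb" for n using Lb by (simp add: \<epsilon>_def)
  have Lle: "\<bar>L\<bar> \<le> Lb" by (rule LIMSEQ_le_const2[OF tendsto_rabs[OF lim]]) (use Lb in auto)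
  define H where "H = Lb * (sh * K)"
  have knB: "AE x in unit_meas. \<bar>kn n x\<bar> \<le> H" for n
    using rb[of n] fAE[of n]
  proof eventually_elim
    case (elim x)
    then show ?case unfolding kn_def H_def abs_mult using lb[of n] sK[OF fB[of n x]] Lb0 ss K0
      by (intro mult_mono) auto
  qed
  have A01: "AE x in unit_meas. 0 < x \<and> x < (1::real)" by (rule AE_unitI) auto
  have kkB: "AE x in unit_meas. \<bar>kk x\<bar> \<le> H"
    using rb' A01
  proof eventually_elim
    case (elim x)
    then have "\<bar>signed_powr P (g x)\<bar> \<le> K" by (intro sK gB) auto
    then show ?case unfolding kk_def H_def abs_mult using elim Lle Lb0 ss K0 by (intro mult_mono) auto
  qed
  define f0 where "f0 v = (\<integral>x. kk x * v x \<partial>unit_meas)" for v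
  define F where "F \<epsilon>' v = l \<epsilon>' * (\<integral>x. \<rho>_eps \<epsilon>' x * (\<bar>u \<epsilon>' x\<bar> powr (p - 2) * u \<epsilon>' x) * v x \<partial>unit_meas)" for \<epsilon>' v
  have f0d: "f0 \<in> W_dual p" unfolding f0_def[abs_def] by (rule integral_in_dual[OF p kkm kkB])
  have Fk: "F (\<epsilon> n) = (\<lambda>v. \<integral>x. kn n x * v x \<partial>unit_meas)" for n
    unfolding F_def[abs_def] kn_def abs_powr_mult_eq_signed_powr P_def by (simp add: mult.assoc)
  have Fd: "F (\<epsilon> n) \<in> W_dual p" for n unfolding Fk by (rule integral_in_dual[OF p knm knB])
  have ws: "weak_solution p (a_eps \<epsilon>') (F \<epsilon>') (u \<epsilon>')" if "0 < \<epsilon>'" for \<epsilon>'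
    using ef[OF that] unfolding F_def[abs_def] by (simp add: eigenfunction_def)
  \<comment> \<open>In terms of gradients the limit functional is given by a bounded flux, so it has solutions.\<close>
  have \<xi>m: "(\<lambda>x. - prim kk x) \<in> borel_measurable unit_meas" using prim_measurable[OF bounded_integrable_unit[OF kkm kkB]] by simp
  have \<xi>B: "AE x in unit_meas. \<bar>- prim kk x\<bar> \<le> H" using abs_prim_le_bound[OF kkm kkB] by simp
  have f0\<xi>: "f0 v = (\<integral>x. - prim kk x * wderiv v x \<partial>unit_meas)" if "v \<in> W01p p" for v
    unfolding f0_def using W01p_integral_by_parts[OF p kkm kkB that] by simp
  have sol: "\<exists>w. weak_solution p b f0 w" if b: "bounded_between \<alpha> \<beta> b" for b
  proof -
    obtain w where "weak_solution p b (\<lambda>v. \<integral>x. - prim kk x * wderiv v x \<partial>unit_meas) w"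
      using exists_weak_solution[OF p \<alpha> b \<xi>m \<xi>B] by blast
    then show ?thesis by (auto simp: weak_solution_def f0\<xi>)
  qed
  obtain u0 where u0: "weak_solution p a f0 u0" using sol[OF a] by blast
  \<comment> \<open>Right-hand sides and solutions indexed by all positive parameters.\<close>
  define fs where "fs \<epsilon>' = (if \<epsilon>' \<in> range \<epsilon> then F \<epsilon>' else f0)" for \<epsilon>'
  define us where "us \<epsilon>' = (if \<epsilon>' \<in> range \<epsilon> then u \<epsilon>' else (SOME w. weak_solution p (a_eps \<epsilon>') f0 w))" for \<epsilon>'
  have fsd: "fs \<epsilon>' \<in> W_dual p" for \<epsilon>' using Fd f0d by (auto simp: fs_def)
  have uss: "weak_solution p (a_eps \<epsilon>') (fs \<epsilon>') (us \<epsilon>')" if "0 < \<epsilon>'" for \<epsilon>'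
    using ws[OF that] someI_ex[OF sol[OF ae[OF that]]] by (simp add: fs_def us_def)
  \<comment> \<open>Integration by parts expresses the difference of the functionals through primitives, which converge pointwise and boundedly.\<close>
  define D where "D n x = prim (kn n) x - prim kk x" for n x
  have kni: "integrable unit_meas (kn n)" for n by (rule bounded_integrable_unit[OF knm knB])
  have kki: "integrable unit_meas kk" by (rule bounded_integrable_unit[OF kkm kkB])
  have Dm: "D n \<in> borel_measurable unit_meas" for n unfolding D_def[abs_def] using prim_measurable[OF kni] prim_measurable[OF kki] by simp
  have DB: "\<bar>D n x\<bar> \<le> 2 * H" for n x
    unfolding D_def using abs_prim_le_bound[OF knm knB, of n x] abs_prim_le_bound[OF kkm kkB, of x] by linarith
  have D0: "(\<lambda>n. D n x) \<longlonglongrightarrow> 0" for x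
  proof -
    let ?i = "indicat_real {..x}"
    have ri: "integrable unit_meas (\<lambda>t. \<rho>_eps (\<epsilon> n) t * (?i t * s t))" if "s \<in> borel_measurable unit_meas" "AE t in unit_meas. \<bar>s t\<bar> \<le> K" for s n
    proof -
      have "integrable unit_meas (\<lambda>t. \<rho>_eps (\<epsilon> n) t * s t)"
        by (rule integrable_bounded_mult[OF bounded_integrable_unit[OF that] rm rb])
      from integrable_indicator_mult_unit[OF this, of x] show ?thesis by (simp add: mult.left_commute)
    qed
    have gAE: "AE t in unit_meas. \<bar>signed_powr P (g t)\<bar> \<le> K" by (rule AE_unitI) (auto intro!: sK gB)
    have fAE': "AE t in unit_meas. \<bar>signed_powr P (f n t)\<bar> \<le> K" for n by (auto intro!: sK fB)
    have "(\<lambda>n. \<integral>t. \<bar>signed_powr P (f n t) - signed_powr P (g t)\<bar> \<partial>unit_meas) \<longlonglongrightarrow> (\<integral>t. 0 \<partial>unit_meas)"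
    proof (rule integral_dominated_convergence[where w = "\<lambda>t. 2 * K"])
      show "AE t in unit_meas. (\<lambda>n. \<bar>signed_powr P (f n t) - signed_powr P (g t)\<bar>) \<longlonglongrightarrow> 0"
      proof (rule AE_unitI)
        fix t :: real assume "0 < t" "t < 1"
        then have "(\<lambda>n. \<bar>signed_powr P (f n t) - signed_powr P (g t)\<bar>) \<longlonglongrightarrow> \<bar>signed_powr P (g t) - signed_powr P (g t)\<bar>"
          by (intro tendsto_intros tendsto_signed_powr[OF P] fl) auto
        then show "(\<lambda>n. \<bar>signed_powr P (f n t) - signed_powr P (g t)\<bar>) \<longlonglongrightarrow> 0" by simp
      qed
      show "AE t in unit_meas. norm \<bar>signed_powr P (f n t) - signed_powr P (g t)\<bar> \<le> 2 * K" for n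
        using gAE fAE'[of n] by eventually_elim auto
    qed simp_all
    then have sl1: "(\<lambda>n. sh * (\<integral>t. \<bar>signed_powr P (f n t) - signed_powr P (g t)\<bar> \<partial>unit_meas)) \<longlonglongrightarrow> 0"
      using tendsto_mult_right_zero by fastforce
    define A where "A n = (\<integral>t. \<rho>_eps (\<epsilon> n) t * (?i t * signed_powr P (f n t)) \<partial>unit_meas)" for n
    define B where "B n = (\<integral>t. \<rho>_eps (\<epsilon> n) t * (?i t * signed_powr P (g t)) \<partial>unit_meas)" for n
    have "(\<lambda>n. A n - B n) \<longlonglongrightarrow> 0"
    proof (rule Lim_null_comparison[OF _ sl1], rule always_eventually, rule allI)
      fix n
      have AB: "A n - B n = (\<integral>t. \<rho>_eps (\<epsilon> n) t * (?i t * signed_powr P (f n t)) - \<rho>_eps (\<epsilon> n) t * (?i t * signed_powr P (g t)) \<partial>unit_meas)"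
        unfolding A_def B_def using ri[OF _ fAE'] ri[OF _ gAE] by (intro Bochner_Integration.integral_diff[symmetric]) auto
      have "\<bar>A n - B n\<bar> \<le> (\<integral>t. \<bar>\<rho>_eps (\<epsilon> n) t * (?i t * signed_powr P (f n t)) - \<rho>_eps (\<epsilon> n) t * (?i t * signed_powr P (g t))\<bar> \<partial>unit_meas)"
        unfolding AB by (rule integral_abs_bound)
      also have "\<dots> \<le> (\<integral>t. sh * \<bar>signed_powr P (f n t) - signed_powr P (g t)\<bar> \<partial>unit_meas)"
      proof (rule integral_mono_AE)
        show "AE t in unit_meas. \<bar>\<rho>_eps (\<epsilon> n) t * (?i t * signed_powr P (f n t)) - \<rho>_eps (\<epsilon> n) t * (?i t * signed_powr P (g t))\<bar> \<le> sh * \<bar>signed_powr P (f n t) - signed_powr P (g t)\<bar>"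
          using rb[of n]
        proof eventually_elim
          case (elim t)
          have "\<bar>\<rho>_eps (\<epsilon> n) t * (?i t * signed_powr P (f n t)) - \<rho>_eps (\<epsilon> n) t * (?i t * signed_powr P (g t))\<bar> = \<bar>\<rho>_eps (\<epsilon> n) t\<bar> * (?i t * \<bar>signed_powr P (f n t) - signed_powr P (g t)\<bar>)"
          proof -
            have "\<bar>c * (i * a) - c * (i * b)\<bar> = \<bar>c\<bar> * (i * \<bar>a - b\<bar>)" if "0 \<le> i" for c i a b :: real
            proof -
              have "c * (i * a) - c * (i * b) = c * (i * (a - b))" by (simp only: right_diff_distrib)
              then show ?thesis using that by (simp only: abs_mult abs_of_nonneg)
            qed
            note * = this
            show ?thesis by (rule *) (simp add: indicator_def)
          qed
          also have "\<dots> \<le> sh * (1 * \<bar>signed_powr P (f n t) - signed_powr P (g t)\<bar>)"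
            using elim ss by (intro mult_mono) (auto simp: indicator_def)
          finally show ?case by simp
        qed
        show "integrable unit_meas (\<lambda>t. \<bar>\<rho>_eps (\<epsilon> n) t * (?i t * signed_powr P (f n t)) - \<rho>_eps (\<epsilon> n) t * (?i t * signed_powr P (g t))\<bar>)"
          using ri[OF _ fAE'] ri[OF _ gAE] by (intro integrable_abs Bochner_Integration.integrable_diff) auto
        show "integrable unit_meas (\<lambda>t. sh * \<bar>signed_powr P (f n t) - signed_powr P (g t)\<bar>)"
          using bounded_integrable_unit[OF _ fAE'] bounded_integrable_unit[OF _ gAE]
          by (intro integrable_mult_right integrable_abs Bochner_Integration.integrable_diff) auto
      qed
      finally show "norm (A n - B n) \<le> sh * (\<integral>t. \<bar>signed_powr P (f n t) - signed_powr P (g t)\<bar> \<partial>unit_meas)" by simp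
    qed
    moreover have "B \<longlonglongrightarrow> (\<integral>t. \<rho> t * (?i t * signed_powr P (g t)) \<partial>unit_meas)"
    proof -
      have "(\<lambda>t. ?i t * signed_powr P (g t)) \<in> Lp_space 1"
      proof (rule bounded_Lp[of _ K])
        show "(\<lambda>t. ?i t * signed_powr P (g t)) \<in> borel_measurable unit_meas" by measurable
        show "AE t in unit_meas. \<bar>?i t * signed_powr P (g t)\<bar> \<le> K"
          using gAE by eventually_elim (use K0 in \<open>auto simp: indicator_def\<close>)
      qed simp
      then have "((\<lambda>\<epsilon>. \<integral>t. \<rho>_eps \<epsilon> t * (?i t * signed_powr P (g t)) \<partial>unit_meas) \<longlongrightarrow> (\<integral>t. \<rho> t * (?i t * signed_powr P (g t)) \<partial>unit_meas)) (at_right 0)"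
        using w by (simp add: weak_star_conv_Linf_def)
      from filterlim_compose[OF this \<epsilon>f] show ?thesis by (simp add: B_def[abs_def])
    qed
    ultimately have "(\<lambda>n. (A n - B n) + B n) \<longlonglongrightarrow> 0 + (\<integral>t. \<rho> t * (?i t * signed_powr P (g t)) \<partial>unit_meas)" by (rule tendsto_add)
    then have "(\<lambda>n. l (\<epsilon> n) * A n) \<longlonglongrightarrow> L * (\<integral>t. \<rho> t * (?i t * signed_powr P (g t)) \<partial>unit_meas)"
      using tendsto_mult[OF ll] by simp
    moreover have "l (\<epsilon> n) * A n = prim (kn n) x" for n
    proof -
      have "prim (kn n) x = (\<integral>t. l (\<epsilon> n) * (\<rho>_eps (\<epsilon> n) t * (?i t * signed_powr P (f n t))) \<partial>unit_meas)"
        unfolding prim_def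
      proof (rule integral_cong_AE)
        show "AE t in unit_meas. ?i t * kn n t = l (\<epsilon> n) * (\<rho>_eps (\<epsilon> n) t * (?i t * signed_powr P (f n t)))"
          using fAE[of n] by eventually_elim (simp add: kn_def)
      qed measurable
      then show ?thesis by (simp add: A_def)
    qed
    moreover have "L * (\<integral>t. \<rho> t * (?i t * signed_powr P (g t)) \<partial>unit_meas) = prim kk x"
    proof -
      have "prim kk x = (\<integral>t. L * (\<rho> t * (?i t * signed_powr P (g t))) \<partial>unit_meas)"
        unfolding prim_def kk_def by (intro Bochner_Integration.integral_cong) (auto simp: mult_ac)
      then show ?thesis by simp
    qed
    ultimately have "(\<lambda>n. prim (kn n) x) \<longlonglongrightarrow> prim kk x" by simp
    from tendsto_diff[OF this tendsto_const[of "prim kk x"]] show ?thesis by (simp add: D_def)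
  qed
  define q where "q = conj_exp p"
  have q: "1 < q" using conj_exp_gt_1[OF p] by (simp add: q_def)
  define I where "I n = (\<integral>x. \<bar>D n x\<bar> powr q \<partial>unit_meas)" for n
  have I0: "I \<longlonglongrightarrow> 0"
  proof -
    have "I \<longlonglongrightarrow> (\<integral>x. 0 \<partial>unit_meas)" unfolding I_def[abs_def]
    proof (rule integral_dominated_convergence[where w = "\<lambda>x. (2 * H) powr q"])
      show "AE x in unit_meas. (\<lambda>n. \<bar>D n x\<bar> powr q) \<longlonglongrightarrow> 0"
        using q tendsto_rabs_zero[OF D0] by (intro AE_I2 tendsto_0_powr) auto
      show "AE x in unit_meas. norm (\<bar>D n x\<bar> powr q) \<le> (2 * H) powr q" for n
        using DB q by (intro AE_I2) (auto intro!: powr_mono2)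
    qed (use Dm in measurable)
    then show ?thesis by simp
  qed
  have dn: "0 \<le> dual_norm (W01p p) (W1p_norm p) (\<lambda>v. F (\<epsilon> n) v - f0 v)"
    "dual_norm (W01p p) (W1p_norm p) (\<lambda>v. F (\<epsilon> n) v - f0 v) \<le> \<kappa> powr p + I n / \<kappa> powr q"
    if \<kappa>: "0 < \<kappa>" for n \<kappa>
  proof -
    have "\<bar>F (\<epsilon> n) v - f0 v\<bar> \<le> \<kappa> powr p + I n / \<kappa> powr q" if v: "v \<in> W01p p" "W1p_norm p v \<le> 1" for v
    proof -
      note vi = W01pD(5)[OF p v(1)]
      have i1: "integrable unit_meas (\<lambda>x. prim (kn n) x * wderiv v x)"
        using abs_prim_le_bound[OF knm knB] by (intro integrable_bounded_mult[where B = H, OF vi prim_measurable[OF kni]]) auto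
      have i2: "integrable unit_meas (\<lambda>x. prim kk x * wderiv v x)"
        using abs_prim_le_bound[OF kkm kkB] by (intro integrable_bounded_mult[where B = H, OF vi prim_measurable[OF kki]]) auto
      have "F (\<epsilon> n) v - f0 v = - (\<integral>x. D n x * wderiv v x \<partial>unit_meas)"
        unfolding Fk f0_def W01p_integral_by_parts[OF p knm knB v(1)] W01p_integral_by_parts[OF p kkm kkB v(1)] D_def
        using i1 i2 by (simp add: left_diff_distrib)
      moreover have "AE x in unit_meas. \<bar>D n x\<bar> \<le> 2 * H" using DB by simp
      ultimately show ?thesis
        using integral_wderiv_le_young[OF p Dm _ v \<kappa>] by (simp add: I_def q_def)
    qed
    note bound = this
    show "0 \<le> dual_norm (W01p p) (W1p_norm p) (\<lambda>v. F (\<epsilon> n) v - f0 v)"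
      by (rule dual_norm_bounds(1)[OF p]) (rule bound)
    show "dual_norm (W01p p) (W1p_norm p) (\<lambda>v. F (\<epsilon> n) v - f0 v) \<le> \<kappa> powr p + I n / \<kappa> powr q"
      by (rule dual_norm_bounds(2)[OF p]) (rule bound)
  qed
  have zz: "dual_norm (W01p p) (W1p_norm p) (\<lambda>v. f0 v - f0 v) = 0"
    using dual_norm_bounds[OF p, of "\<lambda>v. f0 v - f0 v" 0] by (simp add: antisym)
  have strong: "strong_conv_W_dual p fs f0 (at_right 0)"
    unfolding strong_conv_W_dual_def
  proof (rule tendstoI)
    fix \<tau> :: real assume \<tau>: "0 < \<tau>"
    \<comment> \<open>Half of \<open>\<tau>\<close> is spent on \<open>\<kappa> powr p\<close>, the other half on the integral of the primitives.\<close>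
    define \<kappa> where "\<kappa> = (\<tau> / 2) powr (1/p)"
    have \<kappa>: "0 < \<kappa>" using \<tau> by (simp add: \<kappa>_def)
    have \<kappa>p: "\<kappa> powr p = \<tau> / 2" using \<tau> p by (simp add: \<kappa>_def powr_powr)
    have "(\<lambda>n. I n / \<kappa> powr q) \<longlonglongrightarrow> 0 / \<kappa> powr q" using \<kappa> by (intro tendsto_intros I0) auto
    then have "eventually (\<lambda>n. I n / \<kappa> powr q < \<tau> / 2) sequentially" using \<tau> by (intro order_tendstoD(2)) auto
    then obtain N where N: "\<And>n. N \<le> n \<Longrightarrow> I n / \<kappa> powr q < \<tau> / 2" by (auto simp: eventually_sequentially)
    show "eventually (\<lambda>\<epsilon>'. dist (dual_norm (W01p p) (W1p_norm p) (\<lambda>v. fs \<epsilon>' v - f0 v)) 0 < \<tau>) (at_right 0)"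
      using eventually_at_right_range[of \<epsilon> N, OF \<epsilon>p]
    proof eventually_elim
      case (elim \<epsilon>')
      show ?case
      proof (cases "\<epsilon>' \<in> range \<epsilon>")
        case True
        then obtain n where n: "\<epsilon>' = \<epsilon> n" by blast
        then have "N \<le> n" using elim by blast
        have "fs \<epsilon>' = F (\<epsilon> n)" using n by (simp add: fs_def)
        moreover have "dual_norm (W01p p) (W1p_norm p) (\<lambda>v. F (\<epsilon> n) v - f0 v) < \<tau>"
          using dn(2)[OF \<kappa>, of n] N[OF \<open>N \<le> n\<close>] \<kappa>p by linarith
        ultimately show ?thesis using dn(1)[OF \<kappa>, of n] by (simp add: dist_real_def)
      next
        case False
        then show ?thesis using zz \<tau> by (simp add: fs_def)
      qed
    qed
  qed
  have conv: "weak_conv_W01p p us u0 (at_right 0)"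
    using G[unfolded G_converges_def, rule_format, of f0 fs us u0] f0d fsd strong uss u0 by blast
  have conv_seq: "weak_conv_W01p p (\<lambda>n. u (\<epsilon> n)) u0 sequentially"
    unfolding weak_conv_def
  proof (intro conjI ballI)
    show "u0 \<in> W01p p" using conv by (simp add: weak_conv_def)
    show "eventually (\<lambda>n. u (\<epsilon> n) \<in> W01p p) sequentially" using uW[OF \<epsilon>p] by simp
    fix h assume "h \<in> W_dual p"
    from filterlim_compose[OF weak_convD[OF conv this] \<epsilon>f]
    show "(\<lambda>n. h (u (\<epsilon> n))) \<longlonglongrightarrow> h u0" by (simp add: us_def)
  qed
  have u0W: "u0 \<in> W01p p" using u0 by (simp add: weak_solution_def)
  note U0 = W01pD[OF p u0W]
  have "prim (wderiv u0) x = g x" if "0 \<le> x" "x \<le> 1" for x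
    using LIMSEQ_unique[OF weak_convD[OF conv_seq evaluation_in_dual[OF p, of x]]] fl[OF that] by (simp add: f_def)
  then have "AE x in unit_meas. prim (wderiv u0) x = g x" by (intro AE_unitI) auto
  then have u0g: "AE x in unit_meas. u0 x = g x" using U0(7) by eventually_elim simp
  have u0m [measurable]: "u0 \<in> borel_measurable unit_meas" using U0(4) by simp
  have g1: "(\<integral>x. \<bar>g x\<bar> powr p \<partial>unit_meas) = 1"
  proof -
    have "(\<lambda>n. \<integral>x. \<bar>f n x\<bar> powr p \<partial>unit_meas) \<longlonglongrightarrow> (\<integral>x. \<bar>g x\<bar> powr p \<partial>unit_meas)"
    proof (rule integral_dominated_convergence[where w = "\<lambda>x. Y powr p"])
      show "AE x in unit_meas. (\<lambda>n. \<bar>f n x\<bar> powr p) \<longlonglongrightarrow> \<bar>g x\<bar> powr p"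
        by (rule AE_unitI) (use p in \<open>auto intro!: tendsto_powr' tendsto_rabs fl\<close>)
      show "AE x in unit_meas. norm (\<bar>f n x\<bar> powr p) \<le> Y powr p" for n
        using fB p by (intro AE_I2) (auto intro!: powr_mono2)
    qed simp_all
    moreover have "(\<integral>x. \<bar>f n x\<bar> powr p \<partial>unit_meas) = 1" for n
      using integral_abs_powr_cong[OF fAE um fm, of n p] Lp_norm_eq_1[OF _ nm[OF \<epsilon>p]] p by simp
    ultimately show ?thesis using LIMSEQ_unique[OF tendsto_const] by fastforce
  qed
  have nz: "\<not> (AE x in unit_meas. u0 x = 0)"
  proof
    assume "AE x in unit_meas. u0 x = 0"
    with u0g have "AE x in unit_meas. g x = 0" by eventually_elim simp
    then have "(\<integral>x. \<bar>g x\<bar> powr p \<partial>unit_meas) = (\<integral>x. \<bar>0\<bar> powr p \<partial>unit_meas)"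
      by (rule integral_abs_powr_cong) auto
    then show False using g1 by simp
  qed
  have "weak_solution p a (\<lambda>v. L * (\<integral>x. \<rho> x * (\<bar>u0 x\<bar> powr (p - 2) * u0 x) * v x \<partial>unit_meas)) u0"
    unfolding weak_solution_def
  proof (intro conjI ballI u0W)
    fix v assume v: "v \<in> W01p p"
    have [measurable]: "v \<in> borel_measurable unit_meas" using W01pD(4)[OF p v] by simp
    have [measurable]: "(\<lambda>x. signed_powr P (u0 x)) \<in> borel_measurable unit_meas" by (rule spm[OF u0m])
    have "(\<integral>x. flux p a u0 x * wderiv v x \<partial>unit_meas) = (\<integral>x. kk x * v x \<partial>unit_meas)"
      using u0 v by (simp add: weak_solution_def f0_def)
    also have "\<dots> = (\<integral>x. L * (\<rho> x * signed_powr P (u0 x) * v x) \<partial>unit_meas)"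
    proof (rule integral_cong_AE)
      show "AE x in unit_meas. kk x * v x = L * (\<rho> x * signed_powr P (u0 x) * v x)"
        using u0g by eventually_elim (simp add: kk_def)
    qed measurable
    also have "\<dots> = L * (\<integral>x. \<rho> x * (\<bar>u0 x\<bar> powr (p - 2) * u0 x) * v x \<partial>unit_meas)"
      by (simp add: abs_powr_mult_eq_signed_powr P_def)
    finally show "(\<integral>x. flux p a u0 x * wderiv v x \<partial>unit_meas) = L * (\<integral>x. \<rho> x * (\<bar>u0 x\<bar> powr (p - 2) * u0 x) * v x \<partial>unit_meas)" .
  qed
  then have "eigenfunction p a \<rho> (ereal L) u0" using nz by (simp add: eigenfunction_def)
  then show ?thesis using that[OF r] conv_seq by (simp add: \<epsilon>_def)
qed

theorem theorem5p7:
  fixes p \<alpha> \<beta> \<rho>_lo \<rho>_hi :: real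
    and a_eps \<rho>_eps :: "real \<Rightarrow> real \<Rightarrow> real"
    and a \<rho> :: "real \<Rightarrow> real"
    and k :: nat
  assumes "1 < p"
    and "0 < \<alpha>" and "0 < \<rho>_lo"
    and "\<And>\<epsilon>. 0 < \<epsilon> \<Longrightarrow> a_eps \<epsilon> \<in> borel_measurable unit_meas"
    and "\<And>\<epsilon>. 0 < \<epsilon> \<Longrightarrow> AE x in unit_meas. \<alpha> \<le> a_eps \<epsilon> x \<and> a_eps \<epsilon> x \<le> \<beta>"
    and "\<And>\<epsilon>. 0 < \<epsilon> \<Longrightarrow> \<rho>_eps \<epsilon> \<in> borel_measurable unit_meas"
    and "\<And>\<epsilon>. 0 < \<epsilon> \<Longrightarrow> AE x in unit_meas. \<rho>_lo \<le> \<rho>_eps \<epsilon> x \<and> \<rho>_eps \<epsilon> x \<le> \<rho>_hi"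
    and "a \<in> borel_measurable unit_meas"
    and "\<exists>c C. 0 < c \<and> (AE x in unit_meas. c \<le> a x \<and> a x \<le> C)"
    and "G_converges p a_eps a"
    and "weak_star_conv_Linf \<rho>_eps \<rho> (at_right 0)"
    and "1 \<le> k"
  shows "((\<lambda>\<epsilon>. eigenvalue p (a_eps \<epsilon>) (\<rho>_eps \<epsilon>) k) \<longlongrightarrow> eigenvalue p a \<rho> k) (at_right 0)
    \<and> (\<forall>u :: real \<Rightarrow> real \<Rightarrow> real.
         (\<forall>\<epsilon>>0. eigenfunction p (a_eps \<epsilon>) (\<rho>_eps \<epsilon>) (eigenvalue p (a_eps \<epsilon>) (\<rho>_eps \<epsilon>) k) (u \<epsilon>)
                 \<and> Lp_norm p (u \<epsilon>) = 1) \<longrightarrow>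
         (\<forall>e :: nat \<Rightarrow> real. (\<forall>n. 0 < e n) \<and> e \<longlonglongrightarrow> 0 \<longrightarrow>
            (\<exists>r uk. strict_mono r
                 \<and> eigenfunction p a \<rho> (eigenvalue p a \<rho> k) uk
                 \<and> weak_conv_W01p p (\<lambda>n. u (e (r n))) uk sequentially)))"
proof -
  note p = assms(1)
  obtain c C where c: "0 < c" "AE x in unit_meas. c \<le> a x \<and> a x \<le> C" using assms(9) by blast
  \<comment> \<open>Common bounds for the coefficients of the family and of the limit.\<close>
  define l where "l = min \<alpha> c"
  define h where "h = max \<beta> C"
  have l: "0 < l" using assms(2) c(1) by (simp add: l_def)
  have ae: "bounded_between l h (a_eps \<epsilon>)" if "0 < \<epsilon>" for \<epsilon>
    by (rule bounded_between_mono[of \<alpha> \<beta>]) (use assms(4,5)[OF that] in \<open>auto simp: bounded_between_def l_def h_def\<close>)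
  have a: "bounded_between l h a"
    by (rule bounded_between_mono[of c C]) (use assms(8) c(2) in \<open>auto simp: bounded_between_def l_def h_def\<close>)
  have \<rho>e: "bounded_between \<rho>_lo \<rho>_hi (\<rho>_eps \<epsilon>)" if "0 < \<epsilon>" for \<epsilon> using assms(6,7)[OF that] by (simp add: bounded_between_def)
  have \<rho>: "bounded_between \<rho>_lo \<rho>_hi \<rho>" by (rule weak_star_limit_bounded_between[OF \<rho>e assms(11)])
  have la: "((\<lambda>\<epsilon>. prim (compliance p (a_eps \<epsilon>)) x) \<longlongrightarrow> prim (compliance p a) x) (at_right 0)" if x: "0 \<le> x" "x \<le> 1" for x
  proof -
    consider "x = 0" | "0 < x" "x < 1" | "x = 1" using x by linarith
    then show ?thesis
    proof cases
      case 1 then show ?thesis by (simp add: prim_0)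
    next
      case 2 show ?thesis by (rule G_converges_imp_prim_compliance(1)[OF p l ae a assms(10) 2])
    next
      case 3 then show ?thesis using G_converges_imp_prim_compliance(2)[OF p l ae a assms(10), of "1/2"] by simp
    qed
  qed
  let ?lam = "\<lambda>\<epsilon>. eigenvalue p (a_eps \<epsilon>) (\<rho>_eps \<epsilon>) k" and ?limit = "eigenvalue p a \<rho> k"
  have conv: "(?lam \<longlongrightarrow> ?limit) (at_right 0)"
    by (rule eigenvalue_tendsto[OF p l assms(3) ae a \<rho>e \<rho> la weak_star_prim[OF assms(11)] assms(12)])
  show ?thesis
  proof (intro conjI conv allI impI, elim conjE)
    fix u :: "real \<Rightarrow> real \<Rightarrow> real" and e :: "nat \<Rightarrow> real"
    assume u: "\<forall>\<epsilon>>0. eigenfunction p (a_eps \<epsilon>) (\<rho>_eps \<epsilon>) (?lam \<epsilon>) (u \<epsilon>) \<and> Lp_norm p (u \<epsilon>) = 1"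
      and e: "\<forall>n. 0 < e n" "e \<longlonglongrightarrow> 0"
    define t where "t \<epsilon> = real_of_ereal (?lam \<epsilon>)" for \<epsilon>
    have t: "?lam \<epsilon> = ereal (t \<epsilon>)" if "0 < \<epsilon>" for \<epsilon>
      using u that unfolding eigenfunction_def t_def by auto
    \<comment> \<open>One finite eigenvalue of the family, here for parameter 1, makes the limit eigenvalue finite.\<close>
    have "?limit \<le> ereal ((h * \<rho>_hi / (l * \<rho>_lo)) * \<bar>t 1 + 1\<bar>)"
      by (rule eigenvalue_finite_transfer[OF p ae[of 1] l \<rho>e[of 1] assms(3) a \<rho>]) (use t[of 1] in auto)
    moreover have "0 \<le> ?limit" by (rule eigenvalue_nonneg[OF a _ \<rho> _ assms(12)]) (use l assms(3) in auto)
    ultimately obtain L where L: "?limit = ereal L" by (cases ?limit) auto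
    have ef: "filterlim e (at_right 0) sequentially"
      unfolding filterlim_at using e less_imp_neq[of 0 "e _", symmetric] by (auto intro!: always_eventually)
    have "(\<lambda>n. ?lam (e n)) \<longlonglongrightarrow> ereal L" using filterlim_compose[OF conv ef] by (simp add: L)
    then have lim: "(\<lambda>n. t (e n)) \<longlonglongrightarrow> L" using t e(1) by simp
    obtain r uk where "strict_mono r" "eigenfunction p a \<rho> (ereal L) uk" "weak_conv_W01p p (\<lambda>n. u (e (r n))) uk sequentially"
      by (rule eigenfunctions_converge[OF p l assms(3) ae a \<rho>e \<rho> assms(10,11) _ _ _ e(2) lim, of u]) (use u t e(1) in auto)
    then show "\<exists>r uk. strict_mono r \<and> eigenfunction p a \<rho> ?limit uk \<and> weak_conv_W01p p (\<lambda>n. u (e (r n))) uk sequentially"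
      unfolding L by blast
  qed
qed

end
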